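(* Let $n\ge2$. The horofunction compactification of $\mathcal{T}(n)$ with respect to the Weil-Petersson metric is the visual compactification, i.e. it is isomorphic, as a compactification, to the visual compactification of $\mathcal{T}(n)\cong\mathcal{P}_n$ (the compactification by equivalence classes of asymptotic geodesic rays with the cone topology, taken with respect to the Weil-Petersson metric).
   Context: Let $\mathbb{T}^n=\mathbb{R}^n/\mathbb{Z}^n$. $\mathcal{T}(n)$ is the Teichmüller space of marked flat $n$-tori of unit volume, identified with the space $\mathcal{P}_n$ of real symmetric positive-definite $n\times n$ matrices $g$ of determinant 1, each viewed as a flat unit volume Riemannian metric with constant coefficients on $\mathbb{T}^n$; $\mathcal{P}_n\cong\mathrm{SL}(n,\mathbb{R})/\mathrm{SO}(n)$ via $a\,\mathrm{SO}(n)\mapsto aa^T$. Weil-Petersson metric: the tangent space to the space of all Riemannian metrics on $\mathbb{T}^n$ at $g$ consists of smooth symmetric $(0,2)$-tensors, with the $L^2$-pairing $\langle\langle h_1,h_2\rangle\rangle_{L^2(g)}=\int_{\mathbb{T}^n}\mathrm{Tr}(g^{-1}h_1g^{-1}h_2)\,d\mu_g$. $T_g\mathcal{T}(n)$ is represented by the trace-free, divergence-free tensors tangent to the unit volume flat metrics, namely the constant symmetric matrices $h$ with $\mathrm{Tr}(g^{-1}h)=0$. The Weil-Petersson metric is the Riemannian metric on $\mathcal{T}(n)$ obtained by restricting the $L^2$-pairing to these tensors. Horofunction compactification of a proper metric space $(X,d)$: let $\tilde C(X)$ be the quotient by constants of the space of continuous real functions with the topology of uniform convergence on compact sets; the compactification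 is the closure in $\tilde C(X)$ of the image of $z\mapsto[\psi_z]$, $\psi_z(x)=d(x,z)$. Two compactifications $i_j:X\to\overline X_j$ are isomorphic if there is a homeomorphism $\phi:\overline X_1\to\overline X_2$ with $\phi\circ i_1=i_2$. *)

theory Defs
  imports "HOL-Analysis.Analysis"
begin

section \<open>Compactifications\<close>

definition compactification :: "'a topology \<Rightarrow> 'b topology \<Rightarrow> ('a \<Rightarrow> 'b) \<Rightarrow> bool" where
  "compactification X Y i \<longleftrightarrow>
     compact_space Y \<and> Hausdorff_space Y \<and> embedding_map X Y i \<and>
     Y closure_of (i ` topspace X) = topspace Y"

definition isomorphic_compactifications ::
    "'a topology \<Rightarrow> 'b topology \<Rightarrow> ('a \<Rightarrow> 'b) \<Rightarrow> 'c topology \<Rightarrow> ('a \<Rightarrow> 'c) \<Rightarrow> bool" where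
  "isomorphic_compactifications X Y\<^sub>1 i\<^sub>1 Y\<^sub>2 i\<^sub>2 \<longleftrightarrow>
     compactification X Y\<^sub>1 i\<^sub>1 \<and> compactification X Y\<^sub>2 i\<^sub>2 \<and>
     (\<exists>\<phi>. homeomorphic_map Y\<^sub>1 Y\<^sub>2 \<phi> \<and> (\<forall>x \<in> topspace X. \<phi> (i\<^sub>1 x) = i\<^sub>2 x))"

context Metric_space
begin

section \<open>The horofunction compactification\<close>

text \<open>Functions on \<open>M\<close> are represented by their extensional extensions to the whole type, so
  that equality of representatives is equality on \<open>M\<close>.\<close>

definition continuous_funs :: "('a \<Rightarrow> real) set" where
  "continuous_funs = {f \<in> extensional M. continuous_map mtopology euclideanreal f}"

definition compact_convergence :: "('a \<Rightarrow> real) topology" where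
  "compact_convergence = topology (\<lambda>U. U \<subseteq> continuous_funs \<and>
     (\<forall>f\<in>U. \<exists>K \<epsilon>. compactin mtopology K \<and> 0 < \<epsilon> \<and>
        {g \<in> continuous_funs. \<forall>x\<in>K. \<bar>g x - f x\<bar> < \<epsilon>} \<subseteq> U))"

lemma openin_compact_convergence:
  "openin compact_convergence U \<longleftrightarrow> U \<subseteq> continuous_funs \<and>
     (\<forall>f\<in>U. \<exists>K \<epsilon>. compactin mtopology K \<and> 0 < \<epsilon> \<and>
        {g \<in> continuous_funs. \<forall>x\<in>K. \<bar>g x - f x\<bar> < \<epsilon>} \<subseteq> U)"
proof -
  let ?P = "\<lambda>U. U \<subseteq> continuous_funs \<and> (\<forall>f\<in>U. \<exists>K \<epsilon>. compactin mtopology K \<and> 0 < \<epsilon> \<and>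
        {g \<in> continuous_funs. \<forall>x\<in>K. \<bar>g x - f x\<bar> < \<epsilon>} \<subseteq> U)"
  have "istopology ?P"
    unfolding istopology_def
  proof (intro conjI allI impI)
    fix S T assume S: "?P S" and T: "?P T"
    show "S \<inter> T \<subseteq> continuous_funs" using S by blast
    show "\<forall>f\<in>S \<inter> T. \<exists>K \<epsilon>. compactin mtopology K \<and> 0 < \<epsilon> \<and>
        {g \<in> continuous_funs. \<forall>x\<in>K. \<bar>g x - f x\<bar> < \<epsilon>} \<subseteq> S \<inter> T"
    proof
      fix f assume f: "f \<in> S \<inter> T"
      obtain K \<epsilon> where K: "compactin mtopology K" "0 < \<epsilon>"
          "{g \<in> continuous_funs. \<forall>x\<in>K. \<bar>g x - f x\<bar> < \<epsilon>} \<subseteq> S"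
        using S f by blast
      obtain L \<delta> where L: "compactin mtopology L" "0 < \<delta>"
          "{g \<in> continuous_funs. \<forall>x\<in>L. \<bar>g x - f x\<bar> < \<delta>} \<subseteq> T"
        using T f by blast
      have "{g \<in> continuous_funs. \<forall>x\<in>K \<union> L. \<bar>g x - f x\<bar> < min \<epsilon> \<delta>} \<subseteq> S \<inter> T"
        using K(3) L(3) by auto
      moreover have "compactin mtopology (K \<union> L)"
        using K(1) L(1) by (rule compactin_Un)
      ultimately show "\<exists>K \<epsilon>. compactin mtopology K \<and> 0 < \<epsilon> \<and>
        {g \<in> continuous_funs. \<forall>x\<in>K. \<bar>g x - f x\<bar> < \<epsilon>} \<subseteq> S \<inter> T"
        using K(2) L(2) by (intro exI[of _ "K \<union> L"] exI[of _ "min \<epsilon> \<delta>"]) auto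
    qed
  next
    fix \<K> assume \<K>: "\<forall>U\<in>\<K>. ?P U"
    show "\<Union>\<K> \<subseteq> continuous_funs" using \<K> by blast
    show "\<forall>f\<in>\<Union>\<K>. \<exists>K \<epsilon>. compactin mtopology K \<and> 0 < \<epsilon> \<and>
        {g \<in> continuous_funs. \<forall>x\<in>K. \<bar>g x - f x\<bar> < \<epsilon>} \<subseteq> \<Union>\<K>"
      using \<K> by (meson Union_iff Union_upper subset_trans)
  qed
  then show ?thesis
    by (simp add: compact_convergence_def topology_inverse')
qed

definition differ_by_const :: "(('a \<Rightarrow> real) \<times> ('a \<Rightarrow> real)) set" where
  "differ_by_const = {(f, g). f \<in> continuous_funs \<and> g \<in> continuous_funs \<and>
     (\<exists>c. \<forall>x\<in>M. g x = f x + c)}"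

text \<open>The quotient topology on the space of continuous functions modulo constants.\<close>

definition funs_mod_const :: "('a \<Rightarrow> real) set topology" where
  "funs_mod_const = topology (\<lambda>V. V \<subseteq> continuous_funs // differ_by_const \<and>
     openin compact_convergence {f \<in> continuous_funs. differ_by_const `` {f} \<in> V})"

lemma openin_funs_mod_const:
  "openin funs_mod_const V \<longleftrightarrow> V \<subseteq> continuous_funs // differ_by_const \<and>
     openin compact_convergence {f \<in> continuous_funs. differ_by_const `` {f} \<in> V}"
proof -
  let ?pre = "\<lambda>V. {f \<in> continuous_funs. differ_by_const `` {f} \<in> V}"
  have Int: "?pre (S \<inter> T) = ?pre S \<inter> ?pre T" for S T by blast
  have Un: "?pre (\<Union>\<K>) = (\<Union>V\<in>\<K>. ?pre V)" for \<K> by blast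
  have "istopology (\<lambda>V. V \<subseteq> continuous_funs // differ_by_const \<and>
     openin compact_convergence (?pre V))"
    unfolding istopology_def Int Un by (auto intro!: openin_Int openin_Union)
  then show ?thesis
    by (simp add: funs_mod_const_def topology_inverse')
qed

definition horo_embedding :: "'a \<Rightarrow> ('a \<Rightarrow> real) set" where
  "horo_embedding z = differ_by_const `` {restrict (\<lambda>x. d x z) M}"

definition horofunction_space :: "('a \<Rightarrow> real) set topology" where
  "horofunction_space =
     subtopology funs_mod_const (funs_mod_const closure_of (horo_embedding ` M))"

section \<open>The visual compactification\<close>

text \<open>Only the values at nonnegative times matter for a ray; two functions that agree there
  define the same point at infinity.\<close>

definition geodesic_ray :: "(real \<Rightarrow> 'a) \<Rightarrow> bool" where
  "geodesic_ray c \<longleftrightarrow> c ` {0..} \<subseteq> M \<and> (\<forall>s\<ge>0. \<forall>t\<ge>0. d (c s) (c t) = \<bar>s - t\<bar>)"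

definition geodesic_segment :: "(real \<Rightarrow> 'a) \<Rightarrow> 'a \<Rightarrow> 'a \<Rightarrow> bool" where
  "geodesic_segment c x y \<longleftrightarrow> c ` {0..d x y} \<subseteq> M \<and> c 0 = x \<and> c (d x y) = y \<and>
     (\<forall>s\<in>{0..d x y}. \<forall>t\<in>{0..d x y}. d (c s) (c t) = \<bar>s - t\<bar>)"

definition asymptotic :: "((real \<Rightarrow> 'a) \<times> (real \<Rightarrow> 'a)) set" where
  "asymptotic = {(c, c'). geodesic_ray c \<and> geodesic_ray c' \<and>
     (\<exists>B. \<forall>t\<ge>0. d (c t) (c' t) \<le> B)}"

definition visual_boundary :: "(real \<Rightarrow> 'a) set set" where
  "visual_boundary = {c. geodesic_ray c} // asymptotic"

text \<open>The basic neighbourhood \<open>{y. d (c 0) y > r, d (p\<^sub>r y) (c r) < \<epsilon>}\<close> of the endpoint of \<open>c\<close>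
  in the cone topology, where \<open>p\<^sub>r y\<close> is the point at distance \<open>r\<close> from \<open>c 0\<close> on the geodesic
  from \<open>c 0\<close> to \<open>y\<close>. In a Hadamard manifold, that geodesic exists and is unique both for points
  \<open>y\<close> of the space and for points at infinity, so the existential quantifiers just name it.\<close>

definition cone_neighbourhood ::
    "(real \<Rightarrow> 'a) \<Rightarrow> real \<Rightarrow> real \<Rightarrow> ('a + (real \<Rightarrow> 'a) set) set" where
  "cone_neighbourhood c r \<epsilon> =
     Inl ` {y \<in> M. r < d (c 0) y \<and> (\<exists>\<sigma>. geodesic_segment \<sigma> (c 0) y \<and> d (\<sigma> r) (c r) < \<epsilon>)} \<union>
     Inr ` {\<xi> \<in> visual_boundary. \<exists>c'\<in>\<xi>. c' 0 = c 0 \<and> d (c' r) (c r) < \<epsilon>}"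

text \<open>The cone topology on the disjoint union of \<open>M\<close> and its visual boundary; the rays \<open>c\<close> range
  over all base points \<open>c 0\<close>. The space \<open>M\<close> is embedded by \<open>Inl\<close>.\<close>

definition visual_space :: "('a + (real \<Rightarrow> 'a) set) topology" where
  "visual_space = topology_generated_by
     ({Inl ` U | U. openin mtopology U} \<union>
      {cone_neighbourhood c r \<epsilon> | c r \<epsilon>. geodesic_ray c \<and> 0 < r \<and> 0 < \<epsilon>})"

end

section \<open>The Weil-Petersson metric on the Teichmueller space of flat tori\<close>

definition flat_torus_teich :: "(real^'n^'n) set" where
  "flat_torus_teich =
     {g. transpose g = g \<and> (\<forall>x. x \<noteq> 0 \<longrightarrow> 0 < x \<bullet> (g *v x)) \<and> det g = 1}"

text \<open>Tensor fields on the torus are periodic matrix-valued functions of \<open>x \<in> \<real>\<^sup>n\<close>; integration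
  over the torus is integration over the unit cube, and \<open>d\<mu>\<^sub>g = sqrt (det g) dx\<close>.\<close>

definition L2_pairing ::
    "(real^'n \<Rightarrow> real^'n^'n) \<Rightarrow> (real^'n \<Rightarrow> real^'n^'n) \<Rightarrow> (real^'n \<Rightarrow> real^'n^'n) \<Rightarrow> real" where
  "L2_pairing g h\<^sub>1 h\<^sub>2 = integral (cbox 0 1)
     (\<lambda>x. trace (matrix_inv (g x) ** h\<^sub>1 x ** matrix_inv (g x) ** h\<^sub>2 x) * sqrt (det (g x)))"

text \<open>The tangent space at \<open>g\<close> consists of the constant symmetric \<open>h\<close> with
  \<open>trace (matrix_inv g ** h) = 0\<close>. Velocities of curves in \<^const>\<open>flat_torus_teich\<close> lie in it
  automatically, so this condition need not be imposed on the arguments.\<close>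

definition wp_inner :: "real^'n^'n \<Rightarrow> real^'n^'n \<Rightarrow> real^'n^'n \<Rightarrow> real" where
  "wp_inner g h\<^sub>1 h\<^sub>2 = L2_pairing (\<lambda>_. g) (\<lambda>_. h\<^sub>1) (\<lambda>_. h\<^sub>2)"

lemma wp_inner_eq:
  fixes g :: "real^'n^'n"
  assumes "g \<in> flat_torus_teich"
  shows "wp_inner g h\<^sub>1 h\<^sub>2 = trace (matrix_inv g ** h\<^sub>1 ** matrix_inv g ** h\<^sub>2)"
proof -
  have "measure lborel (cbox (0 :: real^'n) 1) = 1"
    by (subst content_cbox_cart) (auto simp: interval_ne_empty_cart)
  then show ?thesis
    using assms by (simp add: wp_inner_def L2_pairing_def flat_torus_teich_def)
qed

definition wp_speed :: "(real \<Rightarrow> real^'n^'n) \<Rightarrow> real \<Rightarrow> real" where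
  "wp_speed \<gamma> t =
     sqrt (wp_inner (\<gamma> t) (vector_derivative \<gamma> (at t)) (vector_derivative \<gamma> (at t)))"

text \<open>A \<^const>\<open>valid_path\<close> may have unbounded derivative near its finitely many exceptional
  points, and \<^const>\<open>integral\<close> is 0 on nonintegrable functions; the integrability condition
  excludes the resulting curves of infinite length.\<close>

definition wp_lengths :: "real^'n^'n \<Rightarrow> real^'n^'n \<Rightarrow> real set" where
  "wp_lengths a b = {integral {0..1} (wp_speed \<gamma>) | \<gamma>.
     valid_path \<gamma> \<and> path_image \<gamma> \<subseteq> flat_torus_teich \<and> pathstart \<gamma> = a \<and> pathfinish \<gamma> = b \<and>
     wp_speed \<gamma> integrable_on {0..1}}"

text \<open>The value outside \<^const>\<open>flat_torus_teich\<close> is irrelevant; it is set to 0 because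
  \<^locale>\<open>Metric_space\<close> requires nonnegativity and symmetry on the whole type.\<close>

definition wp_dist :: "real^'n^'n \<Rightarrow> real^'n^'n \<Rightarrow> real" where
  "wp_dist a b =
     (if a \<in> flat_torus_teich \<and> b \<in> flat_torus_teich then Inf (wp_lengths a b) else 0)"

end

(* The entry point is a discrete form of the exponential metric increasing property: for positive
   definite a, b, in eigenbases of a and b, the inequality (ln y - ln x)^2 <= (y - x)^2 / (x y) for
   pairs of eigenvalues gives ||log b - log a||^2 <= tr (a^-1 (b - a) b^-1 (b - a)). Summed along a
   path it shows that the logarithm, in any frame, shortens Weil-Petersson length; since it is
   isometric along the geodesics through the identity, the distance is explicit, and comparing a
   triangle with its logarithm in the frame of a point of one side yields Stewart's inequality.
   Thus the space is a proper CAT(0) space.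

   In a proper CAT(0) space the function d(x, y) - d(o, y) of x is determined, up to an error
   A^2 / (r - A) with A = d(o, x), by the point at distance r from o on the geodesic from o to y.
   Conversely that point is, up to an error that vanishes with e, any point within distance r of o
   where the function is at most e - r. So convergence of horofunctions is convergence of
   directions. *)

theory Submission
  imports Defs
begin

text \<open>The logarithm is never differentiated. The finite-difference inequality, divided by the
  squared time step, tends to the squared speed, and a mean value argument for the gauge integral
  turns this local slope bound into a length bound, also across the corners of a path. The two
  compactifications are not compared directly. Both are matched with one model: the functions
  \<open>visual_fun w\<close>, which vanish at a base point, with pointwise convergence. They are
  1-Lipschitz, so pointwise and compact convergence agree, and Tychonoff's theorem gives
  compactness. The obstacle is the base point: cone neighbourhoods are seen from the origins of all
  rays, whereas the model functions are normalized at a single point. The bridge is that two rays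
  are asymptotic exactly when their Busemann functions differ by a constant. One direction rests on
  contracting a gap of order sqrt R by the factor r / R, the other on the fact that geodesics to a
  common target get no further apart than they start.\<close>

section \<open>Diagonalization and the logarithm of positive definite matrices\<close>

text \<open>A maximum point of the quadratic form of \<open>f\<close> on the unit sphere of
  \<open>S\<close> is an eigenvector, and self-adjointness makes its orthogonal complement in
  \<open>S\<close> invariant, so induction on the dimension applies.\<close>

lemma selfadjoint_eigenbasis:
  fixes f :: "'a::euclidean_space \<Rightarrow> 'a"
  assumes lin: "linear f" and sym: "\<And>x y. x \<bullet> f y = f x \<bullet> y"
    and "subspace S" "f ` S \<subseteq> S"
  shows "\<exists>B \<subseteq> S. finite B \<and> card B = dim S \<and> pairwise orthogonal B \<and>
           (\<forall>b\<in>B. norm b = 1 \<and> (\<exists>c. f b = c *\<^sub>R b))"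
  using assms(3,4)
proof (induction "dim S" arbitrary: S)
  case 0
  then show ?case by (intro exI[of _ "{}"]) auto
next
  case (Suc k)
  have "S \<noteq> {0}" using Suc.hyps(2) by auto
  then obtain y where y: "y \<in> S" "y \<noteq> 0"
    using subspace_0[OF Suc.prems(1)] by blast
  let ?C = "S \<inter> sphere 0 1"
  have "compact ?C"
    by (simp add: closed_Int_compact closed_subspace Suc.prems(1))
  moreover have "y /\<^sub>R norm y \<in> ?C"
    using y Suc.prems(1) by (simp add: subspace_scale)
  moreover have "continuous_on ?C (\<lambda>v. v \<bullet> f v)"
    by (intro continuous_intros linear_continuous_on linear_conv_bounded_linear[THEN iffD1] lin)
  ultimately obtain x where x: "x \<in> ?C" and max: "\<And>v. v \<in> ?C \<Longrightarrow> v \<bullet> f v \<le> x \<bullet> f x"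
    using continuous_attains_sup[of ?C "\<lambda>v. v \<bullet> f v"] by blast
  define m where "m = x \<bullet> f x"
  have xS: "x \<in> S" and nx: "x \<bullet> x = 1" using x by (auto simp: norm_eq_1)
  have q: "0 \<le> m * (v \<bullet> v) - v \<bullet> f v" if "v \<in> S" for v
  proof (cases "v = 0")
    case True
    then show ?thesis by simp
  next
    case False
    have "v /\<^sub>R norm v \<in> ?C" using that False Suc.prems(1) by (simp add: subspace_scale)
    from max[OF this] have "(v \<bullet> f v) / (norm v)\<^sup>2 \<le> m"
      using lin by (simp add: m_def linear_scale power2_eq_square divide_simps)
    then show ?thesis using False by (simp add: divide_simps dot_square_norm)
  qed
  \<comment> \<open>The form \<open>m * (v \<bullet> v) - v \<bullet> f v\<close> is nonnegative on
    \<open>S\<close> and zero at \<open>x\<close>, so its gradient there, twice \<open>w\<close>,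
    must vanish.\<close>
  have "m *\<^sub>R x - f x = 0"
  proof -
    define w where "w = m *\<^sub>R x - f x"
    have wS: "w \<in> S" unfolding w_def using xS Suc.prems
      by (auto intro!: subspace_diff subspace_scale)
    define c where "c = m * (w \<bullet> w) - w \<bullet> f w"
    have *: "0 \<le> 2 * t * (w \<bullet> w) + t\<^sup>2 * c" for t
    proof -
      have "x + t *\<^sub>R w \<in> S" using xS wS Suc.prems(1) by (simp add: subspace_add subspace_scale)
      from q[OF this] show ?thesis
        using sym[of x w] sym[of w x] nx
        by (simp add: c_def linear_add[OF lin] linear_scale[OF lin] m_def[symmetric] w_def inner_diff_left
          inner_diff_right linear_diff[OF lin] algebra_simps inner_commute power2_eq_square)
    qed
    have "w \<bullet> w = 0"
    proof (rule ccontr)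
      assume "w \<bullet> w \<noteq> 0"
      then have wp: "w \<bullet> w > 0" by (metis inner_gt_zero_iff inner_eq_zero_iff)
      \<comment> \<open>A small step against the gradient makes the linear term beat the quadratic
        one. Using \<open>\<bar>c\<bar> + 1\<close> for \<open>c\<close> avoids a sign distinction
        and a zero denominator.\<close>
      define t where "t = - (w \<bullet> w) / (\<bar>c\<bar> + 1)"
      have "2 * t * (w \<bullet> w) + t\<^sup>2 * c \<le> 2 * t * (w \<bullet> w) + t\<^sup>2 * (\<bar>c\<bar> + 1)"
        by (intro add_left_mono mult_left_mono) auto
      also have "\<dots> = - (w \<bullet> w)\<^sup>2 / (\<bar>c\<bar> + 1)"
      proof -
        have "\<bar>c\<bar> + 1 \<noteq> 0" by linarith
        then show ?thesis by (simp add: t_def power2_eq_square divide_simps)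
      qed
      also have "\<dots> < 0" using wp by (simp add: divide_neg_pos)
      finally show False using *[of t] by linarith
    qed
    then show ?thesis by (simp add: w_def)
  qed
  then have fx: "f x = m *\<^sub>R x" by simp
  define S' where "S' = {y \<in> S. \<forall>v\<in>span {x}. orthogonal v y}"
  have S'eq: "S' = {y \<in> S. orthogonal x y}"
    unfolding S'_def using orthogonal_clauses(1)
    by (auto simp: span_singleton span_base orthogonal_def)
  have "x \<noteq> 0" using nx by auto
  have "dim S' + dim (span {x}) = dim S"
    unfolding S'_def by (rule dim_subspace_orthogonal_to_vectors) (use xS Suc.prems(1) in \<open>auto simp: span_minimal\<close>)
  then have dS': "dim S = Suc (dim S')" using \<open>x \<noteq> 0\<close> by simp
  have "subspace S'" unfolding S'eq using Suc.prems(1)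
    by (auto simp: subspace_def orthogonal_def inner_add_right)
  moreover have "f ` S' \<subseteq> S'" unfolding S'eq using Suc.prems(2) sym[of x] fx
    by (auto simp: orthogonal_def)
  ultimately obtain B where B: "B \<subseteq> S'" "finite B" "card B = dim S'" "pairwise orthogonal B"
      "\<forall>b\<in>B. norm b = 1 \<and> (\<exists>c. f b = c *\<^sub>R b)"
    using Suc.hyps(1)[of S'] Suc.hyps(2) dS' by auto
  have "x \<notin> B" using B(1) nx unfolding S'eq orthogonal_def by auto
  then show ?case using B xS dS' fx x unfolding S'eq
    by (intro exI[of _ "insert x B"]) (auto simp: pairwise_insert orthogonal_commute)
qed

section \<open>Diagonal matrices, orthogonal diagonalization and the Frobenius norm\<close>

definition diagm :: "('n \<Rightarrow> real) \<Rightarrow> real^'n^'n" where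
  "diagm l = (\<chi> i j. if i = j then l i else 0)"

lemma diagm_nth: "diagm l $ i $ j = (if i = j then l i else 0)"
  by (simp add: diagm_def)

lemma matrix_mult_diagm_nth: "(A ** diagm l) $ i $ j = A $ i $ j * l j"
  by (simp add: matrix_matrix_mult_def diagm_nth if_distrib cong: if_cong)

lemma diagm_mult_matrix_nth: "(diagm l ** A) $ i $ j = l i * A $ i $ j"
  by (simp add: matrix_matrix_mult_def diagm_nth if_distrib[of "\<lambda>x. x * _"] cong: if_cong)

lemma diagm_mult: "diagm a ** diagm b = diagm (\<lambda>i. a i * b i)"
  by (simp add: vec_eq_iff matrix_mult_diagm_nth) (simp add: diagm_nth)

lemma transpose_diagm [simp]: "transpose (diagm a) = diagm a"
  by (simp add: vec_eq_iff transpose_def diagm_nth)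

lemma det_diagm: "det (diagm l) = prod l UNIV"
  by (subst det_diagonal) (auto simp: diagm_nth)

lemma trace_diagm: "trace (diagm l) = sum l UNIV"
  by (simp add: trace_def diagm_nth)

lemma diagm_1: "diagm (\<lambda>_. 1) = mat 1"
  by (simp add: vec_eq_iff diagm_nth mat_def)

lemma symmetric_matrix_diagonalization:
  fixes A :: "real^'n^'n"
  assumes "transpose A = A"
  obtains U l where "orthogonal_matrix U" "A = U ** diagm l ** transpose U"
proof -
  have "x \<bullet> (A *v y) = (A *v x) \<bullet> y" for x y
    by (subst dot_lmul_matrix[symmetric]) (simp add: assms flip: transpose_matrix_vector)
  from selfadjoint_eigenbasis[OF matrix_vector_mul_linear this, of UNIV]
  have "\<exists>B. finite B \<and> card B = dim (UNIV :: (real^'n) set) \<and> pairwise orthogonal B \<and>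
           (\<forall>b\<in>B. norm b = 1 \<and> (\<exists>c. A *v b = c *\<^sub>R b))"
    by auto
  then obtain B :: "(real^'n) set" where B: "finite B" "card B = CARD('n)" "pairwise orthogonal B"
      "\<forall>b\<in>B. norm b = 1 \<and> (\<exists>c. A *v b = c *\<^sub>R b)"
    by auto
  then obtain u where u: "bij_betw u (UNIV :: 'n set) B"
    using finite_same_card_bij[of "UNIV :: 'n set" B] by auto
  have "\<forall>i. \<exists>c. A *v u i = c *\<^sub>R u i" using B(4) u by (auto simp: bij_betw_def)
  then obtain l where l: "\<And>i. A *v u i = l i *\<^sub>R u i" by metis
  define U :: "real^'n^'n" where "U = (\<chi> i j. u j $ i)"
  have col: "column j U = u j" for j by (simp add: U_def column_def vec_eq_iff)
  have U: "orthogonal_matrix U"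
    unfolding orthogonal_matrix_orthonormal_columns col
    using B(3,4) u by (auto simp: bij_betw_def pairwise_def inj_def) metis
  have "A ** U = U ** diagm l"
    using l by (simp add: vec_eq_iff matrix_mult_diagm_nth)
      (simp add: U_def matrix_matrix_mult_def matrix_vector_mult_def mult.commute)
  then have "U ** diagm l ** transpose U = A ** (U ** transpose U)"
    by (simp add: matrix_mul_assoc)
  also have "\<dots> = A" using U by (simp add: orthogonal_matrix_def)
  finally show thesis using that[OF U] by metis
qed

lemma trace_mult_transpose: "trace (A ** transpose B) = (\<Sum>i\<in>UNIV. \<Sum>j\<in>UNIV. A $ i $ j * B $ i $ j)"
  by (simp add: trace_def matrix_matrix_mult_def transpose_def)

lemma norm_matrix_power2: "(norm (A :: real^'n^'m))\<^sup>2 = (\<Sum>i\<in>UNIV. \<Sum>j\<in>UNIV. (A $ i $ j)\<^sup>2)"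
  by (simp add: norm_vec_def L2_set_def sum_nonneg)

lemma norm_matrix_power2_trace: "(norm (A :: real^'n^'m))\<^sup>2 = trace (transpose A ** A)"
  unfolding norm_matrix_power2 trace_def matrix_matrix_mult_def transpose_def
  by (subst sum.swap) (simp add: power2_eq_square)

lemma norm_orthogonal_mult:
  fixes A U :: "real^'n^'n"
  assumes "orthogonal_matrix U"
  shows "norm (U ** A) = norm A" "norm (A ** U) = norm A"
proof -
  have 1: "norm (U ** A) = norm A" if "orthogonal_matrix U" for A U :: "real^'n^'n"
  proof -
    have "transpose (U ** A) ** (U ** A) = transpose A ** (transpose U ** U) ** A"
      by (simp add: matrix_transpose_mul matrix_mul_assoc)
    then have "(norm (U ** A))\<^sup>2 = (norm A)\<^sup>2"
      using that by (simp add: norm_matrix_power2_trace orthogonal_matrix_def)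
    then show ?thesis by simp
  qed
  have "(norm (transpose A))\<^sup>2 = (norm A)\<^sup>2" for A :: "real^'n^'n"
    by (simp add: norm_matrix_power2_trace trace_mul_sym[of A])
  then have t: "norm (transpose A) = norm A" for A :: "real^'n^'n"
    by simp
  show "norm (U ** A) = norm A" using 1 assms .
  show "norm (A ** U) = norm A"
    using 1[of "transpose U" "transpose A"] assms by (simp add: t flip: matrix_transpose_mul)
qed

lemma matrix_inv_unique:
  fixes A B :: "real^'n^'n"
  assumes "A ** B = mat 1"
  shows "matrix_inv A = B"
proof -
  have "B ** A = mat 1" using assms by (simp add: matrix_left_right_inverse)
  then have "A ** matrix_inv A = mat 1 \<and> matrix_inv A ** A = mat 1"
    unfolding matrix_inv_def
    using assms someI[of "\<lambda>A'. A ** A' = mat 1 \<and> A' ** A = mat 1" B] by blast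
  then have "B ** (A ** matrix_inv A) = B" by simp
  then show ?thesis by (simp add: matrix_mul_assoc \<open>B ** A = mat 1\<close>)
qed

lemma bounded_bilinear_matrix_mult:
  "bounded_bilinear ((**) :: real^'n^'m \<Rightarrow> real^'p^'n \<Rightarrow> real^'p^'m)"
  unfolding bilinear_conv_bounded_bilinear[symmetric] bilinear_def
  by (auto intro!: linearI simp: matrix_add_ldistrib vec_eq_iff matrix_matrix_mult_def distrib_left distrib_right sum.distrib sum_distrib_left mult_ac)

interpretation matrix_mult: bounded_bilinear "(**) :: real^'n^'m \<Rightarrow> real^'p^'n \<Rightarrow> real^'p^'m"
  by (rule bounded_bilinear_matrix_mult)

text \<open>With \<open>t = exp u\<close> this is \<open>2 * u \<le> 2 * sinh u\<close>.\<close>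

lemma ln_le_half_diff_inverse:
  fixes t :: real
  assumes "t \<ge> 1"
  shows "2 * ln t \<le> t - 1 / t"
proof -
  have "(\<lambda>t. t - 1 / t - 2 * ln t) 1 \<le> (\<lambda>t. t - 1 / t - 2 * ln t) t"
  proof (rule DERIV_nonneg_imp_nondecreasing[OF assms])
    fix x :: real assume "1 \<le> x"
    then show "\<exists>y. ((\<lambda>t. t - 1 / t - 2 * ln t) has_real_derivative y) (at x) \<and> 0 \<le> y"
      by (intro exI[of _ "(1 - 1 / x)\<^sup>2"] conjI, auto intro!: derivative_eq_intros)
        (simp add: field_simps power2_eq_square)
  qed
  then show ?thesis by simp
qed

text \<open>With \<open>t = sqrt (y / x)\<close> the left side is \<open>(2 * ln t)\<^sup>2\<close>
  and the right side is \<open>(t - 1 / t)\<^sup>2\<close>. Both sides are symmetric in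
  \<open>x\<close> and \<open>y\<close>, so \<open>x \<le> y\<close> may be assumed.\<close>

lemma ln_diff_power2_le:
  fixes x y :: real
  assumes "x > 0" "y > 0"
  shows "(ln y - ln x)\<^sup>2 \<le> (y - x)\<^sup>2 / (x * y)"
proof -
  have *: "(ln y - ln x)\<^sup>2 \<le> (y - x)\<^sup>2 / (x * y)" if "x > 0" "x \<le> y" for x y :: real
  proof -
    define t where "t = sqrt (y / x)"
    have "y > 0" using that by linarith
    then have t: "t \<ge> 1" "t\<^sup>2 = y / x" using that by (auto simp: t_def)
    have "ln y - ln x = 2 * ln t" using that \<open>y > 0\<close> by (simp add: t_def ln_sqrt ln_div)
    also have "\<dots> \<le> t - 1 / t" by (rule ln_le_half_diff_inverse[OF t(1)])
    finally have "(ln y - ln x)\<^sup>2 \<le> (t - 1 / t)\<^sup>2"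
      using that by (intro power_mono) auto
    also have "\<dots> = t\<^sup>2 - 2 + 1 / t\<^sup>2"
      using t(1) by (simp add: power2_diff power_divide)
    also have "\<dots> = (y - x)\<^sup>2 / (x * y)"
      unfolding t(2) using that \<open>y > 0\<close> by (simp add: field_simps power2_eq_square)
    finally show ?thesis .
  qed
  show ?thesis
    using *[of x y] *[of y x] assms
    by (cases "x \<le> y") (auto simp: power2_commute mult.commute)
qed

text \<open>In eigenbases \<open>u\<^sub>i\<close> of \<open>a\<close>
  and \<open>v\<^sub>j\<close> of \<open>b\<close> the entries of \<open>f b - f a\<close> are \<open>(f (m j) - f (l i)) * (u\<^sub>i \<bullet> v\<^sub>j)\<close> for every
  function \<open>f\<close>, so the estimate reduces to the scalar one for each pair of eigenvalues.\<close>

lemma log_metric_increasing: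
  fixes U V a b :: "real^'n^'n"
  assumes U: "orthogonal_matrix U" and V: "orthogonal_matrix V"
    and l: "\<And>i. l i > 0" and m: "\<And>i. m i > 0"
    and a: "a = U ** diagm l ** transpose U" and b: "b = V ** diagm m ** transpose V"
  shows "(norm (V ** diagm (\<lambda>i. ln (m i)) ** transpose V - U ** diagm (\<lambda>i. ln (l i)) ** transpose U))\<^sup>2
           \<le> trace (matrix_inv a ** (b - a) ** matrix_inv b ** (b - a))"
proof -
  define T where "T = transpose U ** V"
  have UU: "transpose U ** U = mat 1" "U ** transpose U = mat 1" "transpose V ** V = mat 1" "V ** transpose V = mat 1"
    using U V by (auto simp: orthogonal_matrix_def)
  have inv: "matrix_inv (W ** diagm k ** transpose W) = W ** diagm (\<lambda>i. 1 / k i) ** transpose W"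
    if "\<And>i. k i > 0" "transpose W ** W = mat 1" "W ** transpose W = mat 1" for W :: "real^'n^'n" and k
  proof (rule matrix_inv_unique)
    have "W ** diagm k ** transpose W ** (W ** diagm (\<lambda>i. 1 / k i) ** transpose W)
        = W ** (diagm k ** (transpose W ** W) ** diagm (\<lambda>i. 1 / k i)) ** transpose W"
      by (simp add: matrix_mul_assoc)
    also have "\<dots> = mat 1"
      using that(1)[THEN less_imp_neq] that by (simp add: diagm_mult diagm_1 eq_commute[of 0])
    finally show "W ** diagm k ** transpose W ** (W ** diagm (\<lambda>i. 1 / k i) ** transpose W) = mat 1" .
  qed
  \<comment> \<open>Stated for arbitrary \<open>k\<close> and \<open>k'\<close> because it is used
    twice with the same \<open>T\<close>: for the eigenvalues and for their logarithms.\<close>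
  have conj: "transpose U ** (V ** diagm k' ** transpose V - U ** diagm k ** transpose U) ** V
      = T ** diagm k' - diagm k ** T" for k k'
  proof -
    have "transpose U ** (V ** diagm k' ** transpose V - U ** diagm k ** transpose U) ** V
      = transpose U ** V ** diagm k' ** (transpose V ** V) - (transpose U ** U) ** diagm k ** transpose U ** V"
      by (simp only: matrix_mult.diff_left matrix_mult.diff_right matrix_mul_assoc)
    then show ?thesis by (simp add: UU T_def matrix_mul_assoc)
  qed
  define N where "N = T ** diagm m - diagm l ** T"
  have N: "transpose U ** (b - a) ** V = N" unfolding N_def a b by (rule conj)
  have "transpose a = a" "transpose b = b"
    by (simp_all add: a b matrix_transpose_mul matrix_mul_assoc)
  moreover have "transpose (b - a) = transpose b - transpose a" by (simp add: vec_eq_iff transpose_def)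
  ultimately have ab: "transpose (b - a) = b - a" by simp
  have N': "transpose V ** (b - a) ** U = transpose N"
    unfolding N[symmetric] by (simp add: matrix_transpose_mul ab matrix_mul_assoc)
  have "(norm (V ** diagm (\<lambda>i. ln (m i)) ** transpose V - U ** diagm (\<lambda>i. ln (l i)) ** transpose U))\<^sup>2
     = (norm (T ** diagm (\<lambda>i. ln (m i)) - diagm (\<lambda>i. ln (l i)) ** T))\<^sup>2"
    unfolding conj[symmetric] using U V by (simp add: norm_orthogonal_mult)
  also have "\<dots> = (\<Sum>i\<in>UNIV. \<Sum>j\<in>UNIV. (T $ i $ j)\<^sup>2 * (ln (m j) - ln (l i))\<^sup>2)"
    by (simp add: norm_matrix_power2 matrix_mult_diagm_nth diagm_mult_matrix_nth power_mult_distrib[symmetric] algebra_simps)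
  also have "\<dots> \<le> (\<Sum>i\<in>UNIV. \<Sum>j\<in>UNIV. (T $ i $ j)\<^sup>2 * ((m j - l i)\<^sup>2 / (l i * m j)))"
    by (intro sum_mono mult_left_mono ln_diff_power2_le l m) auto
  \<comment> \<open>The factors \<open>1 / l i\<close> and \<open>1 / m j\<close> are the
    eigenvalues of the two inverses, which turns the sum back into a trace.\<close>
  also have "\<dots> = (\<Sum>i\<in>UNIV. \<Sum>j\<in>UNIV. 1 / l i * (N $ i $ j)\<^sup>2 * (1 / m j))"
  proof (intro sum.cong refl)
    fix i j
    have "N $ i $ j = T $ i $ j * (m j - l i)"
      by (simp add: N_def matrix_mult_diagm_nth diagm_mult_matrix_nth algebra_simps)
    then show "(T $ i $ j)\<^sup>2 * ((m j - l i)\<^sup>2 / (l i * m j)) = 1 / l i * (N $ i $ j)\<^sup>2 * (1 / m j)"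
      by (simp add: power_mult_distrib)
  qed
  also have "\<dots> = trace (diagm (\<lambda>i. 1 / l i) ** N ** diagm (\<lambda>i. 1 / m i) ** transpose N)"
    by (simp add: trace_mult_transpose matrix_mult_diagm_nth diagm_mult_matrix_nth power2_eq_square mult_ac)
  also have "\<dots> = trace ((diagm (\<lambda>i. 1 / l i) ** transpose U ** (b - a) ** (V ** diagm (\<lambda>i. 1 / m i) ** transpose V) ** (b - a)) ** U)"
  proof -
    have "diagm (\<lambda>i. 1 / l i) ** N ** diagm (\<lambda>i. 1 / m i) ** transpose N
      = diagm (\<lambda>i. 1 / l i) ** (transpose U ** (b - a) ** V) ** diagm (\<lambda>i. 1 / m i) ** (transpose V ** (b - a) ** U)"
      by (simp only: N N')
    then show ?thesis by (simp only: matrix_mul_assoc)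
  qed
  also have "\<dots> = trace (U ** (diagm (\<lambda>i. 1 / l i) ** transpose U ** (b - a) ** (V ** diagm (\<lambda>i. 1 / m i) ** transpose V) ** (b - a)))"
    by (rule trace_mul_sym)
  also have "\<dots> = trace (matrix_inv a ** (b - a) ** matrix_inv b ** (b - a))"
    using inv[OF l] inv[OF m] UU by (simp add: a b matrix_mul_assoc)
  finally show ?thesis .
qed

section \<open>Unit-volume positive definite matrices under congruence\<close>

lemma inner_matrix_vector: "x \<bullet> (A *v y) = (transpose A *v x) \<bullet> (y :: real^'n)" for A :: "real^'n^'m"
  by (simp add: dot_lmul_matrix transpose_matrix_vector)

lemma inner_congruence: "x \<bullet> ((W ** A ** transpose W) *v x) = (transpose W *v x) \<bullet> (A *v (transpose W *v x))"
  for A W :: "real^'n^'n"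
  by (simp add: inner_matrix_vector matrix_vector_mul_assoc[symmetric] del: transpose_matrix_vector)

lemma inner_diagm: "x \<bullet> (diagm l *v x) = (\<Sum>i\<in>UNIV. l i * (x $ i)\<^sup>2)"
  by (simp add: inner_vec_def matrix_vector_mult_def diagm_nth if_distrib[of "\<lambda>x. x * _"] cong: if_cong)
    (simp add: power2_eq_square mult_ac)

lemma flat_torus_teich_diagm:
  fixes l :: "'n::finite \<Rightarrow> real"
  assumes "\<And>i. l i > 0" "prod l UNIV = 1"
  shows "diagm l \<in> flat_torus_teich"
  unfolding flat_torus_teich_def
proof (intro CollectI conjI allI impI)
  fix x :: "real^'n" assume "x \<noteq> 0"
  then obtain i where "x $ i \<noteq> 0" by (auto simp: vec_eq_iff)
  then show "0 < x \<bullet> (diagm l *v x)" unfolding inner_diagm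
    by (intro sum_pos2[of _ i]) (use assms(1) in \<open>auto simp: less_imp_le\<close>)
qed (use assms in \<open>auto simp: det_diagm\<close>)

text \<open>The condition squares the determinant because orthogonal eigenvector matrices may have
  determinant -1; the sign disappears in \<open>W ** A ** transpose W\<close>.\<close>

lemma flat_torus_teich_congruence:
  fixes A W :: "real^'n^'n"
  assumes "A \<in> flat_torus_teich" "(det W)\<^sup>2 = 1"
  shows "W ** A ** transpose W \<in> flat_torus_teich"
  unfolding flat_torus_teich_def
proof (intro CollectI conjI allI impI)
  have A: "transpose A = A" "\<And>x. x \<noteq> 0 \<Longrightarrow> 0 < x \<bullet> (A *v x)" "det A = 1"
    using assms(1) by (auto simp: flat_torus_teich_def)
  show "transpose (W ** A ** transpose W) = W ** A ** transpose W"
    by (simp add: matrix_transpose_mul A matrix_mul_assoc)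
  show "det (W ** A ** transpose W) = 1"
    using assms(2) by (simp add: det_mul A power2_eq_square)
  fix x :: "real^'n" assume x: "x \<noteq> 0"
  have "det (transpose W) \<noteq> 0" using assms(2) by auto
  then have "invertible (transpose W)" by (subst invertible_det_nz)
  then have "transpose W *v x \<noteq> 0" using x
    using inj_matrix_vector_mult[of "transpose W"] injD[of "(*v) (transpose W)" x 0] by (metis matrix_vector_mult_0_right)
  then show "0 < x \<bullet> ((W ** A ** transpose W) *v x)"
    unfolding inner_congruence by (rule A(2))
qed

lemma det_orthogonal_power2: "orthogonal_matrix U \<Longrightarrow> (det U)\<^sup>2 = (1 :: real)"
  using det_orthogonal_matrix[of U] by auto

lemma orthogonal_matrix_congruence_cancel:
  assumes "orthogonal_matrix (U :: real^'n^'n)"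
  shows "transpose U ** (U ** A ** transpose U) ** U = A"
proof -
  have "transpose U ** (U ** A ** transpose U) ** U = (transpose U ** U) ** A ** (transpose U ** U)"
    by (simp only: matrix_mul_assoc)
  then show ?thesis using assms by (simp add: orthogonal_matrix_def)
qed

lemma flat_torus_teich_diagmD:
  assumes "diagm l \<in> flat_torus_teich"
  shows "l i > 0" "prod l UNIV = 1"
proof -
  have "0 < axis i 1 \<bullet> (diagm l *v axis i 1)"
    using assms by (auto simp: flat_torus_teich_def axis_eq_0_iff)
  also have "\<dots> = l i"
    by (simp add: inner_diagm axis_def if_distrib[of "\<lambda>x. _ * x\<^sup>2"] cong: if_cong)
  finally show "l i > 0" .
  show "prod l UNIV = 1" using assms by (auto simp: flat_torus_teich_def det_diagm)
qed

lemma flat_torus_teich_diagonalization: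
  assumes "A \<in> flat_torus_teich"
  obtains U l where "orthogonal_matrix U" "\<And>i. l i > 0" "prod l UNIV = 1" "A = U ** diagm l ** transpose U"
proof -
  obtain U l where U: "orthogonal_matrix U" "A = U ** diagm l ** transpose U"
    using symmetric_matrix_diagonalization assms unfolding flat_torus_teich_def by blast
  have "transpose U ** A ** transpose (transpose U) \<in> flat_torus_teich"
    using U(1) by (intro flat_torus_teich_congruence assms) (simp add: det_orthogonal_power2)
  then have "diagm l \<in> flat_torus_teich"
    by (simp add: U orthogonal_matrix_congruence_cancel)
  from flat_torus_teich_diagmD[OF this] that[OF U(1) _ _ U(2)] show thesis by blast
qed

text \<open>Write \<open>a = R ** transpose R\<close>, diagonalize \<open>b\<close> in the frame
  \<open>R\<close> by an orthogonal \<open>V\<close>, and take \<open>W = R ** V\<close>: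
  \<open>V\<close> fixes the identity, so \<open>a\<close> keeps its form. Geometrically, one frame
  moves \<open>a\<close> to the identity and \<open>b\<close> into the flat of diagonal
  matrices.\<close>

lemma flat_torus_teich_simultaneous_diagonalization:
  assumes a: "a \<in> flat_torus_teich" and b: "b \<in> flat_torus_teich"
  obtains W m where "(det W)\<^sup>2 = 1" "\<And>i. m i > 0" "prod m UNIV = 1"
    "a = W ** transpose W" "b = W ** diagm m ** transpose W"
proof -
  obtain U l where U: "orthogonal_matrix U" "\<And>i. l i > 0" "prod l UNIV = 1" "a = U ** diagm l ** transpose U"
    using flat_torus_teich_diagonalization[OF a] by metis
  define R where "R = U ** diagm (\<lambda>i. sqrt (l i))"
  define R' where "R' = diagm (\<lambda>i. 1 / sqrt (l i)) ** transpose U"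
  have l: "sqrt (l i) \<noteq> 0" "sqrt (l i) * sqrt (l i) = l i" for i
    using U(2)[of i] by (auto simp: less_imp_le)
  have "R ** transpose R = U ** (diagm (\<lambda>i. sqrt (l i)) ** diagm (\<lambda>i. sqrt (l i))) ** transpose U"
    by (simp add: R_def matrix_transpose_mul matrix_mul_assoc)
  then have R: "R ** transpose R = a" by (simp only: diagm_mult l U)
  have "R ** R' = U ** (diagm (\<lambda>i. sqrt (l i)) ** diagm (\<lambda>i. 1 / sqrt (l i))) ** transpose U"
    by (simp add: R_def R'_def matrix_mul_assoc)
  then have RR': "R ** R' = mat 1"
    using U(1) U(2)[THEN less_imp_neq] by (simp add: diagm_mult diagm_1 l orthogonal_matrix_def eq_commute[of 0])
  have "det R * det (transpose R) = 1"
    using a by (simp add: det_mul[symmetric] R flat_torus_teich_def del: det_transpose)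
  then have dR: "(det R)\<^sup>2 = 1" by (simp add: power2_eq_square)
  have "det R * det R' = 1" by (simp add: det_mul[symmetric] RR')
  then have dR': "(det R')\<^sup>2 = 1" using dR by (metis mult_1 power_mult_distrib power_one)
  have "R' ** b ** transpose R' \<in> flat_torus_teich"
    by (intro flat_torus_teich_congruence b dR')
  then obtain V m where V: "orthogonal_matrix V" "\<And>i. m i > 0" "prod m UNIV = 1"
      "R' ** b ** transpose R' = V ** diagm m ** transpose V"
    using flat_torus_teich_diagonalization by metis
  have tR: "transpose R' ** transpose R = mat 1" by (simp add: matrix_transpose_mul[symmetric] RR')
  show thesis
  proof
    show "(det (R ** V))\<^sup>2 = 1" by (simp add: det_mul power_mult_distrib dR det_orthogonal_power2[OF V(1)])
    have "R ** V ** transpose (R ** V) = R ** (V ** transpose V) ** transpose R"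
      by (simp only: matrix_transpose_mul matrix_mul_assoc)
    then show "a = R ** V ** transpose (R ** V)" using V(1) by (simp add: orthogonal_matrix_def R)
    have "R ** V ** diagm m ** transpose (R ** V) = R ** (V ** diagm m ** transpose V) ** transpose R"
      by (simp only: matrix_transpose_mul matrix_mul_assoc)
    also have "\<dots> = (R ** R') ** b ** (transpose R' ** transpose R)"
      unfolding V(4)[symmetric] by (simp only: matrix_mul_assoc)
    finally show "b = R ** V ** diagm m ** transpose (R ** V)" by (simp add: RR' tR)
  qed (use V in auto)
qed

definition mlog :: "real^'n^'n \<Rightarrow> real^'n^'n" where
  "mlog a = (SOME X. \<exists>U l. orthogonal_matrix U \<and> (\<forall>i. l i > 0) \<and>
     a = U ** diagm l ** transpose U \<and> X = U ** diagm (\<lambda>i. ln (l i)) ** transpose U)"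

lemma trace_zero: "trace (0 :: real^'n^'n) = 0"
  by (simp add: trace_def)

text \<open>Two diagonalizations of the same matrix give the same logarithm because
  \<open>log_metric_increasing\<close> with \<open>a = b\<close> bounds their distance by 0.\<close>

lemma mlog_eq:
  assumes "orthogonal_matrix U" "\<And>i. l i > 0"
  shows "mlog (U ** diagm l ** transpose U) = U ** diagm (\<lambda>i. ln (l i)) ** transpose U"
  unfolding mlog_def
proof (rule someI2_ex)
  fix X assume "\<exists>V m. orthogonal_matrix V \<and> (\<forall>i. m i > 0) \<and>
     U ** diagm l ** transpose U = V ** diagm m ** transpose V \<and> X = V ** diagm (\<lambda>i. ln (m i)) ** transpose V"
  then obtain V m where V: "orthogonal_matrix V" "\<And>i. m i > 0"
     "U ** diagm l ** transpose U = V ** diagm m ** transpose V" "X = V ** diagm (\<lambda>i. ln (m i)) ** transpose V"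
    by blast
  show "X = U ** diagm (\<lambda>i. ln (l i)) ** transpose U"
    using log_metric_increasing[where l = l and m = m, OF assms(1) V(1) assms(2) V(2) refl V(3)]
    by (simp add: V(4) matrix_mult.zero_right trace_zero)
qed (use assms in blast)

lemma mlog_increasing:
  assumes "a \<in> flat_torus_teich" "b \<in> flat_torus_teich"
  shows "(norm (mlog b - mlog a))\<^sup>2 \<le> trace (matrix_inv a ** (b - a) ** matrix_inv b ** (b - a))"
proof -
  obtain U l where U: "orthogonal_matrix U" "\<And>i. l i > 0" "a = U ** diagm l ** transpose U"
    using flat_torus_teich_diagonalization[OF assms(1)] by metis
  obtain V m where V: "orthogonal_matrix V" "\<And>i. m i > 0" "b = V ** diagm m ** transpose V"
    using flat_torus_teich_diagonalization[OF assms(2)] by metis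
  show ?thesis
    using log_metric_increasing[where l = l and m = m, OF U(1) V(1) U(2) V(2) U(3) V(3)]
      mlog_eq[where l = l, OF U(1,2)] mlog_eq[where l = m, OF V(1,2)] U(3) V(3)
    by simp
qed

lemma mlog_diagm: "(\<And>i. l i > 0) \<Longrightarrow> mlog (diagm l) = diagm (\<lambda>i. ln (l i))"
  using mlog_eq[of "mat 1" l] by (simp add: orthogonal_matrix_id)

lemma flat_torus_teich_matrix_inv:
  assumes "a \<in> flat_torus_teich"
  shows "a ** matrix_inv a = mat 1" "matrix_inv a ** a = mat 1"
proof -
  have "invertible a" using assms by (simp add: invertible_det_nz flat_torus_teich_def)
  then obtain B where "a ** B = mat 1" "B ** a = mat 1" by (auto simp: invertible_def)
  then show "a ** matrix_inv a = mat 1" "matrix_inv a ** a = mat 1" by (auto simp: matrix_inv_unique)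
qed

text \<open>The right-hand side is invariant under congruence.\<close>

lemma mlog_congruence_increasing:
  assumes a: "a \<in> flat_torus_teich" and b: "b \<in> flat_torus_teich" and V: "(det V)\<^sup>2 = 1"
  shows "(norm (mlog (V ** b ** transpose V) - mlog (V ** a ** transpose V)))\<^sup>2
           \<le> trace (matrix_inv a ** (b - a) ** matrix_inv b ** (b - a))"
proof -
  have "invertible V" using V by (auto simp: invertible_det_nz)
  then obtain W where W: "V ** W = mat 1" "W ** V = mat 1" by (auto simp: invertible_def)
  have W': "transpose W ** transpose V = mat 1" "transpose V ** transpose W = mat 1"
    by (simp_all add: matrix_transpose_mul[symmetric] W)
  have inv: "matrix_inv (V ** c ** transpose V) = transpose W ** matrix_inv c ** W" if "c \<in> flat_torus_teich" for c
  proof (rule matrix_inv_unique)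
    have "V ** c ** transpose V ** (transpose W ** matrix_inv c ** W) = V ** (c ** (transpose V ** transpose W) ** matrix_inv c) ** W"
      by (simp only: matrix_mul_assoc)
    then show "V ** c ** transpose V ** (transpose W ** matrix_inv c ** W) = mat 1"
      by (simp add: W W' flat_torus_teich_matrix_inv[OF that])
  qed
  have "matrix_inv (V ** a ** transpose V) ** (V ** b ** transpose V - V ** a ** transpose V) **
      matrix_inv (V ** b ** transpose V) ** (V ** b ** transpose V - V ** a ** transpose V)
    = transpose W ** matrix_inv a ** W ** (V ** (b - a) ** transpose V) ** (transpose W ** matrix_inv b ** W) ** (V ** (b - a) ** transpose V)"
    by (simp only: inv[OF a] inv[OF b] matrix_mult.diff_left matrix_mult.diff_right)
  also have "\<dots> = transpose W ** matrix_inv a ** (W ** V) ** (b - a) ** (transpose V ** transpose W) ** matrix_inv b ** (W ** V) ** (b - a) ** transpose V"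
    by (simp only: matrix_mul_assoc)
  also have "\<dots> = transpose W ** (matrix_inv a ** (b - a) ** matrix_inv b ** (b - a) ** transpose V)"
    by (simp add: W W' matrix_mul_assoc)
  also have "trace \<dots> = trace (matrix_inv a ** (b - a) ** matrix_inv b ** (b - a) ** (transpose V ** transpose W))"
    by (subst trace_mul_sym) (simp only: matrix_mul_assoc)
  finally show ?thesis
    using mlog_increasing[OF flat_torus_teich_congruence[OF a V] flat_torus_teich_congruence[OF b V]] by (simp add: W')
qed

text \<open>The counting function \<open>w\<close> jumps at the points of \<open>S\<close>; its increments absorb the intervals
  of a tagged division whose tag lies in \<open>S\<close>.\<close>

lemma norm_diff_le_integral:
  fixes F :: "real \<Rightarrow> 'b::real_normed_vector" and g :: "real \<Rightarrow> real"
  assumes F: "continuous_on {0..1} F" and S: "finite S" and g: "g integrable_on {0..1}"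
    and loc: "\<And>x e. x \<in> {0..1} - S \<Longrightarrow> e > 0 \<Longrightarrow>
      \<exists>\<delta>>0. \<forall>y\<in>{0..1}. \<bar>y - x\<bar> < \<delta> \<longrightarrow> norm (F y - F x) \<le> (g x + e) * \<bar>y - x\<bar>"
  shows "norm (F 1 - F 0) \<le> integral {0..1} g"
proof -
  \<comment> \<open>No slope bound is assumed at the points of \<open>S\<close>, so the integrand is
    set to 0 there, which leaves the integral unchanged.\<close>
  let ?g = "\<lambda>x. if x \<in> S then 0 else g x"
  \<comment> \<open>Each point is counted once with \<open><\<close> and once with
    \<open>\<le>\<close>: an interval whose left end is \<open>x \<in> S\<close> gains through
    \<open><\<close>, any other one through \<open>\<le>\<close>, so every nondegenerate interval
    containing \<open>x\<close> gains at least 1.\<close>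
  define w where "w t = real (card {s \<in> S. s < t}) + real (card {s \<in> S. s \<le> t})" for t :: real
  have w_mono: "w u \<le> w v" if "u \<le> v" for u v
    unfolding w_def by (intro add_mono of_nat_mono card_mono) (use S that in auto)
  have w_jump: "w u + 1 \<le> w v" if "u \<le> x" "x \<le> v" "u < v" "x \<in> S" for u v x
  proof (cases "u = x")
    case True
    then have "card {s \<in> S. s < u} < card {s \<in> S. s < v}"
      by (intro psubset_card_mono) (use S that in auto)
    moreover have "card {s \<in> S. s \<le> u} \<le> card {s \<in> S. s \<le> v}"
      by (intro card_mono) (use S that in auto)
    ultimately show ?thesis by (simp add: w_def)
  next
    case False
    then have "x \<in> {s \<in> S. s \<le> v} - {s \<in> S. s \<le> u}" using that by auto
    then have "card {s \<in> S. s \<le> u} < card {s \<in> S. s \<le> v}"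
      by (intro psubset_card_mono) (use S that in \<open>fastforce+\<close>)
    moreover have "card {s \<in> S. s < u} \<le> card {s \<in> S. s < v}"
      by (intro card_mono) (use S that in auto)
    ultimately show ?thesis by (simp add: w_def)
  qed
  have loc': "\<exists>\<delta>>0. \<forall>u\<in>{0..1}. \<forall>v\<in>{0..1}. u \<le> x \<and> x \<le> v \<and> u < v \<and> v < x + \<delta> \<and> x - \<delta> < u \<longrightarrow>
      norm (F v - F u) \<le> ?g x * (v - u) + e * (v - u) + e * (w v - w u)" (is "\<exists>\<delta>>0. ?Q \<delta>")
    if x: "x \<in> {0..1}" and e: "e > 0" for x e
  proof (cases "x \<in> S")
    case True
    obtain \<delta> where \<delta>: "\<delta> > 0" "\<And>y. y \<in> {0..1} \<Longrightarrow> dist y x < \<delta> \<Longrightarrow> dist (F y) (F x) < e / 2"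
      using F e x by (metis continuous_on_iff half_gt_zero)
    have "norm (F v - F u) \<le> ?g x * (v - u) + e * (v - u) + e * (w v - w u)"
      if "u \<in> {0..1}" "v \<in> {0..1}" "u \<le> x \<and> x \<le> v \<and> u < v \<and> v < x + \<delta> \<and> x - \<delta> < u" for u v
    proof -
      have "norm (F v - F u) \<le> dist (F v) (F x) + dist (F u) (F x)"
        by (metis dist_norm dist_triangle2)
      also have "\<dots> \<le> e"
        using \<delta>(2)[of u] \<delta>(2)[of v] that by (auto simp: dist_real_def)
      also have "\<dots> \<le> e * (w v - w u)"
        using w_jump[of u x v] that e True by (auto simp: mult_le_cancel_left1)
      finally show ?thesis using that e True by (simp add: add_increasing)
    qed
    then show ?thesis using \<delta>(1) by blast
  next
    case False
    then obtain \<delta> where \<delta>: "\<delta> > 0" "\<And>y. y \<in> {0..1} \<Longrightarrow> \<bar>y - x\<bar> < \<delta> \<Longrightarrow> norm (F y - F x) \<le> (g x + e) * \<bar>y - x\<bar>"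
      using loc[of x e] x e by auto
    have "norm (F v - F u) \<le> ?g x * (v - u) + e * (v - u) + e * (w v - w u)"
      if "u \<in> {0..1}" "v \<in> {0..1}" "u \<le> x \<and> x \<le> v \<and> u < v \<and> v < x + \<delta> \<and> x - \<delta> < u" for u v
    proof -
      have "norm (F v - F u) \<le> norm (F v - F x) + norm (F u - F x)"
        by (metis dist_norm dist_triangle2)
      also have "\<dots> \<le> (g x + e) * \<bar>v - x\<bar> + (g x + e) * \<bar>u - x\<bar>"
        by (intro add_mono \<delta>(2)) (use that in auto)
      also have "\<dots> = (g x + e) * (v - u)"
        using that by (simp add: algebra_simps)
      also have "\<dots> \<le> (g x + e) * (v - u) + e * (w v - w u)"
        using w_mono[of u v] that e by simp
      finally show ?thesis using False by (simp add: algebra_simps)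
    qed
    then show ?thesis using \<delta>(1) by blast
  qed
  have "norm (F 1 - F 0) \<le> integral {0..1} g + e * (2 + (w 1 - w 0))" if e: "e > 0" for e
  proof -
    from loc'[OF _ e] obtain \<delta> where \<delta>: "\<And>x. x \<in> {0..1} \<Longrightarrow> \<delta> x > 0"
       "\<And>x u v. \<lbrakk>x \<in> {0..1}; u \<in> {0..1}; v \<in> {0..1}; u \<le> x; x \<le> v; u < v; v < x + \<delta> x; x - \<delta> x < u\<rbrakk>
         \<Longrightarrow> norm (F v - F u) \<le> ?g x * (v - u) + e * (v - u) + e * (w v - w u)"
      by metis
    have gI: "(?g has_integral integral {0..1} g) (cbox 0 1)"
      using has_integral_spike_finite[OF S _ integrable_integral[OF g], of ?g] by auto
    obtain \<gamma> where \<gamma>: "gauge \<gamma>" "\<And>p. p tagged_division_of (cbox 0 1) \<Longrightarrow> \<gamma> fine p \<Longrightarrow>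
        norm ((\<Sum>(x,k)\<in>p. measure lborel k *\<^sub>R ?g x) - integral {0..1} g) < e"
      by (rule has_integralD[OF gI e]) blast
    define \<gamma>' where "\<gamma>' x = ball x (if x \<in> {0..1} then \<delta> x else 1)" for x
    have "gauge \<gamma>'" unfolding gauge_def \<gamma>'_def using \<delta>(1) by auto
    then obtain p where p: "p tagged_division_of (cbox 0 1)" "(\<lambda>x. \<gamma> x \<inter> \<gamma>' x) fine p"
      using fine_division_exists[OF gauge_Int[OF \<gamma>(1)]] by blast
    have fine: "\<gamma> fine p" "\<gamma>' fine p" using p(2) by (auto simp: fine_Int)
    have p': "p tagged_division_of {0..1}" using p(1) by simp
    \<comment> \<open>Applied to \<open>F\<close>, to the identity and to \<open>w\<close>, this
      makes the total error \<open>e * 1 + e * (w 1 - w 0)\<close> independent of the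
      division.\<close>
    have tele: "(\<Sum>(x,K)\<in>p. f (Sup K) - f (Inf K)) = f 1 - f 0" for f :: "real \<Rightarrow> 'c::real_normed_vector"
      by (rule additive_tagged_division_1[OF _ p']) simp
    have *: "norm (F (Sup K) - F (Inf K)) \<le> measure lborel K *\<^sub>R ?g x + e * (Sup K - Inf K) + e * (w (Sup K) - w (Inf K))"
      if xK: "(x, K) \<in> p" for x K
    proof -
      obtain u v where K: "K = cbox u v" "x \<in> K" "K \<subseteq> {0..1}"
        using tagged_division_ofD(2-4)[OF p' xK] by metis
      then have uv: "u \<le> v" by auto
      show ?thesis
      proof (cases "u = v")
        case True
        then show ?thesis using K by simp
      next
        case False
        have "K \<subseteq> \<gamma>' x" using fine(2) xK by (auto simp: fine_def)
        moreover have "u \<in> K" "v \<in> K" using K(1) uv by auto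
        ultimately have "u \<in> \<gamma>' x" "v \<in> \<gamma>' x" "x \<in> {0..1}" "u \<in> {0..1}" "v \<in> {0..1}" "u \<le> x" "x \<le> v"
          using K by auto
        then have "norm (F v - F u) \<le> ?g x * (v - u) + e * (v - u) + e * (w v - w u)"
          using uv False by (intro \<delta>(2)) (auto simp: \<gamma>'_def dist_real_def)
        then show ?thesis using K uv False by (simp add: mult.commute)
      qed
    qed
    have "norm (F 1 - F 0) = norm (\<Sum>(x,K)\<in>p. F (Sup K) - F (Inf K))" by (simp only: tele)
    also have "\<dots> \<le> (\<Sum>(x,K)\<in>p. measure lborel K *\<^sub>R ?g x + e * (Sup K - Inf K) + e * (w (Sup K) - w (Inf K)))"
      by (intro sum_norm_le) (use * in auto)
    also have "\<dots> = (\<Sum>(x,K)\<in>p. measure lborel K *\<^sub>R ?g x) + e * (\<Sum>(x,K)\<in>p. (Sup K - Inf K)) + e * (\<Sum>(x,K)\<in>p. w (Sup K) - w (Inf K))"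
      by (simp add: sum.distrib sum_distrib_left case_prod_unfold)
    also have "\<dots> = (\<Sum>(x,K)\<in>p. measure lborel K *\<^sub>R ?g x) + e * 1 + e * (w 1 - w 0)"
      using tele[of w] tele[of "\<lambda>x. x"] by simp
    also have "\<dots> \<le> integral {0..1} g + e * (2 + (w 1 - w 0))"
      using \<gamma>(2)[OF p(1) fine(1)] by (simp add: algebra_simps abs_le_iff)
    finally show ?thesis .
  qed
  note * = this
  have "((\<lambda>e. integral {0..1} g + e * (2 + (w 1 - w 0))) \<longlongrightarrow> integral {0..1} g + 0 * (2 + (w 1 - w 0))) (at_right 0)"
    by (intro tendsto_intros)
  then have "norm (F 1 - F 0) \<le> integral {0..1} g + 0 * (2 + (w 1 - w 0))"
    by (rule tendsto_lowerbound) (auto simp: eventually_at_right_less intro!: eventually_mono[OF eventually_at_right_less] *)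
  then show ?thesis by simp
qed

section \<open>The Weil-Petersson distance\<close>

lemma tendsto_det:
  fixes f :: "'a \<Rightarrow> real^'n^'n"
  assumes "(f \<longlongrightarrow> A) F"
  shows "((\<lambda>x. det (f x)) \<longlongrightarrow> det A) F"
  unfolding det_def by (intro tendsto_intros assms)

text \<open>Cramer's rule writes the entries of the inverse as quotients of determinants, from which
  continuity of inversion follows.\<close>

lemma matrix_inv_nth:
  fixes A :: "real^'n^'n"
  assumes "det A \<noteq> 0"
  shows "matrix_inv A $ k $ m = det (\<chi> i j. if j = k then axis m 1 $ i else A $ i $ j) / det A"
proof -
  obtain B where B: "A ** B = mat 1" "B ** A = mat 1"
    using assms unfolding invertible_det_nz[symmetric] invertible_def by blast
  then have "A *v (B *v axis m 1) = axis m 1" by (simp add: matrix_vector_mul_assoc)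
  then have "(B *v axis m 1) $ k = det (\<chi> i j. if j = k then axis m 1 $ i else A $ i $ j) / det A"
    by (subst (asm) cramer[OF assms]) simp
  then show ?thesis
    by (simp add: matrix_inv_unique[OF B(1)] matrix_vector_mult_basis column_def)
qed

lemma tendsto_matrix_inv:
  fixes f :: "'a \<Rightarrow> real^'n^'n"
  assumes f: "(f \<longlongrightarrow> A) F" and A: "det A \<noteq> 0"
  shows "((\<lambda>x. matrix_inv (f x)) \<longlongrightarrow> matrix_inv A) F"
proof (intro vec_tendstoI)
  fix k m
  have "((\<lambda>x. det (\<chi> i j. if j = k then axis m 1 $ i else f x $ i $ j) / det (f x)) \<longlongrightarrow>
      det (\<chi> i j. if j = k then axis m 1 $ i else A $ i $ j) / det A) F"
  proof (intro tendsto_intros tendsto_det A f)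
    fix i j
    show "((\<lambda>x. if j = k then axis m 1 $ i else f x $ i $ j) \<longlongrightarrow> (if j = k then axis m 1 $ i else A $ i $ j)) F"
      by (auto intro!: tendsto_intros f)
  qed
  moreover have "\<forall>\<^sub>F x in F. det (f x) \<noteq> 0"
    using tendsto_imp_eventually_ne[OF tendsto_det[OF f] A] .
  ultimately show "((\<lambda>x. matrix_inv (f x) $ k $ m) \<longlongrightarrow> matrix_inv A $ k $ m) F"
    unfolding matrix_inv_nth[OF A]
    by (elim Lim_transform_eventually eventually_mono) (simp add: matrix_inv_nth)
qed

lemma tendsto_trace: "(f \<longlongrightarrow> A) F \<Longrightarrow> ((\<lambda>x. trace (f x)) \<longlongrightarrow> trace A) F"
  for A :: "real^'n^'n"
  unfolding trace_def by (intro tendsto_intros)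

text \<open>Divide \<open>mlog_congruence_increasing\<close> for \<open>\<gamma> x\<close> and
  \<open>\<gamma> y\<close> by \<open>(y - x)\<^sup>2\<close>: the right side is \<open>R y\<close>,
  whose limit at \<open>x\<close> is the squared speed because inversion is continuous.\<close>

lemma mlog_path_bound:
  fixes \<gamma> :: "real \<Rightarrow> real^'n^'n"
  assumes V: "(det V)\<^sup>2 = 1" and \<gamma>: "\<gamma> ` {0..1} \<subseteq> flat_torus_teich" and x: "x \<in> {0..1}"
    and D: "(\<gamma> has_vector_derivative D) (at x)" and e: "e > 0"
  shows "\<exists>\<delta>>0. \<forall>y\<in>{0..1}. \<bar>y - x\<bar> < \<delta> \<longrightarrow>
    norm (mlog (V ** \<gamma> y ** transpose V) - mlog (V ** \<gamma> x ** transpose V)) \<le> (wp_speed \<gamma> x + e) * \<bar>y - x\<bar>"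
proof -
  define R where "R y = trace (matrix_inv (\<gamma> x) ** ((\<gamma> y - \<gamma> x) /\<^sub>R (y - x)) ** matrix_inv (\<gamma> y) ** ((\<gamma> y - \<gamma> x) /\<^sub>R (y - x)))" for y
  have gx: "\<gamma> x \<in> flat_torus_teich" using \<gamma> x by auto
  then have "det (\<gamma> x) \<noteq> 0" by (auto simp: flat_torus_teich_def)
  have *: "((\<lambda>y. (\<gamma> y - \<gamma> x) /\<^sub>R (y - x)) \<longlongrightarrow> D) (at x)"
  proof (rule tendstoI)
    fix \<epsilon> :: real assume "\<epsilon> > 0"
    then obtain d where d: "d > 0" "\<And>y. 0 < norm (y - x) \<Longrightarrow> norm (y - x) < d \<Longrightarrow>
        norm (\<gamma> y - \<gamma> x - (y - x) *\<^sub>R D) / norm (y - x) < \<epsilon>"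
      using D unfolding has_vector_derivative_def has_derivative_at' by metis
    have "dist ((\<gamma> y - \<gamma> x) /\<^sub>R (y - x)) D < \<epsilon>" if "y \<noteq> x" "dist y x < d" for y
    proof -
      have "(\<gamma> y - \<gamma> x) /\<^sub>R (y - x) - D = (\<gamma> y - \<gamma> x - (y - x) *\<^sub>R D) /\<^sub>R (y - x)"
        using that by (simp add: scaleR_diff_right)
      then show ?thesis using d(2)[of y] that by (simp add: dist_norm divide_inverse mult.commute)
    qed
    then show "\<forall>\<^sub>F y in at x. dist ((\<gamma> y - \<gamma> x) /\<^sub>R (y - x)) D < \<epsilon>"
      using d(1) unfolding eventually_at by blast
  qed
  have "isCont \<gamma> x" using D has_vector_derivative_continuous by blast
  then have c: "(\<gamma> \<longlongrightarrow> \<gamma> x) (at x)" by (simp add: isCont_def)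
  have "(R \<longlongrightarrow> trace (matrix_inv (\<gamma> x) ** D ** matrix_inv (\<gamma> x) ** D)) (at x)"
    unfolding R_def
    by (intro tendsto_trace matrix_mult.tendsto tendsto_matrix_inv tendsto_const * c) fact
  then have "((\<lambda>y. sqrt (R y)) \<longlongrightarrow> wp_speed \<gamma> x) (at x)"
    unfolding wp_speed_def wp_inner_eq[OF gx] vector_derivative_at[OF D] by (rule tendsto_real_sqrt)
  then have "\<forall>\<^sub>F y in at x. sqrt (R y) < wp_speed \<gamma> x + e"
    using e by (intro order_tendstoD) auto
  then obtain \<delta> where \<delta>: "\<delta> > 0" "\<And>y. y \<noteq> x \<Longrightarrow> dist y x < \<delta> \<Longrightarrow> sqrt (R y) < wp_speed \<gamma> x + e"
    unfolding eventually_at by auto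
  have "norm (mlog (V ** \<gamma> y ** transpose V) - mlog (V ** \<gamma> x ** transpose V)) \<le> (wp_speed \<gamma> x + e) * \<bar>y - x\<bar>"
    if y: "y \<in> {0..1}" "\<bar>y - x\<bar> < \<delta>" for y
  proof (cases "y = x")
    case False
    let ?n = "norm (mlog (V ** \<gamma> y ** transpose V) - mlog (V ** \<gamma> x ** transpose V))"
    have "?n\<^sup>2 \<le> trace (matrix_inv (\<gamma> x) ** (\<gamma> y - \<gamma> x) ** matrix_inv (\<gamma> y) ** (\<gamma> y - \<gamma> x))"
      by (rule mlog_congruence_increasing[OF gx _ V]) (use y \<gamma> in auto)
    also have "\<dots> = R y * (y - x)\<^sup>2"
    proof -
      have "R y = inverse (y - x) * inverse (y - x) * trace (matrix_inv (\<gamma> x) ** (\<gamma> y - \<gamma> x) ** matrix_inv (\<gamma> y) ** (\<gamma> y - \<gamma> x))"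
        unfolding R_def matrix_mult.scaleR_right matrix_mult.scaleR_left by (simp add: trace_def sum_distrib_left mult.assoc)
      moreover have "inverse (y - x) * inverse (y - x) * (y - x)\<^sup>2 = 1"
        using False power_mult_distrib[of "inverse (y - x)" "y - x" 2] by (simp add: power2_eq_square[of "inverse _"])
      ultimately show ?thesis by (simp add: mult_ac)
    qed
    finally have "?n \<le> sqrt (R y * (y - x)\<^sup>2)" by (rule real_le_rsqrt)
    also have "\<dots> = sqrt (R y) * \<bar>y - x\<bar>" by (simp add: real_sqrt_mult)
    also have "\<dots> \<le> (wp_speed \<gamma> x + e) * \<bar>y - x\<bar>"
      using \<delta>(2)[of y] False y by (intro mult_right_mono) (auto simp: dist_real_def)
    finally show ?thesis .
  qed simp
  then show ?thesis using \<delta>(1) by blast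
qed

text \<open>The bound in \<open>mlog_congruence_increasing\<close> tends to 0 with
  \<open>b - a\<close>, so the inequality that compares lengths also proves continuity.\<close>

lemma tendsto_mlog_congruence:
  assumes V: "(det V)\<^sup>2 = 1" and a: "a \<in> flat_torus_teich" and f: "(f \<longlongrightarrow> a) F"
    and ev: "\<forall>\<^sub>F x in F. f x \<in> flat_torus_teich"
  shows "((\<lambda>x. mlog (V ** f x ** transpose V)) \<longlongrightarrow> mlog (V ** a ** transpose V)) F"
proof -
  define R where "R b = trace (matrix_inv a ** (b - a) ** matrix_inv b ** (b - a))" for b
  have "((\<lambda>x. R (f x)) \<longlongrightarrow> trace (matrix_inv a ** (a - a) ** matrix_inv a ** (a - a))) F"
    unfolding R_def using a
    by (intro tendsto_trace matrix_mult.tendsto tendsto_matrix_inv tendsto_const tendsto_diff f)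
      (auto simp: flat_torus_teich_def)
  then have "((\<lambda>x. sqrt (R (f x))) \<longlongrightarrow> sqrt 0) F"
    by (intro tendsto_real_sqrt) (simp add: matrix_mult.zero_right trace_zero)
  then have lim: "((\<lambda>x. sqrt (R (f x))) \<longlongrightarrow> 0) F" by simp
  have "\<forall>\<^sub>F x in F. norm (mlog (V ** f x ** transpose V) - mlog (V ** a ** transpose V)) \<le> sqrt (R (f x))"
    using ev
  proof (rule eventually_mono)
    fix x assume "f x \<in> flat_torus_teich"
    then show "norm (mlog (V ** f x ** transpose V) - mlog (V ** a ** transpose V)) \<le> sqrt (R (f x))"
      unfolding R_def by (intro real_le_rsqrt mlog_congruence_increasing a V)
  qed
  then have "((\<lambda>x. mlog (V ** f x ** transpose V) - mlog (V ** a ** transpose V)) \<longlongrightarrow> 0) F"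
    using lim by (rule Lim_null_comparison)
  then show ?thesis by (rule LIM_zero_cancel)
qed

text \<open>Each \<open>V\<close> of determinant 1 or -1 gives a map into the Euclidean space of
  matrices that does not increase lengths. The freedom in \<open>V\<close> serves to place any
  chosen point at the identity.\<close>

lemma wp_length_lower_bound:
  assumes V: "(det V)\<^sup>2 = 1" and L: "L \<in> wp_lengths a b"
  shows "norm (mlog (V ** b ** transpose V) - mlog (V ** a ** transpose V)) \<le> L"
proof -
  obtain \<gamma> where L: "L = integral {0..1} (wp_speed \<gamma>)" and vp: "valid_path \<gamma>"
    and im: "path_image \<gamma> \<subseteq> flat_torus_teich" and ab: "pathstart \<gamma> = a" "pathfinish \<gamma> = b"
    and int: "wp_speed \<gamma> integrable_on {0..1}"
    using L unfolding wp_lengths_def by blast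
  obtain S where S: "finite S" "\<gamma> C1_differentiable_on ({0..1} - S)" and cont: "continuous_on {0..1} \<gamma>"
    using vp unfolding valid_path_def piecewise_C1_differentiable_on_def by auto
  have im': "\<gamma> ` {0..1} \<subseteq> flat_torus_teich" using im by (simp add: path_image_def)
  let ?F = "\<lambda>x. mlog (V ** \<gamma> x ** transpose V)"
  have "norm (?F 1 - ?F 0) \<le> integral {0..1} (wp_speed \<gamma>)"
  proof (rule norm_diff_le_integral[OF _ S(1) int])
    show "continuous_on {0..1} ?F"
      unfolding continuous_on_def
    proof
      fix x :: real assume x: "x \<in> {0..1}"
      then show "(?F \<longlongrightarrow> ?F x) (at x within {0..1})"
        using cont im' by (intro tendsto_mlog_congruence V)
          (auto simp: continuous_on_def eventually_at intro!: exI[of _ 1])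
    qed
    fix x e :: real assume x: "x \<in> {0..1} - S" and e: "e > 0"
    then obtain D where "(\<gamma> has_vector_derivative D) (at x)"
      using S(2) unfolding C1_differentiable_on_def by blast
    then show "\<exists>\<delta>>0. \<forall>y\<in>{0..1}. \<bar>y - x\<bar> < \<delta> \<longrightarrow> norm (?F y - ?F x) \<le> (wp_speed \<gamma> x + e) * \<bar>y - x\<bar>"
      using x e by (intro mlog_path_bound[OF V im']) auto
  qed
  then show ?thesis using ab L by (simp add: pathstart_def pathfinish_def)
qed

lemma norm_diagm: "norm (diagm l) = sqrt (\<Sum>i\<in>UNIV. (l i)\<^sup>2)" for l :: "'n::finite \<Rightarrow> real"
proof -
  have "(norm (diagm l))\<^sup>2 = (\<Sum>i\<in>UNIV. (l i)\<^sup>2)"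
    by (simp add: norm_matrix_power2 diagm_nth if_distrib[of "\<lambda>x. x\<^sup>2"] cong: if_cong)
  then show ?thesis by (metis norm_ge_zero real_sqrt_unique)
qed

text \<open>The curve \<open>W ** diagm (\<lambda>i. m i powr t) ** transpose W\<close>, a geodesic
  of the symmetric space, has this constant speed.\<close>

lemma wp_lengths_geodesic:
  fixes W :: "real^'n^'n"
  assumes W: "(det W)\<^sup>2 = 1" and m: "\<And>i. m i > 0" "prod m UNIV = 1"
  shows "sqrt (\<Sum>i\<in>UNIV. (ln (m i))\<^sup>2) \<in> wp_lengths (W ** transpose W) (W ** diagm m ** transpose W)"
proof -
  define D where "D t = diagm (\<lambda>i. m i powr t)" for t
  define D' where "D' t = diagm (\<lambda>i. m i powr t * ln (m i))" for t
  define \<gamma> where "\<gamma> t = W ** D t ** transpose W" for t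
  have "((\<lambda>t. D t $ i $ j) has_real_derivative D' t $ i $ j) (at t)" for t i j
    using m(1)[of i] unfolding D_def D'_def diagm_nth by (auto intro!: derivative_eq_intros)
  then have "(D has_vector_derivative D' t) (at t)" for t
    unfolding has_vector_derivative_def has_derivative_componentwise_within[of D]
    by (auto simp: Basis_vec_def inner_axis has_field_derivative_def mult.commute[of _ "D' t $ _ $ _"])
  then have \<gamma>: "(\<gamma> has_vector_derivative W ** D' t ** transpose W) (at t)" for t
    unfolding \<gamma>_def
    by (intro bounded_linear.has_vector_derivative[OF bounded_linear_compose[OF matrix_mult.bounded_linear_left matrix_mult.bounded_linear_right]])
  have "continuous_on UNIV D'"
    unfolding D'_def diagm_def
  proof (intro continuous_intros)
    show "continuous_on UNIV (\<lambda>t. if i = j then m i powr t * ln (m i) else 0)" for i j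
      using m(1)[of i] by (cases "i = j") (auto intro!: continuous_intros)
  qed
  then have "\<gamma> C1_differentiable_on UNIV"
    unfolding C1_differentiable_on_def using \<gamma>
    by (intro exI[of _ "\<lambda>t. W ** D' t ** transpose W"]) (auto intro!: matrix_mult.continuous_on continuous_intros)
  then have vp: "valid_path \<gamma>"
    unfolding valid_path_def by (meson C1_differentiable_imp_piecewise C1_differentiable_on_subset subset_UNIV)
  have mem: "\<gamma> t \<in> flat_torus_teich" for t
    unfolding \<gamma>_def D_def
  proof (intro flat_torus_teich_congruence flat_torus_teich_diagm W)
    show "m i powr t > 0" for i using m(1)[of i] by simp
    have "(\<Prod>i\<in>UNIV. m i powr t) = prod m UNIV powr t"
      using m(1) by (simp add: prod_powr_distrib less_imp_le)
    then show "(\<Prod>i\<in>UNIV. m i powr t) = 1" by (simp add: m(2))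
  qed
  have "det W \<noteq> 0" using W by auto
  then obtain V where V: "V ** W = mat 1" "W ** V = mat 1"
    using invertible_det_nz invertible_def by metis
  have V': "transpose W ** transpose V = mat 1" "transpose V ** transpose W = mat 1"
    by (simp_all add: matrix_transpose_mul[symmetric] V)
  have speed: "wp_speed \<gamma> t = sqrt (\<Sum>i\<in>UNIV. (ln (m i))\<^sup>2)" for t
  proof -
    \<comment> \<open>\<open>E\<close> is the inverse of \<open>D t\<close>, and
      \<open>E ** D' t\<close> does not depend on \<open>t\<close>: this is why the speed is
      constant.\<close>
    define E where "E = diagm (\<lambda>i. 1 / m i powr t)"
    have D: "D t ** E = mat 1" "E ** D' t = diagm (\<lambda>i. ln (m i))"
      using m(1)[THEN less_imp_neq, THEN not_sym] unfolding D_def E_def D'_def diagm_mult by (auto simp: diagm_1)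
    have "\<gamma> t ** (transpose V ** E ** V) = W ** (D t ** (transpose W ** transpose V) ** E) ** V"
      by (simp only: \<gamma>_def matrix_mul_assoc)
    then have inv: "matrix_inv (\<gamma> t) = transpose V ** E ** V"
      by (intro matrix_inv_unique) (simp add: V V' D)
    have "wp_inner (\<gamma> t) (W ** D' t ** transpose W) (W ** D' t ** transpose W) =
        trace (transpose V ** E ** V ** (W ** D' t ** transpose W) ** (transpose V ** E ** V) ** (W ** D' t ** transpose W))"
      by (simp only: wp_inner_eq[OF mem] inv)
    also have "transpose V ** E ** V ** (W ** D' t ** transpose W) ** (transpose V ** E ** V) ** (W ** D' t ** transpose W)
      = transpose V ** (E ** (V ** W) ** D' t ** (transpose W ** transpose V) ** E ** (V ** W) ** D' t ** transpose W)"
      by (simp only: matrix_mul_assoc)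
    also have "\<dots> = transpose V ** (E ** D' t ** (E ** D' t) ** transpose W)"
      by (simp add: V V' matrix_mul_assoc)
    also have "trace \<dots> = trace (E ** D' t ** (E ** D' t) ** (transpose W ** transpose V))"
      by (subst trace_mul_sym) (simp only: matrix_mul_assoc)
    also have "\<dots> = (\<Sum>i\<in>UNIV. (ln (m i))\<^sup>2)"
      by (simp add: V' D diagm_mult trace_diagm power2_eq_square)
    finally show ?thesis unfolding wp_speed_def vector_derivative_at[OF \<gamma>] by simp
  qed
  have ends: "\<gamma> 0 = W ** transpose W" "\<gamma> 1 = W ** diagm m ** transpose W"
    using m(1)[THEN less_imp_neq, THEN not_sym] m(1)[THEN less_imp_le] by (auto simp: \<gamma>_def D_def diagm_1)
  have "wp_speed \<gamma> = (\<lambda>_. sqrt (\<Sum>i\<in>UNIV. (ln (m i))\<^sup>2))" using speed by auto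
  then have int: "(wp_speed \<gamma> has_integral sqrt (\<Sum>i\<in>UNIV. (ln (m i))\<^sup>2)) {0..1}"
    using has_integral_const_real[of "sqrt (\<Sum>i\<in>UNIV. (ln (m i))\<^sup>2)" 0 1] by simp
  show ?thesis
    unfolding wp_lengths_def
    by (intro CollectI exI[of _ \<gamma>]) (use vp mem ends int in \<open>auto simp: integral_unique has_integral_integrable pathstart_def pathfinish_def path_image_def\<close>)
qed

text \<open>In the frame inverse to \<open>W\<close> the end points become \<open>mat 1\<close> and
  \<open>diagm m\<close>, with logarithms 0 and \<open>diagm (\<lambda>i. ln (m i))\<close>. There
  the lower bound valid for all paths equals the length of the explicit one.\<close>

lemma wp_dist_eq:
  fixes W :: "real^'n^'n"
  assumes W: "(det W)\<^sup>2 = 1" and m: "\<And>i. m i > 0" "prod m UNIV = 1"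
  shows "wp_dist (W ** transpose W) (W ** diagm m ** transpose W) = sqrt (\<Sum>i\<in>UNIV. (ln (m i))\<^sup>2)"
proof -
  have "W ** diagm (\<lambda>_. 1) ** transpose W \<in> flat_torus_teich"
    by (intro flat_torus_teich_congruence flat_torus_teich_diagm W) auto
  moreover have "W ** diagm m ** transpose W \<in> flat_torus_teich"
    by (intro flat_torus_teich_congruence flat_torus_teich_diagm W m)
  ultimately have mem: "W ** transpose W \<in> flat_torus_teich" "W ** diagm m ** transpose W \<in> flat_torus_teich"
    by (auto simp: diagm_1)
  have "det W \<noteq> 0" using W by auto
  then obtain V where V: "V ** W = mat 1" "W ** V = mat 1"
    using invertible_det_nz invertible_def by metis
  have V': "transpose W ** transpose V = mat 1"
    by (simp_all add: matrix_transpose_mul[symmetric] V)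
  have "det V * det W = 1" by (simp add: det_mul[symmetric] V)
  then have dV: "(det V)\<^sup>2 = 1" using W by (metis mult_1_right power_mult_distrib power_one)
  have c: "V ** (W ** A ** transpose W) ** transpose V = A" for A
  proof -
    have "V ** (W ** A ** transpose W) ** transpose V = (V ** W) ** A ** (transpose W ** transpose V)"
      by (simp only: matrix_mul_assoc)
    then show ?thesis by (simp add: V V')
  qed
  have "sqrt (\<Sum>i\<in>UNIV. (ln (m i))\<^sup>2) \<le> L" if "L \<in> wp_lengths (W ** transpose W) (W ** diagm m ** transpose W)" for L
  proof -
    have "norm (mlog (V ** (W ** diagm m ** transpose W) ** transpose V) - mlog (V ** (W ** diagm (\<lambda>_. 1) ** transpose W) ** transpose V)) \<le> L"
      by (rule wp_length_lower_bound[OF dV]) (use that in \<open>simp add: diagm_1\<close>)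
    then have "norm (diagm (\<lambda>i. ln (m i)) - diagm (\<lambda>_. ln 1)) \<le> L"
      unfolding c using mlog_diagm[of m, OF m(1)] mlog_diagm[of "\<lambda>_::'n. 1"] by simp
    moreover have "diagm (\<lambda>_::'n. ln 1) = 0" by (simp add: diagm_def vec_eq_iff)
    ultimately show ?thesis by (simp add: norm_diagm)
  qed
  then have "Inf (wp_lengths (W ** transpose W) (W ** diagm m ** transpose W)) = sqrt (\<Sum>i\<in>UNIV. (ln (m i))\<^sup>2)"
    by (intro cInf_eq_minimum wp_lengths_geodesic W m)
  then show ?thesis using mem by (simp add: wp_dist_def)
qed

lemma flat_torus_teich_frame:
  assumes "x \<in> flat_torus_teich"
  obtains W V where "(det W)\<^sup>2 = 1" "(det V)\<^sup>2 = 1" "V ** W = mat 1" "W ** V = mat 1" "x = W ** transpose W"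
proof -
  obtain W where W: "(det W)\<^sup>2 = 1" "x = W ** transpose W"
    using flat_torus_teich_simultaneous_diagonalization[OF assms assms] by metis
  then have "det W \<noteq> 0" by auto
  then obtain V where V: "V ** W = mat 1" "W ** V = mat 1"
    using invertible_det_nz invertible_def by metis
  have "det V * det W = 1" by (simp add: det_mul[symmetric] V)
  then have "(det V)\<^sup>2 = 1" using W by (metis mult_1_right power_mult_distrib power_one)
  then show thesis using that W V by blast
qed

lemma congruence_cancel:
  fixes V W :: "real^'n^'n"
  assumes "V ** W = mat 1"
  shows "V ** (W ** A ** transpose W) ** transpose V = A"
proof -
  have "V ** (W ** A ** transpose W) ** transpose V = (V ** W) ** A ** transpose (V ** W)"
    by (simp only: matrix_transpose_mul matrix_mul_assoc)
  then show ?thesis by (simp add: assms)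
qed

lemma mat_1_flat_torus_teich [simp]: "mat 1 \<in> flat_torus_teich"
  using flat_torus_teich_diagm[of "\<lambda>_. 1"] by (simp add: diagm_1)

lemma mlog_mat_1 [simp]: "mlog (mat 1 :: real^'n^'n) = 0"
  using mlog_diagm[of "\<lambda>_::'n. 1"] by (simp add: diagm_1) (simp add: diagm_def vec_eq_iff)

lemma wp_dist_lower_bound:
  assumes a: "a \<in> flat_torus_teich" and b: "b \<in> flat_torus_teich" and V: "(det V)\<^sup>2 = 1"
  shows "norm (mlog (V ** b ** transpose V) - mlog (V ** a ** transpose V)) \<le> wp_dist a b"
proof -
  obtain W m where W: "(det W)\<^sup>2 = 1" "\<And>i. m i > 0" "prod m UNIV = 1"
    "a = W ** transpose W" "b = W ** diagm m ** transpose W"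
    using flat_torus_teich_simultaneous_diagonalization[OF a b] by metis
  have "wp_lengths a b \<noteq> {}" using wp_lengths_geodesic[of W m, OF W(1-3)] W(4,5) by auto
  then have "norm (mlog (V ** b ** transpose V) - mlog (V ** a ** transpose V)) \<le> Inf (wp_lengths a b)"
    by (intro cInf_greatest wp_length_lower_bound V)
  then show ?thesis using a b by (simp add: wp_dist_def)
qed

text \<open>Together with \<open>wp_dist_lower_bound\<close>: the logarithm in the frame of a point
  preserves distances from that point and increases no other distance. The triangle inequality and
  Stewart's inequality rest on these two properties.\<close>

lemma wp_dist_frame:
  assumes W: "(det W)\<^sup>2 = 1" and a: "a \<in> flat_torus_teich"
  shows "wp_dist (W ** transpose W) (W ** a ** transpose W) = norm (mlog a)"
proof -
  obtain U l where U: "orthogonal_matrix U" "\<And>i. l i > 0" "prod l UNIV = 1" "a = U ** diagm l ** transpose U"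
    using flat_torus_teich_diagonalization[OF a] by metis
  have "(W ** U) ** transpose (W ** U) = W ** (U ** transpose U) ** transpose W"
    by (simp only: matrix_transpose_mul matrix_mul_assoc)
  moreover have "(W ** U) ** diagm l ** transpose (W ** U) = W ** a ** transpose W"
    by (simp only: U(4) matrix_transpose_mul matrix_mul_assoc)
  moreover have "(det (W ** U))\<^sup>2 = 1" by (simp add: det_mul power_mult_distrib W det_orthogonal_power2[OF U(1)])
  ultimately have "wp_dist (W ** transpose W) (W ** a ** transpose W) = norm (diagm (\<lambda>i. ln (l i)))"
    using wp_dist_eq[of "W ** U" l, OF _ U(2,3)] U(1) by (simp add: orthogonal_matrix_def norm_diagm)
  also have "\<dots> = norm (mlog a)"
    using U(1) unfolding U(4) by (simp add: mlog_eq[of U l, OF U(1,2)] norm_orthogonal_mult)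
  finally show ?thesis .
qed

lemma wp_dist_frame':
  assumes "V ** W = mat 1" "W ** V = mat 1" "(det W)\<^sup>2 = 1" "(det V)\<^sup>2 = 1" "a \<in> flat_torus_teich"
  shows "wp_dist (W ** transpose W) a = norm (mlog (V ** a ** transpose V))"
  using wp_dist_frame[OF assms(3) flat_torus_teich_congruence[OF assms(5,4)]]
  by (simp add: congruence_cancel[OF assms(2)])

lemma wp_dist_nonneg: "0 \<le> wp_dist a b"
proof (cases "a \<in> flat_torus_teich \<and> b \<in> flat_torus_teich")
  case True
  then show ?thesis using wp_dist_lower_bound[of a b "mat 1"] norm_ge_zero order_trans by (metis det_I power_one)
qed (auto simp: wp_dist_def)

text \<open>Symmetry is read off the formula rather than obtained by reversing paths: the frame
  \<open>W ** diagm (\<lambda>i. sqrt (m i))\<close> exchanges the roles of \<open>a\<close> and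
  \<open>b\<close> and inverts the eigenvalues, and \<open>ln (1 / m i)\<close> has the same square
  as \<open>ln (m i)\<close>.\<close>

lemma wp_dist_commute_on:
  assumes a: "a \<in> flat_torus_teich" and b: "b \<in> flat_torus_teich"
  shows "wp_dist b a = wp_dist a b"
proof -
  obtain W m where W: "(det W)\<^sup>2 = 1" "\<And>i. m i > 0" "prod m UNIV = 1"
    "a = W ** transpose W" "b = W ** diagm m ** transpose W"
    using flat_torus_teich_simultaneous_diagonalization[OF a b] by metis
  define W' where "W' = W ** diagm (\<lambda>i. sqrt (m i))"
  have m: "sqrt (m i) * sqrt (m i) = m i" "sqrt (m i) * (1 / m i) * sqrt (m i) = 1" for i
    using W(2)[of i] by (auto simp: less_imp_le field_simps)
  have "(\<Prod>i\<in>UNIV. sqrt (m i))\<^sup>2 = (\<Prod>i\<in>UNIV. m i)"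
    unfolding power2_eq_square prod.distrib[symmetric] by (simp only: m)
  then have d: "(det W')\<^sup>2 = 1" by (simp add: W'_def det_mul det_diagm power_mult_distrib W)
  have "W' ** transpose W' = W ** (diagm (\<lambda>i. sqrt (m i)) ** diagm (\<lambda>i. sqrt (m i))) ** transpose W"
    by (simp add: W'_def matrix_transpose_mul matrix_mul_assoc)
  then have b': "b = W' ** transpose W'" unfolding diagm_mult by (simp only: W m)
  have "W' ** diagm (\<lambda>i. 1 / m i) ** transpose W' =
      W ** (diagm (\<lambda>i. sqrt (m i)) ** diagm (\<lambda>i. 1 / m i) ** diagm (\<lambda>i. sqrt (m i))) ** transpose W"
    by (simp add: W'_def matrix_transpose_mul matrix_mul_assoc)
  then have a': "a = W' ** diagm (\<lambda>i. 1 / m i) ** transpose W'"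
    unfolding diagm_mult m by (simp add: W diagm_1)
  have "wp_dist b a = sqrt (\<Sum>i\<in>UNIV. (ln (1 / m i))\<^sup>2)"
    unfolding a' b' by (rule wp_dist_eq[OF d]) (use W in \<open>auto simp: prod_dividef\<close>)
  also have "\<dots> = wp_dist a b"
    unfolding W(4,5) by (subst wp_dist_eq[OF W(1-3)]) (use W(2)[THEN less_imp_neq, THEN not_sym] in \<open>simp add: ln_div\<close>)
  finally show ?thesis .
qed

lemma wp_dist_commute: "wp_dist a b = wp_dist b a"
proof (cases "a \<in> flat_torus_teich \<and> b \<in> flat_torus_teich")
  case True
  then show ?thesis by (simp add: wp_dist_commute_on)
next
  case False
  then show ?thesis by (auto simp: wp_dist_def)
qed

text \<open>The triangle inequality is read off in a frame in which \<open>x\<close> is the identity.\<close>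

lemma wp_dist_metric: "Metric_space (flat_torus_teich :: (real^'n^'n) set) wp_dist"
proof
  fix x y :: "real^'n^'n"
  show "0 \<le> wp_dist x y" "wp_dist x y = wp_dist y x"
    by (rule wp_dist_nonneg, rule wp_dist_commute)
  assume x: "x \<in> flat_torus_teich" and y: "y \<in> flat_torus_teich"
  obtain W m where W: "(det W)\<^sup>2 = 1" "\<And>i. m i > 0" "prod m UNIV = 1"
    "x = W ** transpose W" "y = W ** diagm m ** transpose W"
    using flat_torus_teich_simultaneous_diagonalization[OF x y] by metis
  have "y = x" if "wp_dist x y = 0"
  proof -
    have "(\<Sum>i\<in>UNIV. (ln (m i))\<^sup>2) = 0"
      using that wp_dist_eq[OF W(1-3)] W(4,5) by simp
    then have "ln (m i) = 0" for i by (simp add: sum_nonneg_eq_0_iff)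
    then have "m i = 1" for i using W(2)[of i] ln_eq_zero_iff by blast
    then have "m = (\<lambda>_. 1)" by blast
    then show "y = x" by (simp add: W(4,5) diagm_1)
  qed
  moreover have "wp_dist x x = 0"
    using wp_dist_frame[OF W(1), of "mat 1"] W(4) by simp
  ultimately show "wp_dist x y = 0 \<longleftrightarrow> x = y" by auto
next
  fix x y z :: "real^'n^'n"
  assume x: "x \<in> flat_torus_teich" and y: "y \<in> flat_torus_teich" and z: "z \<in> flat_torus_teich"
  obtain W V where W: "(det W)\<^sup>2 = 1" "(det V)\<^sup>2 = 1" "V ** W = mat 1" "W ** V = mat 1" "x = W ** transpose W"
    using flat_torus_teich_frame[OF x] by metis
  have "wp_dist x z = norm (mlog (V ** z ** transpose V))" "wp_dist x y = norm (mlog (V ** y ** transpose V))"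
    unfolding W(5) by (auto intro!: wp_dist_frame' W y z)
  then show "wp_dist x z \<le> wp_dist x y + wp_dist y z"
    using wp_dist_lower_bound[OF y z W(2)]
      norm_triangle_ineq2[of "mlog (V ** z ** transpose V)" "mlog (V ** y ** transpose V)"] by linarith
qed

text \<open>In a frame where \<open>p\<close> is the identity, \<open>x\<close> and \<open>y\<close>
  have logarithms \<open>- q\<close> and \<open>1 - q\<close> times \<open>L\<close>, on one line
  through the origin. Stewart's identity in the Euclidean space of matrices gives the claim, since
  for every \<open>z\<close> the distance to \<open>p\<close> is exact while those to
  \<open>x\<close> and \<open>y\<close> can only shrink under the logarithm.\<close>

lemma wp_dist_stewart:
  fixes x y :: "real^'n^'n"
  assumes x: "x \<in> flat_torus_teich" and y: "y \<in> flat_torus_teich" and s: "0 \<le> s" "s \<le> wp_dist x y"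
  shows "\<exists>p\<in>flat_torus_teich. \<forall>z\<in>flat_torus_teich.
    wp_dist x y * (wp_dist z p)\<^sup>2 \<le>
      (wp_dist x y - s) * (wp_dist z x)\<^sup>2 + s * (wp_dist z y)\<^sup>2 - s * (wp_dist x y - s) * wp_dist x y"
proof (cases "wp_dist x y = 0")
  case True
  then show ?thesis using s x by auto
next
  case False
  define D where "D = wp_dist x y"
  have D: "D > 0" using False wp_dist_nonneg[of x y] by (simp add: D_def)
  define q where "q = s / D"
  have sq: "s = q * D" using D by (simp add: q_def)
  have q: "0 \<le> q" "q \<le> 1" using s D by (auto simp: q_def D_def[symmetric])
  obtain W m where W: "(det W)\<^sup>2 = 1" "\<And>i. m i > 0" "prod m UNIV = 1"
    "x = W ** transpose W" "y = W ** diagm m ** transpose W"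
    using flat_torus_teich_simultaneous_diagonalization[OF x y] by metis
  define L where "L = diagm (\<lambda>i. ln (m i))"
  have L: "norm L = D" using wp_dist_eq[OF W(1-3)] by (simp add: L_def norm_diagm D_def W)
  define E where "E t = diagm (\<lambda>i. m i powr t)" for t
  have EE: "E t ** E u = E (t + u)" for t u by (simp add: E_def diagm_mult powr_add)
  have E0: "E 0 = mat 1" using W(2)[THEN less_imp_neq, THEN not_sym] by (simp add: E_def diagm_1)
  have E1: "E 1 = diagm m" using W(2)[THEN less_imp_le] by (simp add: E_def)
  have detE: "det (E t) = 1" for t
    using W(2,3) by (simp add: E_def det_diagm prod_powr_distrib[symmetric] less_imp_le)
  \<comment> \<open>Half the exponent, since congruence applies the factor on both sides:
    \<open>W' ** transpose W'\<close> is the point at fraction \<open>q\<close> of the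
    geodesic.\<close>
  define W' where "W' = W ** E (q / 2)"
  have dW': "(det W')\<^sup>2 = 1" by (simp add: W'_def det_mul detE W)
  have WE: "W' ** E t ** transpose W' = W ** E (t + q) ** transpose W" for t
  proof -
    have "W' ** E t ** transpose W' = W ** (E (q / 2) ** E t ** E (q / 2)) ** transpose W"
      by (simp add: W'_def matrix_transpose_mul matrix_mul_assoc) (simp add: E_def)
    then show ?thesis by (simp add: EE add.commute)
  qed
  have x': "x = W' ** E (- q) ** transpose W'" and y': "y = W' ** E (1 - q) ** transpose W'"
    unfolding WE by (simp_all add: E0 E1 W)
  define p where "p = W' ** transpose W'"
  have p: "p \<in> flat_torus_teich"
    using flat_torus_teich_congruence[OF mat_1_flat_torus_teich dW'] by (simp add: p_def)
  have "det W' \<noteq> 0" using dW' by auto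
  then obtain V where V: "V ** W' = mat 1" "W' ** V = mat 1"
    using invertible_det_nz invertible_def by metis
  have "det V * det W' = 1" by (simp add: det_mul[symmetric] V)
  then have dV: "(det V)\<^sup>2 = 1" using dW' by (metis mult_1_right power_mult_distrib power_one)
  have lE: "mlog (E t) = t *\<^sub>R L" for t
    unfolding E_def using W(2) W(2)[THEN less_imp_neq, THEN not_sym]
    by (subst mlog_diagm) (auto simp: L_def diagm_def vec_eq_iff ln_powr)
  have Vx: "mlog (V ** x ** transpose V) = (- q) *\<^sub>R L" "mlog (V ** y ** transpose V) = (1 - q) *\<^sub>R L"
    unfolding x' y' congruence_cancel[OF V(1)] lE by simp_all
  show ?thesis
  proof (intro bexI[OF _ p] ballI)
    fix z :: "real^'n^'n" assume z: "z \<in> flat_torus_teich"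
    define Z where "Z = mlog (V ** z ** transpose V)"
    have zp: "wp_dist z p = norm Z"
      unfolding wp_dist_commute[of z] p_def Z_def by (rule wp_dist_frame'[OF V dW' dV z])
    have "norm (Z + q *\<^sub>R L) \<le> wp_dist z x" "norm (Z - (1 - q) *\<^sub>R L) \<le> wp_dist z y"
      using wp_dist_lower_bound[OF x z dV] wp_dist_lower_bound[OF y z dV]
      by (simp_all add: Vx Z_def[symmetric] wp_dist_commute[of z])
    then have "(norm (Z + q *\<^sub>R L))\<^sup>2 \<le> (wp_dist z x)\<^sup>2" "(norm (Z - (1 - q) *\<^sub>R L))\<^sup>2 \<le> (wp_dist z y)\<^sup>2"
      by (intro power_mono; simp)+
    then have "(1 - q) * (norm (Z + q *\<^sub>R L))\<^sup>2 + q * (norm (Z - (1 - q) *\<^sub>R L))\<^sup>2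
        \<le> (1 - q) * (wp_dist z x)\<^sup>2 + q * (wp_dist z y)\<^sup>2"
      using q by (intro add_mono mult_left_mono) auto
    moreover have "(1 - q) * (norm (Z + q *\<^sub>R L))\<^sup>2 + q * (norm (Z - (1 - q) *\<^sub>R L))\<^sup>2
        = (norm Z)\<^sup>2 + q * (1 - q) * D\<^sup>2"
      unfolding L[symmetric] power2_norm_eq_inner
      by (simp add: inner_add_left inner_add_right inner_diff_left inner_diff_right inner_commute algebra_simps)
    ultimately have "D * ((norm Z)\<^sup>2 + q * (1 - q) * D\<^sup>2) \<le> D * ((1 - q) * (wp_dist z x)\<^sup>2 + q * (wp_dist z y)\<^sup>2)"
      using D by (intro mult_left_mono) auto
    then show "wp_dist x y * (wp_dist z p)\<^sup>2 \<le>
      (wp_dist x y - s) * (wp_dist z x)\<^sup>2 + s * (wp_dist z y)\<^sup>2 - s * (wp_dist x y - s) * wp_dist x y"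
      unfolding D_def[symmetric] zp sq by (simp add: algebra_simps power2_eq_square)
  qed
qed

section \<open>Compactness of closed balls\<close>

lemma continuous_map_id_wp:
  "continuous_map (top_of_set flat_torus_teich)
     (Metric_space.mtopology (flat_torus_teich :: (real^'n^'n) set) wp_dist) id"
proof -
  interpret Metric_space "flat_torus_teich :: (real^'n^'n) set" wp_dist by (rule wp_dist_metric)
  show ?thesis
    unfolding continuous_map_to_metric
  proof (intro ballI allI impI)
    fix x :: "real^'n^'n" and \<epsilon> :: real
    assume "x \<in> topspace (top_of_set flat_torus_teich)" and \<epsilon>: "0 < \<epsilon>"
    then have x: "x \<in> flat_torus_teich" by simp
    obtain W V where W: "(det W)\<^sup>2 = 1" "(det V)\<^sup>2 = 1" "V ** W = mat 1" "W ** V = mat 1" "x = W ** transpose W"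
      using flat_torus_teich_frame[OF x] by metis
    have "((\<lambda>y. mlog (V ** y ** transpose V)) \<longlongrightarrow> mlog (V ** x ** transpose V)) (at x within flat_torus_teich)"
      by (intro tendsto_mlog_congruence W x tendsto_ident_at) (auto simp: eventually_at intro!: exI[of _ 1])
    moreover have "mlog (V ** x ** transpose V) = 0"
      using congruence_cancel[OF W(3), of "mat 1"] W(5) by simp
    ultimately obtain \<delta> where \<delta>: "\<delta> > 0"
      "\<And>y. y \<in> flat_torus_teich \<Longrightarrow> y \<noteq> x \<Longrightarrow> dist y x < \<delta> \<Longrightarrow> norm (mlog (V ** y ** transpose V)) < \<epsilon>"
      using \<epsilon> by (auto simp: tendsto_iff eventually_at)
    have "wp_dist x y < \<epsilon>" if "y \<in> flat_torus_teich \<inter> ball x \<delta>" for y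
    proof (cases "y = x")
      case True
      then show ?thesis using \<epsilon> x by simp
    next
      case False
      then show ?thesis
        using \<delta>(2)[of y] that wp_dist_frame'[OF W(3,4,1,2), of y] W(5) by (simp add: dist_commute)
    qed
    then show "\<exists>U. openin (top_of_set flat_torus_teich) U \<and> x \<in> U \<and> (\<forall>y\<in>U. id y \<in> mball (id x) \<epsilon>)"
      using x \<delta>(1) by (intro exI[of _ "flat_torus_teich \<inter> ball x \<delta>"]) (auto simp: openin_open_Int)
  qed
qed

lemma compact_orthogonal_matrices: "compact {U :: real^'n^'n. orthogonal_matrix U}"
proof -
  have "norm U \<le> norm (mat 1 :: real^'n^'n)" if "orthogonal_matrix U" for U :: "real^'n^'n"
    using norm_orthogonal_mult(1)[OF that, of "mat 1"] by simp
  then have "bounded {U :: real^'n^'n. orthogonal_matrix U}"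
    unfolding bounded_iff by blast
  moreover have "continuous_on UNIV (\<lambda>U :: real^'n^'n. transpose U ** U)"
    unfolding transpose_def by (intro matrix_mult.continuous_on continuous_intros)
  then have "closed {U :: real^'n^'n. orthogonal_matrix U}"
    unfolding orthogonal_matrix by (intro closed_Collect_eq) auto
  ultimately show ?thesis by (simp add: compact_eq_bounded_closed)
qed

text \<open>Every point of the space is \<open>f (U, l)\<close> with the logarithms of its
  eigenvalues in \<open>l\<close>. At bounded distance from the identity \<open>l\<close> stays in a
  compact set, so the ball is a closed subset of a compact one. Continuity of \<open>id\<close>
  transfers compactness from the matrix topology to that of the distance.\<close>

lemma compactin_wp_mcball:
  fixes x :: "real^'n^'n"
  assumes x: "x \<in> flat_torus_teich"
  shows "compactin (Metric_space.mtopology flat_torus_teich wp_dist) (Metric_space.mcball flat_torus_teich wp_dist x r)"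
proof -
  interpret Metric_space "flat_torus_teich :: (real^'n^'n) set" wp_dist by (rule wp_dist_metric)
  define R where "R = wp_dist (mat 1) x + r"
  define A where "A = {l :: real^'n. (\<Sum>i\<in>UNIV. l $ i) = 0} \<inter> cball 0 R"
  define f where "f = (\<lambda>(U :: real^'n^'n, l :: real^'n). U ** diagm (\<lambda>i. exp (l $ i :: real)) ** transpose U :: real^'n^'n)"
  define K where "K = f ` ({U. orthogonal_matrix U} \<times> A)"
  have "compact A" unfolding A_def
    by (intro closed_Int_compact closed_Collect_eq) (auto intro!: continuous_intros)
  then have "compact ({U :: real^'n^'n. orthogonal_matrix U} \<times> A)"
    by (intro compact_Times compact_orthogonal_matrices)
  moreover have "continuous_on S f" for S
  proof -
    have "continuous_on S (\<lambda>p :: (real^'n^'n) \<times> (real^'n). diagm (\<lambda>i. exp (snd p $ i)))"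
      unfolding diagm_def
    proof (intro continuous_intros)
      show "continuous_on S (\<lambda>p :: (real^'n^'n) \<times> (real^'n). if i = j then exp (snd p $ i) else 0)" for i j
        by (cases "i = j") (auto intro!: continuous_intros)
    qed
    then show ?thesis
      unfolding f_def case_prod_unfold transpose_def by (intro matrix_mult.continuous_on continuous_intros)
  qed
  ultimately have "compact K" unfolding K_def by (intro compact_continuous_image)
  moreover have "K \<subseteq> flat_torus_teich"
    unfolding K_def f_def A_def
    by (auto intro!: flat_torus_teich_congruence flat_torus_teich_diagm det_orthogonal_power2 simp: exp_sum[symmetric])
  ultimately have "compactin (top_of_set flat_torus_teich) K" by (simp add: compactin_subtopology)
  then have K: "compactin mtopology K"
    using image_compactin[OF _ continuous_map_id_wp] by fastforce
  have "mcball x r \<subseteq> K"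
  proof
    fix z assume "z \<in> mcball x r"
    then have z: "z \<in> flat_torus_teich" "wp_dist x z \<le> r" by auto
    then have "wp_dist (mat 1) z \<le> R"
      using triangle[of "mat 1" x z] x by (auto simp: R_def)
    obtain U l where U: "orthogonal_matrix U" "\<And>i. l i > 0" "prod l UNIV = 1" "z = U ** diagm l ** transpose U"
      using flat_torus_teich_diagonalization[OF z(1)] by metis
    have "norm (\<chi> i. ln (l i)) = norm (diagm (\<lambda>i. ln (l i)))"
      by (simp add: norm_diagm) (simp add: norm_vec_def L2_set_def)
    also have "\<dots> = norm (mlog z)"
      using U(1) unfolding U(4) by (simp add: mlog_eq[of U l, OF U(1,2)] norm_orthogonal_mult)
    also have "\<dots> = wp_dist (mat 1) z"
      using wp_dist_frame[of "mat 1" z] z(1) by simp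
    finally have "norm (\<chi> i. ln (l i)) \<le> R" using \<open>wp_dist (mat 1) z \<le> R\<close> by simp
    moreover have "(\<Sum>i\<in>UNIV. ln (l i)) = ln (prod l UNIV)"
      using U(2) by (intro ln_prod[symmetric]) (auto simp: less_imp_neq[THEN not_sym])
    ultimately have "(\<chi> i. ln (l i)) \<in> A" by (simp add: A_def U(3))
    moreover have "z = f (U, \<chi> i. ln (l i))" using U(2) by (simp add: f_def U(4))
    ultimately show "z \<in> K" unfolding K_def using U(1) by blast
  qed
  then show ?thesis
    using closed_compactin[OF K] by blast
qed

section \<open>Proper \<open>CAT(0)\<close> spaces\<close>

text \<open>The inequality is that of Stewart's theorem in the Euclidean plane; it characterizes \<open>CAT(0)\<close>
  spaces among geodesic ones.\<close>

locale proper_CAT0 = Metric_space +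
  assumes nonempty: "M \<noteq> {}"
    and compactin_mcball: "x \<in> M \<Longrightarrow> compactin mtopology (mcball x r)"
    and ex_stewart_point: "\<lbrakk>x \<in> M; y \<in> M; 0 \<le> s; s \<le> d x y\<rbrakk> \<Longrightarrow> \<exists>p\<in>M. \<forall>z\<in>M.
      d x y * (d z p)\<^sup>2 \<le> (d x y - s) * (d z x)\<^sup>2 + s * (d z y)\<^sup>2 - s * (d x y - s) * d x y"
begin

text \<open>Geodesics are handled point by point: equality in the triangle inequality singles out
  one point for each \<open>s\<close>, so no parametrized curve has to be carried along. The bounds
  on \<open>s\<close> follow from nonnegativity of \<open>d\<close>.\<close>

definition between :: "'a \<Rightarrow> real \<Rightarrow> 'a \<Rightarrow> 'a \<Rightarrow> bool" where
  "between x s y p \<longleftrightarrow> p \<in> M \<and> d x p = s \<and> d p y = d x y - s"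

lemma betweenD: "between x s y p \<Longrightarrow> p \<in> M \<and> d x p = s \<and> d p y = d x y - s \<and> 0 \<le> s \<and> s \<le> d x y"
  unfolding between_def using nonneg[of x p] nonneg[of p y] by auto

text \<open>Stewart's inequality at \<open>z = x\<close> and \<open>z = y\<close> bounds the two
  partial distances by \<open>s\<close> and \<open>d x y - s\<close>; the triangle inequality makes
  both sharp.\<close>

lemma ex_between:
  assumes "x \<in> M" "y \<in> M" "0 \<le> s" "s \<le> d x y"
  obtains p where "between x s y p"
proof (cases "d x y = 0")
  case True
  then show ?thesis using assms that[of x] by (auto simp: between_def)
next
  case False
  then have D: "d x y > 0" by (metis nonneg less_eq_real_def)
  obtain p where p: "p \<in> M" "\<And>z. z \<in> M \<Longrightarrow>
      d x y * (d z p)\<^sup>2 \<le> (d x y - s) * (d z x)\<^sup>2 + s * (d z y)\<^sup>2 - s * (d x y - s) * d x y"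
    using ex_stewart_point[OF assms] by blast
  have "d x y * (d x p)\<^sup>2 \<le> d x y * s\<^sup>2"
    using p(2)[OF assms(1)] assms by (simp add: algebra_simps power2_eq_square)
  then have 1: "d x p \<le> s" using D assms(3) by (simp add: power2_le_iff_abs_le)
  have "d x y * (d y p)\<^sup>2 \<le> d x y * (d x y - s)\<^sup>2"
    using p(2)[OF assms(2)] assms commute[of y x] by (simp add: algebra_simps power2_eq_square)
  then have 2: "d y p \<le> d x y - s" using D assms(4) by (simp add: power2_le_iff_abs_le)
  have "d x y \<le> d x p + d y p" using triangle'[of x p y] p(1) assms by simp
  then show ?thesis using 1 2 p(1) commute[of y p] by (intro that[of p]) (auto simp: between_def)
qed

text \<open>Every point between \<open>x\<close> and \<open>y\<close> inherits the inequality: at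
  \<open>z = p\<close> the right side is 0, so \<open>p\<close> is the point supplied by
  \<open>ex_stewart_point\<close>.\<close>

lemma stewart:
  assumes xy: "x \<in> M" "y \<in> M" and p: "between x s y p" and z: "z \<in> M"
  shows "d x y * (d z p)\<^sup>2 \<le> (d x y - s) * (d z x)\<^sup>2 + s * (d z y)\<^sup>2 - s * (d x y - s) * d x y"
proof (cases "d x y = 0")
  case True
  then have "s = 0" using betweenD[OF p] by linarith
  then show ?thesis using True by simp
next
  case False
  then have D: "d x y > 0" by (metis nonneg less_eq_real_def)
  obtain q where q: "q \<in> M" "\<And>z. z \<in> M \<Longrightarrow>
      d x y * (d z q)\<^sup>2 \<le> (d x y - s) * (d z x)\<^sup>2 + s * (d z y)\<^sup>2 - s * (d x y - s) * d x y"
    using ex_stewart_point[OF xy, of s] betweenD[OF p] by blast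
  have "d x y * (d p q)\<^sup>2 \<le> 0"
    using q(2)[of p] betweenD[OF p] commute[of p x] by (simp add: algebra_simps power2_eq_square)
  then have "d p q = 0" using D by (simp add: mult_le_0_iff)
  then show ?thesis using q z betweenD[OF p] by auto
qed

lemma stewart_scaled:
  assumes xy: "x \<in> M" "y \<in> M" and p: "between x (t * d x y) y p" and z: "z \<in> M" and t: "0 \<le> t" "t \<le> 1"
  shows "(d z p)\<^sup>2 \<le> (1 - t) * (d z x)\<^sup>2 + t * (d z y)\<^sup>2 - t * (1 - t) * (d x y)\<^sup>2"
proof (cases "d x y = 0")
  case True
  then have "d x p = 0" using betweenD[OF p] by simp
  then have "p = x" "y = x" using True xy betweenD[OF p] by auto
  then show ?thesis using xy by (simp add: algebra_simps)
next
  case False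
  then have D: "d x y > 0" by (metis nonneg less_eq_real_def)
  have "d x y * (d z p)\<^sup>2 \<le> d x y * ((1 - t) * (d z x)\<^sup>2 + t * (d z y)\<^sup>2 - t * (1 - t) * (d x y)\<^sup>2)"
    using stewart[OF xy p z] by (simp add: algebra_simps power2_eq_square)
  then show ?thesis using D by simp
qed

lemma between_commute: "x \<in> M \<Longrightarrow> y \<in> M \<Longrightarrow> between x s y p \<longleftrightarrow> between y (d x y - s) x p"
  unfolding between_def using commute[of x y] commute[of x p] commute[of p y] by auto

text \<open>Two uses of Stewart's inequality, on the side from \<open>y\<close> to \<open>u\<close>
  seen from \<open>q\<close> and on the side from \<open>y\<close> to \<open>v\<close> seen from
  \<open>u\<close>. All terms except \<open>(t * d u v)\<^sup>2\<close> cancel.\<close>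

lemma thales:
  assumes M: "y \<in> M" "u \<in> M" "v \<in> M" and t: "0 \<le> t" "t \<le> 1"
    and p: "between y (t * d y u) u p" and q: "between y (t * d y v) v q"
  shows "d p q \<le> t * d u v"
proof -
  have pM: "p \<in> M" and qM: "q \<in> M" using betweenD p q by auto
  have yq: "d q y = t * d y v" using betweenD[OF q] commute by metis
  have "(d q p)\<^sup>2 \<le> (1 - t) * (d q y)\<^sup>2 + t * (d q u)\<^sup>2 - t * (1 - t) * (d y u)\<^sup>2"
    by (rule stewart_scaled[OF M(1,2) p qM t])
  moreover have "t * (d u q)\<^sup>2 \<le> t * ((1 - t) * (d u y)\<^sup>2 + t * (d u v)\<^sup>2 - t * (1 - t) * (d y v)\<^sup>2)"
    using stewart_scaled[OF M(1,3) q M(2) t] t by (intro mult_left_mono)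
  ultimately have "(d q p)\<^sup>2 \<le> (t * d u v)\<^sup>2"
    unfolding yq by (simp add: commute[of u q] commute[of u y] algebra_simps power2_eq_square)
  then show ?thesis using t by (simp add: commute[of p q] power2_le_iff_abs_le)
qed

text \<open>Stewart's inequality seen from \<open>q\<close>; the terms of order 0 in
  \<open>e\<close> cancel. The bound does not contain \<open>d b0 y\<close>, hence survives when
  \<open>y\<close> goes to infinity, and \<open>e = 0\<close> gives uniqueness of geodesics.\<close>

lemma between_dist_le:
  assumes M: "b0 \<in> M" "y \<in> M" "q \<in> M" and p: "between b0 r y p"
    and q: "d b0 q \<le> r" "d q y \<le> d b0 y - r + e" and e: "0 \<le> e"
  shows "(d q p)\<^sup>2 \<le> 2 * r * e + e\<^sup>2"
proof (cases "d b0 y = 0")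
  case True
  then have "r = 0" using betweenD[OF p] by auto
  then have "d b0 q = 0" "d b0 p = 0" using q(1) nonneg[of b0 q] betweenD[OF p] by auto
  then have "q = p" using M betweenD[OF p] by auto
  then show ?thesis using M e \<open>r = 0\<close> by simp
next
  case False
  define D where "D = d b0 y"
  have D: "D > 0" using False unfolding D_def by (metis nonneg less_eq_real_def)
  have r: "0 \<le> r" "r \<le> D" using betweenD[OF p] by (auto simp: D_def)
  have "(d q b0)\<^sup>2 \<le> r\<^sup>2" "(d q y)\<^sup>2 \<le> (D - r + e)\<^sup>2"
    using q commute[of q b0] by (auto simp: D_def intro!: power_mono)
  then have "(D - r) * (d q b0)\<^sup>2 + r * (d q y)\<^sup>2 \<le> (D - r) * r\<^sup>2 + r * (D - r + e)\<^sup>2"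
    using r by (intro add_mono mult_left_mono) auto
  then have "D * (d q p)\<^sup>2 \<le> (D - r) * r\<^sup>2 + r * (D - r + e)\<^sup>2 - r * (D - r) * D"
    using stewart[OF M(1,2) p M(3)] by (simp add: D_def)
  also have "\<dots> = D * (2 * r * e + e\<^sup>2) - (2 * r\<^sup>2 * e + (D - r) * e\<^sup>2)"
    by (simp add: algebra_simps power2_eq_square)
  also have "\<dots> \<le> D * (2 * r * e + e\<^sup>2)"
  proof -
    have "0 \<le> 2 * r\<^sup>2 * e" "0 \<le> (D - r) * e\<^sup>2" using r e by simp_all
    then show ?thesis by linarith
  qed
  finally show ?thesis using D by simp
qed

text \<open>The triangle inequality gives one side without error: the difference is nonnegative.
  Stewart's inequality seen from \<open>x\<close> gives the other, after a square root. The error is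
  again free of \<open>d b0 y\<close>.\<close>

lemma horofunction_between_le:
  assumes M: "b0 \<in> M" "y \<in> M" "x \<in> M" and p: "between b0 r y p" and r: "d b0 x < r"
  shows "\<bar>(d x p - r) - (d x y - d b0 y)\<bar> \<le> (d b0 x)\<^sup>2 / (r - d b0 x)"
proof -
  define D A b where "D = d b0 y" and "A = d b0 x" and "b = d b0 y - d x y"
  have pM: "p \<in> M" and rD: "r \<le> D" using betweenD[OF p] by (auto simp: D_def)
  have A: "0 \<le> A" "A < r" using r by (auto simp: A_def)
  then have D: "D > 0" using rD by linarith
  have b: "\<bar>b\<bar> \<le> A"
    using mdist_reverse_triangle[of b0 y x] M commute[of y x] unfolding b_def A_def by simp
  then have b2: "b\<^sup>2 \<le> A\<^sup>2" by (metis abs_le_square_iff abs_of_nonneg A(1))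
  have Y: "d x y = D - b" by (simp add: b_def D_def)
  have "D * (d x p)\<^sup>2 \<le> (D - r) * A\<^sup>2 + r * (D - b)\<^sup>2 - r * (D - r) * D"
    using stewart[OF M(1,2) p M(3)] Y by (simp add: D_def[symmetric] A_def commute[of b0 x])
  also have "\<dots> = D * (A\<^sup>2 + r\<^sup>2 - 2 * r * b) + r * b\<^sup>2 - r * A\<^sup>2"
    by (simp add: algebra_simps power2_eq_square)
  also have "\<dots> \<le> D * (A\<^sup>2 + r\<^sup>2 - 2 * r * b)"
    using b2 A by (simp add: mult_left_mono)
  also have "\<dots> \<le> D * ((r - b)\<^sup>2 + 2 * A\<^sup>2)"
    using D by (intro mult_left_mono) (auto simp: power2_diff)
  finally have "(d x p)\<^sup>2 \<le> (r - b)\<^sup>2 + 2 * A\<^sup>2" using D by simp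
  \<comment> \<open>The error \<open>E\<close> solves \<open>A\<^sup>2 = (r - A) * E\<close>: since
    \<open>b \<le> A\<close>, the mixed term \<open>2 * ((r - b) * E)\<close> of the square absorbs
    \<open>2 * A\<^sup>2\<close>.\<close>
  also have "\<dots> \<le> (r - b + A\<^sup>2 / (r - A))\<^sup>2"
  proof -
    define E where "E = A\<^sup>2 / (r - A)"
    have "A\<^sup>2 = (r - A) * E" using A by (simp add: E_def)
    also have "\<dots> \<le> (r - b) * E" using A b by (intro mult_right_mono) (auto simp: E_def)
    finally have "(r - b)\<^sup>2 + 2 * A\<^sup>2 \<le> (r - b)\<^sup>2 + 2 * ((r - b) * E) + E\<^sup>2"
      using zero_le_power2[of E] by linarith
    then show ?thesis unfolding E_def[symmetric] power2_sum by (simp add: algebra_simps)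
  qed
  finally have "(d x p)\<^sup>2 \<le> (r - b + A\<^sup>2 / (r - A))\<^sup>2" .
  moreover have "0 \<le> r - b + A\<^sup>2 / (r - A)"
    using A b by (intro add_nonneg_nonneg) auto
  ultimately have "d x p \<le> r - b + A\<^sup>2 / (r - A)" by (rule power2_le_imp_le)
  moreover have "d x y \<le> d x p + (D - r)"
    using triangle[of x p y] M pM betweenD[OF p] by (simp add: D_def)
  moreover have "0 \<le> A\<^sup>2 / (r - A)" using A by simp
  ultimately show ?thesis by (simp add: A_def[symmetric] D_def[symmetric] Y abs_le_iff)
qed

section \<open>Geodesic rays and Busemann functions\<close>

lemma geodesic_rayD:
  assumes "geodesic_ray c"
  shows "0 \<le> t \<Longrightarrow> c t \<in> M" "0 \<le> s \<Longrightarrow> 0 \<le> t \<Longrightarrow> d (c s) (c t) = \<bar>s - t\<bar>"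
  using assms by (auto simp: geodesic_ray_def)

lemma between_ray: "geodesic_ray c \<Longrightarrow> 0 \<le> r \<Longrightarrow> r \<le> t \<Longrightarrow> between (c 0) r (c t) (c r)"
  using geodesic_rayD[of c] by (auto simp: between_def)

text \<open>An infimum instead of a limit: along a ray \<open>d x (c t) - t\<close> is nonincreasing
  and bounded below, so the two agree.\<close>

definition busemann :: "(real \<Rightarrow> 'a) \<Rightarrow> 'a \<Rightarrow> real" where
  "busemann c x = (INF t\<in>{0..}. d x (c t) - t)"

lemma busemann_tendsto:
  assumes c: "geodesic_ray c" and x: "x \<in> M"
  shows "((\<lambda>t. d x (c t) - t) \<longlongrightarrow> busemann c x) at_top"
proof (rule decreasing_tendsto)
  have "- d x (c 0) \<le> d x (c t) - t" if "t \<ge> 0" for t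
    using triangle[of "c 0" x "c t"] geodesic_rayD[OF c] x that commute[of x "c 0"] by auto
  then have bdd: "bdd_below ((\<lambda>t. d x (c t) - t) ` {0..})" by (auto intro!: bdd_belowI2)
  show "\<forall>\<^sub>F t in at_top. busemann c x \<le> d x (c t) - t"
    using eventually_ge_at_top[of 0] unfolding busemann_def
    by eventually_elim (use bdd in \<open>auto intro: cINF_lower\<close>)
  fix l assume "busemann c x < l"
  then obtain s where s: "s \<ge> 0" "d x (c s) - s < l"
    unfolding busemann_def using cINF_less_iff[OF _ bdd] by auto
  show "\<forall>\<^sub>F t in at_top. d x (c t) - t < l"
    using eventually_ge_at_top[of s]
  proof eventually_elim
    case (elim t)
    then show ?case
      using triangle[of x "c s" "c t"] geodesic_rayD[OF c] x s by auto
  qed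
qed

lemma busemann_diff_tendsto:
  assumes c: "geodesic_ray c" and x: "x \<in> M" "y \<in> M"
  shows "((\<lambda>t. d x (c t) - d y (c t)) \<longlongrightarrow> busemann c x - busemann c y) at_top"
  using tendsto_diff[OF busemann_tendsto[OF c x(1)] busemann_tendsto[OF c x(2)]] by simp

lemma busemann_ray: "geodesic_ray c \<Longrightarrow> 0 \<le> s \<Longrightarrow> busemann c (c s) = - s"
proof (rule tendsto_unique[OF _ busemann_tendsto])
  assume c: "geodesic_ray c" "0 \<le> s"
  then show "((\<lambda>t. d (c s) (c t) - t) \<longlongrightarrow> - s) at_top"
    by (intro tendsto_eventually eventually_mono[OF eventually_ge_at_top[of s]]) (auto simp: geodesic_rayD)
qed (auto simp: geodesic_rayD)

lemma busemann_lipschitz: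
  assumes "geodesic_ray c" "x \<in> M" "y \<in> M"
  shows "\<bar>busemann c x - busemann c y\<bar> \<le> d x y"
proof (rule tendsto_upperbound[OF tendsto_rabs[OF busemann_diff_tendsto[OF assms]]])
  show "\<forall>\<^sub>F t in at_top. \<bar>d x (c t) - d y (c t)\<bar> \<le> d x y"
    using eventually_ge_at_top[of 0]
  proof eventually_elim
    case (elim t)
    then show ?case using mdist_reverse_triangle[of x "c t" y] assms geodesic_rayD commute[of y] by simp
  qed
qed auto

lemma busemann_ray_le:
  assumes c: "geodesic_ray c" and x: "x \<in> M" and r: "d (c 0) x < r"
  shows "\<bar>(d x (c r) - r) - busemann c x\<bar> \<le> (d (c 0) x)\<^sup>2 / (r - d (c 0) x)"
proof (rule tendsto_upperbound[OF tendsto_rabs[OF tendsto_diff[OF tendsto_const busemann_tendsto[OF c x]]]])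
  have r0: "0 \<le> r" using r nonneg[of "c 0" x] by linarith
  show "\<forall>\<^sub>F t in at_top. \<bar>(d x (c r) - r) - (d x (c t) - t)\<bar> \<le> (d (c 0) x)\<^sup>2 / (r - d (c 0) x)"
    using eventually_ge_at_top[of r]
  proof eventually_elim
    case (elim t)
    then show ?case
      using horofunction_between_le[OF _ _ x between_ray[OF c r0 elim] r] geodesic_rayD[OF c] r0 by simp
  qed
qed auto

text \<open>The strict hypothesis on the limit already holds at some finite time
  \<open>t \<ge> r\<close>, where \<open>between_dist_le\<close> applies with
  \<open>y = c t\<close>.\<close>

lemma busemann_dist_le:
  assumes c: "geodesic_ray c" and q: "q \<in> M" "d (c 0) q \<le> r" "busemann c q < - r + e" and e: "0 \<le> e"
  shows "(d q (c r))\<^sup>2 \<le> 2 * r * e + e\<^sup>2"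
proof -
  have r0: "0 \<le> r" using q(2) nonneg[of "c 0" q] by linarith
  have "\<forall>\<^sub>F t in at_top. d q (c t) - t < - r + e"
    using order_tendstoD(2)[OF busemann_tendsto[OF c q(1)] q(3)] .
  then obtain t where t: "t \<ge> r" "d q (c t) - t < - r + e"
    by (metis (mono_tags, lifting) eventually_at_top_linorder linorder_le_cases order_trans order_refl)
  then show ?thesis
    using r0 geodesic_rayD[OF c] by (intro between_dist_le[OF _ _ q(1) between_ray[OF c r0 t(1)] q(2) _ e]) auto
qed

lemma ex_small_error:
  fixes r \<delta> :: real
  assumes "0 \<le> r" "0 < \<delta>"
  shows "\<exists>e>0. e \<le> 1 \<and> 2 * r * e + e\<^sup>2 < \<delta>\<^sup>2"
proof -
  have "((\<lambda>e. 2 * r * e + e\<^sup>2) \<longlongrightarrow> 2 * r * 0 + 0\<^sup>2) (at_right 0)" by (intro tendsto_intros)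
  then have "\<forall>\<^sub>F e in at_right 0. 2 * r * e + e\<^sup>2 < \<delta>\<^sup>2" using assms by (intro order_tendstoD) auto
  moreover have "\<forall>\<^sub>F e in at_right (0::real). 0 < e \<and> e \<le> 1"
    unfolding eventually_at_right_field by (intro exI[of _ 1]) auto
  ultimately have "\<forall>\<^sub>F e in at_right 0. 2 * r * e + e\<^sup>2 < \<delta>\<^sup>2 \<and> 0 < e \<and> e \<le> 1" by (rule eventually_conj)
  then show ?thesis using eventually_happens'[OF trivial_limit_at_right_real] by fastforce
qed

lemma eventually_error_small:
  fixes A C e :: real
  assumes "0 < e"
  shows "\<forall>\<^sub>F r in at_top. A < r \<and> 0 \<le> r \<and> C / (r - A) < e"
proof -
  have "LIM r at_top. - A + r :> at_top"
    by (intro filterlim_tendsto_add_at_top[OF tendsto_const] filterlim_ident)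
  then have "((\<lambda>r. C / (r - A)) \<longlongrightarrow> 0) at_top"
    by (intro real_tendsto_divide_at_top[OF tendsto_const]) simp
  then have "\<forall>\<^sub>F r in at_top. C / (r - A) < e" using assms by (rule order_tendstoD)
  then show ?thesis using eventually_gt_at_top[of A] eventually_ge_at_top[of 0] by eventually_elim auto
qed

text \<open>From \<open>b0\<close>, look at a far point \<open>y = c' t\<close>. Since
  \<open>c t\<close> is near \<open>y\<close>, the point at distance \<open>R\<close> towards
  \<open>y\<close> is within order sqrt R of \<open>c R\<close>. Contraction by \<open>r / R\<close>
  brings the geodesic towards \<open>y\<close> arbitrarily close to \<open>c\<close> at time
  \<open>r\<close>, and \<open>horofunction_between_le\<close> then compares the two
  functions.\<close>

lemma asymptotic_busemann:
  assumes "(c, c') \<in> asymptotic" and x: "x \<in> M"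
  shows "busemann c x = busemann c' x - busemann c' (c 0)"
proof -
  obtain B where c: "geodesic_ray c" and c': "geodesic_ray c'" and B: "\<And>t. t \<ge> 0 \<Longrightarrow> d (c t) (c' t) \<le> B"
    using assms(1) by (auto simp: asymptotic_def)
  define b0 A where "b0 = c 0" and "A = d b0 x"
  have b0: "b0 \<in> M" using geodesic_rayD[OF c] by (simp add: b0_def)
  have B0: "0 \<le> B" using B[of 0] nonneg[of "c 0" "c' 0"] by linarith
  \<comment> \<open>Four errors of size \<open>e\<close>: the convergence in \<open>t\<close>, the
    gap between \<open>c r\<close> and \<open>p\<close>, and the estimate with
    \<open>A\<^sup>2 / (r - A)\<close> at each of these two points.\<close>
  have *: "\<bar>busemann c x - (busemann c' x - busemann c' b0)\<bar> \<le> 4 * e" if e: "e > 0" for e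
  proof -
    obtain r where r: "A < r" "0 \<le> r" "A\<^sup>2 / (r - A) < e"
      using eventually_happens'[OF trivial_limit_at_top_linorder eventually_error_small[OF e, of A "A\<^sup>2"]] by auto
    have "((\<lambda>R. r / R * sqrt (2 * R * (2 * B) + (2 * B)\<^sup>2)) \<longlongrightarrow> 0) at_top"
    proof (rule Lim_transform_eventually)
      have "((\<lambda>R. r * sqrt (4 * B / R + (2 * B)\<^sup>2 / R\<^sup>2)) \<longlongrightarrow> r * sqrt (0 + 0)) at_top"
        by (intro tendsto_intros real_tendsto_divide_at_top[OF tendsto_const] filterlim_ident filterlim_pow_at_top) simp
      then show "((\<lambda>R. r * sqrt (4 * B / R + (2 * B)\<^sup>2 / R\<^sup>2)) \<longlongrightarrow> 0) at_top" by simp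
      show "\<forall>\<^sub>F R in at_top. r * sqrt (4 * B / R + (2 * B)\<^sup>2 / R\<^sup>2) = r / R * sqrt (2 * R * (2 * B) + (2 * B)\<^sup>2)"
        using eventually_gt_at_top[of 0]
      proof eventually_elim
        case (elim R)
        have "4 * B / R + (2 * B)\<^sup>2 / R\<^sup>2 = (2 * R * (2 * B) + (2 * B)\<^sup>2) / R\<^sup>2"
          using elim by (simp add: field_simps power2_eq_square)
        then show ?case using elim by (simp add: real_sqrt_divide)
      qed
    qed
    then have "\<forall>\<^sub>F R in at_top. r / R * sqrt (2 * R * (2 * B) + (2 * B)\<^sup>2) < e" using e by (rule order_tendstoD)
    then have "\<forall>\<^sub>F R in at_top. r / R * sqrt (2 * R * (2 * B) + (2 * B)\<^sup>2) < e \<and> r \<le> R \<and> 0 < R"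
      using eventually_ge_at_top[of r] eventually_gt_at_top[of 0] by eventually_elim auto
    then obtain R where R: "r / R * sqrt (2 * R * (2 * B) + (2 * B)\<^sup>2) < e" "r \<le> R" "0 < R"
      by (auto dest!: eventually_happens'[OF trivial_limit_at_top_linorder])
    have "\<forall>\<^sub>F t in at_top. \<bar>d x (c' t) - d b0 (c' t) - (busemann c' x - busemann c' b0)\<bar> < e"
      using tendstoD[OF busemann_diff_tendsto[OF c' x b0] e] by (simp add: dist_real_def)
    then have "\<forall>\<^sub>F t in at_top. \<bar>d x (c' t) - d b0 (c' t) - (busemann c' x - busemann c' b0)\<bar> < e \<and> R + B \<le> t"
      using eventually_ge_at_top[of "R + B"] by eventually_elim auto
    then obtain t where t: "\<bar>d x (c' t) - d b0 (c' t) - (busemann c' x - busemann c' b0)\<bar> < e" "R + B \<le> t"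
      by (auto dest!: eventually_happens'[OF trivial_limit_at_top_linorder])
    define y where "y = c' t"
    have t0: "t \<ge> 0" "R \<le> t" using t R B0 by auto
    have yM: "y \<in> M" using geodesic_rayD[OF c'] t0 by (simp add: y_def)
    have cM: "c r \<in> M" "c R \<in> M" "c t \<in> M" using geodesic_rayD[OF c] r R t0 by auto
    have ct: "d b0 (c t) = t" using geodesic_rayD(2)[OF c, of 0 t] t0 by (simp add: b0_def)
    have Dt: "t \<le> d b0 y + B"
      using triangle'[of b0 "y" "c t"] B[of t] t0 b0 yM cM ct by (simp add: y_def)
    then have D: "R \<le> d b0 y" using t by linarith
    obtain v where v: "between b0 R y v" using ex_between[OF b0 yM, of R] R D by auto
    have vM: "v \<in> M" "d b0 v = R" using betweenD[OF v] by auto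
    obtain p where p: "between b0 r v p" using ex_between[OF b0 vM(1), of r] r R vM by auto
    have pM: "p \<in> M" using betweenD[OF p] by simp
    have "d p y \<le> d b0 y - r" using triangle[of p v y] betweenD[OF p] betweenD[OF v] yM by auto
    moreover have "d b0 y \<le> d b0 p + d p y" using triangle b0 pM yM by simp
    ultimately have py: "between b0 r y p" using betweenD[OF p] by (auto simp: between_def)
    \<comment> \<open>One \<open>B\<close> comes from \<open>d (c t) y \<le> B\<close>, the other
      from \<open>t \<le> d b0 y + B\<close>.\<close>
    have "(d (c R) v)\<^sup>2 \<le> 2 * R * (2 * B) + (2 * B)\<^sup>2"
    proof (rule between_dist_le[OF b0 yM cM(2) v])
      show "d b0 (c R) \<le> R" using geodesic_rayD(2)[OF c, of 0 R] R by (simp add: b0_def)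
      show "d (c R) y \<le> d b0 y - R + 2 * B"
        using triangle[of "c R" "c t" y] geodesic_rayD(2)[OF c, of R t] R t0 B[of t] Dt yM cM by (simp add: y_def)
    qed (use B0 in simp)
    then have "d (c R) v \<le> sqrt (2 * R * (2 * B) + (2 * B)\<^sup>2)" by (rule real_le_rsqrt)
    then have "r / R * d (c R) v \<le> r / R * sqrt (2 * R * (2 * B) + (2 * B)\<^sup>2)"
      using r R by (intro mult_left_mono) auto
    moreover have "d (c r) p \<le> r / R * d (c R) v"
    proof (rule thales[OF b0 cM(2) vM(1)])
      have "d b0 (c R) = R" using geodesic_rayD(2)[OF c, of 0 R] R by (simp add: b0_def)
      then show "between b0 (r / R * d b0 (c R)) (c R) (c r)" using between_ray[OF c r(2) R(2)] R by (simp add: b0_def)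
      show "between b0 (r / R * d b0 v) v p" using p vM R by simp
    qed (use r R in auto)
    ultimately have "d (c r) p < e" using R(1) by linarith
    then have "\<bar>d x (c r) - d x p\<bar> < e"
      using mdist_reverse_triangle[of "c r" x p] x pM cM commute[of x] by simp
    moreover have "\<bar>(d x p - r) - (d x y - d b0 y)\<bar> \<le> A\<^sup>2 / (r - A)"
      unfolding A_def by (rule horofunction_between_le[OF b0 yM x py]) (use r in \<open>simp add: A_def\<close>)
    moreover have "\<bar>(d x (c r) - r) - busemann c x\<bar> \<le> A\<^sup>2 / (r - A)"
      unfolding A_def b0_def by (rule busemann_ray_le[OF c x]) (use r in \<open>simp add: A_def b0_def\<close>)
    ultimately show ?thesis using t(1) r(3) unfolding y_def by linarith
  qed
  have "\<bar>busemann c x - (busemann c' x - busemann c' b0)\<bar> \<le> 0 + e" if "e > 0" for e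
    using *[of "e / 4"] that by simp
  then have "\<bar>busemann c x - (busemann c' x - busemann c' b0)\<bar> \<le> 0" by (rule field_le_epsilon)
  then show ?thesis by (simp add: b0_def)
qed

text \<open>\<open>thales\<close> compares \<open>p\<close> with the point \<open>q\<close> at the
  same proportion of the way from \<open>x'\<close>, which costs \<open>t * K\<close>. Both
  \<open>q\<close> and \<open>p'\<close> lie on the geodesic from \<open>x'\<close> and are at most
  \<open>(1 - t) * \<bar>D - D'\<bar>\<close> apart, hence at most
  \<open>(1 - t) * K\<close>.\<close>

lemma between_fellow_travel:
  assumes M: "x \<in> M" "x' \<in> M" "y \<in> M" and p: "between x r y p" and p': "between x' r y p'"
  shows "d p p' \<le> d x x'"
proof (cases "d x y = 0")
  case True
  then have "r = 0" using betweenD[OF p] by auto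
  then have "d x p = 0" "d x' p' = 0" using betweenD[OF p] betweenD[OF p'] by auto
  then have "p = x" "p' = x'" using M betweenD[OF p] betweenD[OF p'] by auto
  then show ?thesis by simp
next
  case False
  define D D' K where "D = d x y" and "D' = d x' y" and "K = d x x'"
  have D: "D > 0" using False unfolding D_def by (metis nonneg less_eq_real_def)
  have r: "0 \<le> r" "r \<le> D" "r \<le> D'" using betweenD[OF p] betweenD[OF p'] by (auto simp: D_def D'_def)
  have DD: "\<bar>D - D'\<bar> \<le> K" using mdist_reverse_triangle[of x y x'] M commute[of y x'] by (simp add: D_def D'_def K_def)
  define t where "t = 1 - r / D"
  have t: "0 \<le> t" "t \<le> 1" using r D by (auto simp: t_def)
  obtain q where q: "between y (t * d y x') x' q"
    using ex_between[of y x' "t * d y x'"] M t by (auto simp: mult_left_le_one_le)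
  have qM: "q \<in> M" and pM: "p' \<in> M" using betweenD q p' by auto
  have "between y (t * d y x) x p"
    using p M D between_commute[of x y r p] commute[of x y] by (simp add: t_def D_def left_diff_distrib)
  then have 1: "d p q \<le> t * d x x'" using thales[OF M(3,1,2) t _ q] by blast
  have yx': "d x' y = d y x'" by (rule commute)
  have dq: "d x' q = (1 - t) * D'" "d q y = t * D'" "d y q = t * D'"
    using betweenD[OF q] commute[of x' q] commute[of q y] yx' by (auto simp: D'_def algebra_simps)
  have "d p' q \<le> \<bar>r - (1 - t) * D'\<bar>"
  proof (cases "D' = 0")
    case True
    then have "d x' p' = 0" "d x' q = 0" using betweenD[OF p'] dq r by auto
    then show ?thesis using M qM pM by auto
  next
    case False
    have "D' > 0" using False nonneg[of x' y] unfolding D'_def by linarith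
    define s where "s = r / D'"
    have s: "0 \<le> s" "s \<le> 1" "r = s * D'" using r \<open>D' > 0\<close> by (auto simp: s_def)
    have "between x' (s * d x' y) y p'" using p' s by (simp add: D'_def)
    \<comment> \<open>For points of one geodesic the right side of Stewart's inequality is the
      squared difference of their parameters.\<close>
    then have "(d q p')\<^sup>2 \<le> (1 - s) * (d q x')\<^sup>2 + s * (d q y)\<^sup>2 - s * (1 - s) * (d x' y)\<^sup>2"
      by (rule stewart_scaled[OF M(2,3) _ qM s(1,2)])
    also have "\<dots> = (r - (1 - t) * D')\<^sup>2"
      unfolding commute[of q x'] dq D'_def[symmetric] s(3) by (simp add: algebra_simps power2_eq_square)
    finally show ?thesis by (simp add: commute[of p'] abs_le_square_iff[symmetric])
  qed
  also have "r - (1 - t) * D' = (1 - t) * (D - D')" using D by (simp add: t_def field_simps)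
  also have "\<bar>\<dots>\<bar> = (1 - t) * \<bar>D - D'\<bar>" using t by (simp add: abs_mult)
  also have "\<dots> \<le> (1 - t) * K" using t DD by (intro mult_left_mono) auto
  finally have 2: "d p' q \<le> (1 - t) * K" .
  have "d p p' \<le> d p q + d p' q" using triangle'[of p q p'] betweenD[OF p] pM qM by simp
  also have "\<dots> \<le> K" using 1 2 by (simp add: K_def algebra_simps)
  finally show ?thesis by (simp add: K_def)
qed

text \<open>The hypothesis makes \<open>c r\<close> an almost minimal point towards
  \<open>c' t\<close>, so it lies within 1 of the point at distance \<open>r\<close> on the geodesic
  from \<open>c 0\<close> to \<open>c' t\<close>. That geodesic and \<open>c'\<close> share the
  target \<open>c' t\<close> and stay within \<open>d (c 0) (c' 0)\<close>, whatever
  \<open>r\<close> is.\<close>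

lemma busemann_asymptotic:
  assumes c: "geodesic_ray c" and c': "geodesic_ray c'" and eq: "\<And>x. x \<in> M \<Longrightarrow> busemann c x = busemann c' x + k"
  shows "(c, c') \<in> asymptotic"
proof -
  have M: "c 0 \<in> M" "c' 0 \<in> M" using geodesic_rayD c c' by auto
  have "d (c r) (c' r) \<le> 1 + d (c 0) (c' 0)" if r: "r \<ge> 0" for r
  proof -
    obtain e where e: "e > 0" "2 * r * e + e\<^sup>2 < 1\<^sup>2" using ex_small_error[OF r, of 1] by auto
    have cr: "c r \<in> M" using geodesic_rayD[OF c] r by auto
    have "busemann c' (c r) - busemann c' (c 0) = - r"
      using eq[OF cr] eq[OF M(1)] busemann_ray[OF c r] busemann_ray[OF c, of 0] by simp
    then have "((\<lambda>t. d (c r) (c' t) - d (c 0) (c' t)) \<longlongrightarrow> - r) at_top"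
      using busemann_diff_tendsto[OF c' cr M(1)] by simp
    then have "\<forall>\<^sub>F t in at_top. d (c r) (c' t) - d (c 0) (c' t) < - r + e"
      using e by (intro order_tendstoD) auto
    then have "\<forall>\<^sub>F t in at_top. d (c r) (c' t) - d (c 0) (c' t) < - r + e \<and> r + d (c 0) (c' 0) \<le> t"
      using eventually_ge_at_top[of "r + d (c 0) (c' 0)"] by eventually_elim auto
    then obtain t where t: "d (c r) (c' t) - d (c 0) (c' t) < - r + e" "r + d (c 0) (c' 0) \<le> t"
      by (auto dest!: eventually_happens'[OF trivial_limit_at_top_linorder])
    have rt: "r \<le> t" using t(2) nonneg[of "c 0" "c' 0"] by linarith
    have y: "c' t \<in> M" using geodesic_rayD[OF c'] r rt by auto
    have "d (c' 0) (c' t) = t" using geodesic_rayD(2)[OF c', of 0 t] r rt by simp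
    then have "r \<le> d (c 0) (c' t)" using t(2) triangle''[of "c' 0" "c 0" "c' t"] M y by linarith
    then obtain p where p: "between (c 0) r (c' t) p" using ex_between[OF M(1) y r] by blast
    have "(d (c r) p)\<^sup>2 \<le> 2 * r * e + e\<^sup>2"
      using t(1) e geodesic_rayD(2)[OF c, of 0 r] r by (intro between_dist_le[OF M(1) y cr p]) auto
    then have "(d (c r) p)\<^sup>2 \<le> 1\<^sup>2" using e by linarith
    then have "d (c r) p \<le> 1" by (rule power2_le_imp_le) simp
    moreover have "d p (c' r) \<le> d (c 0) (c' 0)"
      by (rule between_fellow_travel[OF M y p between_ray[OF c' r rt]])
    ultimately show ?thesis
      using triangle[of "c r" p "c' r"] betweenD[OF p] cr geodesic_rayD(1)[OF c' r] by linarith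
  qed
  then show ?thesis using c c' by (auto simp: asymptotic_def)
qed

end

section \<open>Rays and horofunctions at infinity\<close>

context proper_CAT0
begin

lemma between_unique:
  assumes "x \<in> M" "y \<in> M" "between x r y p" "between x r y q"
  shows "p = q"
  using between_dist_le[OF assms(1,2) _ assms(3), of q 0] betweenD[OF assms(3)] betweenD[OF assms(4)] by simp

text \<open>The points \<open>\<sigma> s\<close> are chosen independently. They fit together because
  the point at distance \<open>s\<close> on the way to \<open>\<sigma> t\<close> is also between
  \<open>x\<close> and \<open>y\<close>, and there is only one such point.\<close>

lemma ex_geodesic_segment:
  assumes x: "x \<in> M" and y: "y \<in> M"
  shows "\<exists>\<sigma>. geodesic_segment \<sigma> x y"
proof -
  have "\<exists>p. between x s y p" if "s \<in> {0..d x y}" for s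
    using ex_between[OF x y, of s] that by auto
  then obtain \<sigma> where \<sigma>: "\<And>s. s \<in> {0..d x y} \<Longrightarrow> between x s y (\<sigma> s)" by metis
  have le: "d (\<sigma> s) (\<sigma> t) = t - s" if st: "0 \<le> s" "s \<le> t" "t \<le> d x y" for s t
  proof -
    have b: "between x s y (\<sigma> s)" "between x t y (\<sigma> t)" using \<sigma> st by auto
    note D = betweenD[OF b(1)] betweenD[OF b(2)]
    obtain p where p: "between x s (\<sigma> t) p" using ex_between[OF x, of "\<sigma> t" s] D st by auto
    have "d p y \<le> d x y - s" using triangle[of p "\<sigma> t" y] betweenD[OF p] D y by auto
    moreover have "d x y \<le> d x p + d p y" using triangle[of x p y] betweenD[OF p] x y by simp
    ultimately have "between x s y p" using betweenD[OF p] by (auto simp: between_def)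
    then have "p = \<sigma> s" using between_unique[OF x y] b(1) by blast
    then show ?thesis using betweenD[OF p] D by auto
  qed
  have "d (\<sigma> s) (\<sigma> t) = \<bar>s - t\<bar>" if "s \<in> {0..d x y}" "t \<in> {0..d x y}" for s t
    using le[of s t] le[of t s] that commute[of "\<sigma> s" "\<sigma> t"] by (cases "s \<le> t") auto
  moreover have "\<sigma> s \<in> M" if "s \<in> {0..d x y}" for s using betweenD[OF \<sigma>[OF that]] by simp
  moreover have "\<sigma> 0 = x" "\<sigma> (d x y) = y"
    using betweenD[OF \<sigma>[of 0]] betweenD[OF \<sigma>[of "d x y"]] x y by auto
  ultimately show ?thesis unfolding geodesic_segment_def by (intro exI[of _ \<sigma>]) blast
qed

lemma between_geodesic_segment:
  assumes "geodesic_segment \<sigma> x y" "0 \<le> r" "r \<le> d x y"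
  shows "between x r y (\<sigma> r)"
proof -
  have I: "r \<in> {0..d x y}" "0 \<in> {0..d x y}" "d x y \<in> {0..d x y}" using assms by auto
  then have "d (\<sigma> 0) (\<sigma> r) = \<bar>0 - r\<bar>" "d (\<sigma> r) (\<sigma> (d x y)) = \<bar>r - d x y\<bar>" "\<sigma> r \<in> M" "\<sigma> 0 = x" "\<sigma> (d x y) = y"
    using assms(1) unfolding geodesic_segment_def by blast+
  then show ?thesis using assms(2,3) by (simp add: between_def)
qed

lemma lipschitz_continuous_map:
  assumes "\<And>x y. x \<in> M \<Longrightarrow> y \<in> M \<Longrightarrow> \<bar>f x - f y\<bar> \<le> d x y"
  shows "continuous_map mtopology euclideanreal f"
proof -
  have "continuous_map mtopology Met_TC.mtopology f"
    unfolding Met_TC.continuous_map_to_metric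
  proof (intro ballI allI impI)
    fix x and \<epsilon> :: real assume x: "x \<in> topspace mtopology" and "0 < \<epsilon>"
    then have "x \<in> mball x \<epsilon> \<and> (\<forall>y\<in>mball x \<epsilon>. f y \<in> Met_TC.mball (f x) \<epsilon>)"
      using le_less_trans[OF assms[of x]] by (auto simp: dist_real_def)
    then show "\<exists>U. openin mtopology U \<and> x \<in> U \<and> (\<forall>y\<in>U. f y \<in> Met_TC.mball (f x) \<epsilon>)"
      using openin_mball by blast
  qed
  then show ?thesis by simp
qed

lemma lipschitz_attains_min:
  assumes f: "\<And>x y. x \<in> M \<Longrightarrow> y \<in> M \<Longrightarrow> \<bar>f x - f y\<bar> \<le> d x y" and x: "x \<in> M" "0 \<le> r"
  obtains p where "p \<in> mcball x r" "\<And>q. q \<in> mcball x r \<Longrightarrow> f p \<le> f q"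
proof -
  have "compactin euclideanreal (f ` mcball x r)"
    using image_compactin[OF compactin_mcball[OF x(1)] lipschitz_continuous_map[OF f]] by blast
  then have "compact (f ` mcball x r)" by simp
  moreover have "f ` mcball x r \<noteq> {}" using x by auto
  ultimately show thesis using compact_attains_inf[of "f ` mcball x r"] that by blast
qed

lemma ex_finite_net:
  assumes "compactin mtopology K" "0 < \<epsilon>"
  obtains T where "finite T" "T \<subseteq> K" "T \<subseteq> M" "\<And>x. x \<in> K \<Longrightarrow> \<exists>t\<in>T. d x t < \<epsilon>"
proof -
  have "mtotally_bounded K" by (rule compactin_imp_mtotally_bounded[OF assms(1)])
  then obtain T where T: "finite T" "T \<subseteq> K" "K \<subseteq> (\<Union>x\<in>T. mball x \<epsilon>)"
    using assms(2) unfolding mtotally_bounded_def by meson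
  have "\<exists>t\<in>T. d x t < \<epsilon>" if x: "x \<in> K" for x
  proof -
    obtain t where "t \<in> T" "x \<in> mball t \<epsilon>" using T(3) x by blast
    then show ?thesis by (metis in_mball commute)
  qed
  moreover have "T \<subseteq> M" using T(2) compactin_subset_topspace[OF assms(1)] by auto
  ultimately show thesis using that T by blast
qed

text \<open>The point \<open>c r\<close> is the unique point at distance \<open>r\<close> from \<open>b0\<close> at which \<open>f\<close> attains its
  least possible value \<open>- r\<close>.\<close>

lemma horofunction_at_infinity_busemann:
  assumes b0: "b0 \<in> M"
    and f: "\<And>T \<epsilon> R. \<lbrakk>finite T; T \<subseteq> M; 0 < \<epsilon>\<rbrakk> \<Longrightarrow>
      \<exists>y\<in>M. R < d b0 y \<and> (\<forall>x\<in>T. \<bar>(d x y - d b0 y) - f x\<bar> < \<epsilon>)"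
  shows "\<exists>c. geodesic_ray c \<and> c 0 = b0 \<and> (\<forall>x\<in>M. busemann c x = f x)"
proof -
  have lip: "\<bar>f x - f y\<bar> \<le> d x y" if xy: "x \<in> M" "y \<in> M" for x y
  proof (rule field_le_epsilon)
    fix e :: real assume e: "0 < e"
    obtain z where z: "z \<in> M" "\<bar>(d x z - d b0 z) - f x\<bar> < e / 2" "\<bar>(d y z - d b0 z) - f y\<bar> < e / 2"
      using f[of "{x, y}" "e / 2"] xy e by auto
    moreover have "\<bar>d x z - d y z\<bar> \<le> d x y"
      using mdist_reverse_triangle[of x z y] xy z commute[of z y] by simp
    ultimately show "\<bar>f x - f y\<bar> \<le> d x y + e" by linarith
  qed
  have f0: "f b0 = 0"
  proof -
    have "\<bar>f b0\<bar> \<le> 0 + e" if e: "0 < e" for e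
      using f[of "{b0}" e 0] e b0 by auto
    then have "\<bar>f b0\<bar> \<le> 0" by (rule field_le_epsilon)
    then show ?thesis by simp
  qed
  have lower: "- d b0 x \<le> f x" if "x \<in> M" for x
    using lip[OF that b0] f0 commute[of x] by auto
  \<comment> \<open>\<open>y\<close> stands in for the point at infinity on the finite set
    \<open>T\<close>. One parameter \<open>e\<close> controls both the approximation of
    \<open>f\<close> and the distance to \<open>p\<close> from the points of \<open>T\<close> with
    value \<open>- r\<close>.\<close>
  have close: "\<exists>y\<in>M. \<exists>p. r < d b0 y \<and> between b0 r y p \<and> (\<forall>x\<in>T. \<bar>(d x y - d b0 y) - f x\<bar> < e) \<and>
      (\<forall>q\<in>T. d b0 q \<le> r \<longrightarrow> f q = - r \<longrightarrow> (d q p)\<^sup>2 \<le> 2 * r * e + e\<^sup>2)"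
    if T: "finite T" "T \<subseteq> M" and e: "0 < e" and r: "0 \<le> r" for T e r
  proof -
    obtain y where y: "y \<in> M" "r < d b0 y" "\<forall>x\<in>T. \<bar>(d x y - d b0 y) - f x\<bar> < e"
      using f[OF T e, of r] by blast
    obtain p where p: "between b0 r y p" using ex_between[OF b0 y(1) r] y(2) by auto
    have "(d q p)\<^sup>2 \<le> 2 * r * e + e\<^sup>2" if "q \<in> T" "d b0 q \<le> r" "f q = - r" for q
      using y(3) that T e by (intro between_dist_le[OF b0 y(1) _ p]) (force simp: abs_less_iff)+
    then show ?thesis using y p by blast
  qed
  have ex: "\<exists>p\<in>M. d b0 p = r \<and> f p = - r" if r: "0 \<le> r" for r
  proof -
    obtain p where p: "p \<in> mcball b0 r" "\<And>q. q \<in> mcball b0 r \<Longrightarrow> f p \<le> f q"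
      using lipschitz_attains_min[of f, OF lip b0 r] by blast
    have "f p \<le> - r"
    proof (rule field_le_epsilon)
      fix e :: real assume e: "0 < e"
      \<comment> \<open>The net is fixed before \<open>y\<close>, since \<open>y\<close> is only
        good on a finite set; the point \<open>q\<close> at distance \<open>r\<close> towards
        \<open>y\<close> is then replaced by a net point \<open>t\<close>.\<close>
      obtain T where T: "finite T" "T \<subseteq> mcball b0 r" "T \<subseteq> M" "\<And>x. x \<in> mcball b0 r \<Longrightarrow> \<exists>t\<in>T. d x t < e / 2"
        using ex_finite_net[OF compactin_mcball[OF b0], of "e / 2" r] e by auto
      obtain y q where y: "y \<in> M" "between b0 r y q" "\<forall>x\<in>T. \<bar>(d x y - d b0 y) - f x\<bar> < e / 2"
        using close[OF T(1,3) _ r, of "e / 2"] e by auto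
      have q: "q \<in> mcball b0 r" "q \<in> M" "d q y = d b0 y - r" using betweenD[OF y(2)] b0 by auto
      obtain t where t: "t \<in> T" "d q t < e / 2" using T(4)[OF q(1)] by auto
      have "d t y \<le> d q t + d q y" using triangle[of t q y] t T y q commute[of t q] by auto
      moreover have "f p \<le> f t" using p(2) t T by auto
      moreover have "\<bar>(d t y - d b0 y) - f t\<bar> < e / 2" using y(3) t by blast
      ultimately show "f p \<le> - r + e" using t(2) q(3) by linarith
    qed
    then show ?thesis using p(1) lower[of p] by (intro bexI[of _ p]) auto
  qed
  have unique: "p = q" if pq: "p \<in> M" "q \<in> M" "d b0 p \<le> r" "d b0 q \<le> r" "f p = - r" "f q = - r" and r: "0 \<le> r" for p q r
  proof -
    have "d p q \<le> 0 + \<delta>" if pos: "0 < \<delta>" for \<delta> :: real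
    proof -
      obtain e where e: "0 < e" "2 * r * e + e\<^sup>2 < (\<delta> / 2)\<^sup>2" using ex_small_error[OF r half_gt_zero[OF pos]] by auto
      obtain y m where y: "between b0 r y m" "(d p m)\<^sup>2 \<le> 2 * r * e + e\<^sup>2" "(d q m)\<^sup>2 \<le> 2 * r * e + e\<^sup>2"
        using close[of "{p, q}" e r] pq e r by auto
      then have "(d p m)\<^sup>2 \<le> (\<delta> / 2)\<^sup>2" "(d q m)\<^sup>2 \<le> (\<delta> / 2)\<^sup>2" using e by linarith+
      then have "d p m \<le> \<delta> / 2" "d q m \<le> \<delta> / 2" using pos by (auto intro: power2_le_imp_le)
      then show ?thesis using triangle'[of p m q] betweenD[OF y(1)] pq by simp
    qed
    then have "d p q \<le> 0" by (rule field_le_epsilon)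
    then show ?thesis using pq by (metis nonneg order_antisym zero)
  qed
  obtain c where c: "\<And>r. 0 \<le> r \<Longrightarrow> c r \<in> M \<and> d b0 (c r) = r \<and> f (c r) = - r"
    using ex by metis
  \<comment> \<open>On the geodesic to \<open>c s\<close> the 1-Lipschitz \<open>f\<close> must fall
    at full rate, so its point at distance \<open>r\<close> has value \<open>- r\<close> and is
    therefore \<open>c r\<close>.\<close>
  have dc: "d (c r) (c s) = s - r" if rs: "0 \<le> r" "r \<le> s" for r s
  proof -
    obtain q where q: "between b0 r (c s) q" using ex_between[OF b0, of "c s" r] c[of s] rs by auto
    note D = betweenD[OF q]
    have "f q = - r" using lower[of q] lip[of q "c s"] D c[of s] rs by (auto simp: abs_le_iff)
    then have "q = c r" using unique[of q "c r" r] D c[of r] rs by auto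
    then show ?thesis using D c[of s] rs by auto
  qed
  have ray: "geodesic_ray c"
    unfolding geodesic_ray_def
  proof (intro conjI allI impI)
    show "c ` {0..} \<subseteq> M" using c by auto
    fix s t :: real assume "0 \<le> s" "0 \<le> t"
    then show "d (c s) (c t) = \<bar>s - t\<bar>" using dc[of s t] dc[of t s] commute[of "c s" "c t"] by (cases "s \<le> t") auto
  qed
  have c0: "c 0 = b0" using c[of 0] b0 by auto
  have "busemann c x = f x" if x: "x \<in> M" for x
  proof -
    define A where "A = d b0 x"
    \<comment> \<open>Four errors: the gap between \<open>c r\<close> and \<open>m\<close>, the two
      estimates with \<open>A\<^sup>2 / (r - A)\<close>, and the approximation of \<open>f x\<close>
      through \<open>y\<close>.\<close>
    have "\<bar>busemann c x - f x\<bar> \<le> 0 + 4 * e" if e: "0 < e" for e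
    proof -
      obtain r where r: "A < r" "0 \<le> r" "A\<^sup>2 / (r - A) < e"
        using eventually_happens'[OF trivial_limit_at_top_linorder eventually_error_small[OF e, of A "A\<^sup>2"]] by auto
      obtain e' where e': "0 < e'" "2 * r * e' + e'\<^sup>2 < e\<^sup>2" using ex_small_error[OF r(2) e] by auto
      define e1 where "e1 = min e e'"
      have e1: "0 < e1" "e1 \<le> e" "e1 \<le> e'" using e e' by (auto simp: e1_def)
      obtain y m where y: "y \<in> M" "between b0 r y m" "\<bar>(d x y - d b0 y) - f x\<bar> < e1"
          "(d (c r) m)\<^sup>2 \<le> 2 * r * e1 + e1\<^sup>2"
        using close[of "{x, c r}" e1 r] x c[OF r(2)] e1 r(2) by auto
      have "2 * r * e1 + e1\<^sup>2 \<le> 2 * r * e' + e'\<^sup>2"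
        using e1 r(2) by (intro add_mono mult_left_mono power_mono) auto
      then have "(d (c r) m)\<^sup>2 \<le> e\<^sup>2" using y e' by linarith
      then have "d (c r) m \<le> e" using e by (auto intro: power2_le_imp_le)
      then have "\<bar>d x (c r) - d x m\<bar> \<le> e"
        using mdist_reverse_triangle[of "c r" x m] x c[OF r(2)] betweenD[OF y(2)] commute[of x] by simp
      moreover have "\<bar>(d x m - r) - (d x y - d b0 y)\<bar> \<le> A\<^sup>2 / (r - A)"
        unfolding A_def by (rule horofunction_between_le[OF b0 y(1) x y(2)]) (use r in \<open>simp add: A_def\<close>)
      moreover have "\<bar>(d x (c r) - r) - busemann c x\<bar> \<le> A\<^sup>2 / (r - A)"
        using busemann_ray_le[OF ray x, of r] r by (simp add: A_def c0)
      ultimately show ?thesis using y(3) e1(2) r(3) by linarith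
    qed
    from this[of "_ / 4"] have "\<bar>busemann c x - f x\<bar> \<le> 0 + e" if "0 < e" for e using that by simp
    then have "\<bar>busemann c x - f x\<bar> \<le> 0" by (rule field_le_epsilon)
    then show ?thesis by simp
  qed
  then show ?thesis using ray c0 by blast
qed

text \<open>Instead of a limit of segments: the Busemann function of \<open>c\<close>, shifted to
  vanish at \<open>b0\<close>, is approximated by the points \<open>c t\<close>. So it is the
  Busemann function of a ray from \<open>b0\<close>, and \<open>busemann_asymptotic\<close> shows
  that this ray is asymptotic to \<open>c\<close>.\<close>

lemma ex_asymptotic_ray:
  assumes c: "geodesic_ray c" and b0: "b0 \<in> M"
  obtains c' where "(c, c') \<in> asymptotic" "c' 0 = b0"
proof -
  have "\<exists>c'. geodesic_ray c' \<and> c' 0 = b0 \<and> (\<forall>x\<in>M. busemann c' x = busemann c x - busemann c b0)"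
  proof (rule horofunction_at_infinity_busemann[OF b0])
    fix T and \<epsilon> R :: real assume T: "finite T" "T \<subseteq> M" and \<epsilon>: "0 < \<epsilon>"
    have "\<forall>\<^sub>F t in at_top. \<forall>x\<in>T. \<bar>(d x (c t) - d b0 (c t)) - (busemann c x - busemann c b0)\<bar> < \<epsilon>"
      using tendstoD[OF busemann_diff_tendsto[OF c _ b0] \<epsilon>] T
      by (auto simp: eventually_ball_finite_distrib dist_real_def)
    then have "\<forall>\<^sub>F t in at_top. (\<forall>x\<in>T. \<bar>(d x (c t) - d b0 (c t)) - (busemann c x - busemann c b0)\<bar> < \<epsilon>) \<and>
        max 0 (R + d b0 (c 0)) < t"
      using eventually_gt_at_top[of "max 0 (R + d b0 (c 0))"] by eventually_elim auto
    then obtain t where t: "\<forall>x\<in>T. \<bar>(d x (c t) - d b0 (c t)) - (busemann c x - busemann c b0)\<bar> < \<epsilon>"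
        "max 0 (R + d b0 (c 0)) < t"
      by (auto dest!: eventually_happens'[OF trivial_limit_at_top_linorder])
    have "c t \<in> M" "c 0 \<in> M" "d (c 0) (c t) = t" using geodesic_rayD[OF c] t(2) by auto
    then have "R < d b0 (c t)" using triangle''[of "c 0" b0 "c t"] b0 t(2) by auto
    then show "\<exists>y\<in>M. R < d b0 y \<and> (\<forall>x\<in>T. \<bar>(d x y - d b0 y) - (busemann c x - busemann c b0)\<bar> < \<epsilon>)"
      using t(1) \<open>c t \<in> M\<close> by blast
  qed
  then obtain c' where c': "geodesic_ray c'" "c' 0 = b0" "\<forall>x\<in>M. busemann c' x = busemann c x - busemann c b0" by blast
  then have "(c, c') \<in> asymptotic"
    by (intro busemann_asymptotic[OF c c'(1), of "busemann c b0"]) simp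
  then show thesis using that c'(2) by blast
qed

lemma equiv_asymptotic: "equiv {c. geodesic_ray c} asymptotic"
proof (rule equivI)
  show "asymptotic \<subseteq> {c. geodesic_ray c} \<times> {c. geodesic_ray c}" by (auto simp: asymptotic_def)
  show "refl_on {c. geodesic_ray c} asymptotic"
    by (auto simp: refl_on_def asymptotic_def geodesic_rayD)
  show "sym asymptotic" by (auto simp: sym_def asymptotic_def commute)
  show "trans asymptotic"
  proof (rule transI)
    fix c1 c2 c3 assume "(c1, c2) \<in> asymptotic" "(c2, c3) \<in> asymptotic"
    then obtain B B' where B: "geodesic_ray c1" "geodesic_ray c2" "geodesic_ray c3"
      "\<And>t. t \<ge> 0 \<Longrightarrow> d (c1 t) (c2 t) \<le> B" "\<And>t. t \<ge> 0 \<Longrightarrow> d (c2 t) (c3 t) \<le> B'"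
      by (auto simp: asymptotic_def)
    have "d (c1 t) (c3 t) \<le> B + B'" if "t \<ge> 0" for t
      using triangle[of "c1 t" "c2 t" "c3 t"] B geodesic_rayD(1) that by (smt (verit))
    then show "(c1, c3) \<in> asymptotic" using B by (auto simp: asymptotic_def)
  qed
qed

lemma visual_boundaryD:
  assumes "\<xi> \<in> visual_boundary" "c \<in> \<xi>"
  shows "geodesic_ray c" "\<xi> = asymptotic `` {c}"
proof -
  obtain c' where c': "\<xi> = asymptotic `` {c'}" using assms(1) by (auto simp: visual_boundary_def elim: quotientE)
  then have "(c', c) \<in> asymptotic" using assms(2) by auto
  then show "geodesic_ray c" "\<xi> = asymptotic `` {c}"
    using c' equiv_class_eq[OF equiv_asymptotic] by (auto simp: asymptotic_def)
qed

lemma visual_boundary_nonempty: "\<xi> \<in> visual_boundary \<Longrightarrow> \<exists>c. c \<in> \<xi>"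
  using in_quotient_imp_non_empty[OF equiv_asymptotic] unfolding visual_boundary_def by fast

lemma asymptotic_class_in_boundary: "geodesic_ray c \<Longrightarrow> asymptotic `` {c} \<in> visual_boundary \<and> c \<in> asymptotic `` {c}"
  unfolding visual_boundary_def using equiv_class_self[OF equiv_asymptotic, of c] by (auto intro: quotientI)

lemma visual_boundary_ray_from:
  assumes "\<xi> \<in> visual_boundary" "b0 \<in> M"
  obtains c where "c \<in> \<xi>" "c 0 = b0"
proof -
  obtain c where c: "c \<in> \<xi>" using visual_boundary_nonempty[OF assms(1)] by blast
  obtain c' where "(c, c') \<in> asymptotic" "c' 0 = b0"
    using ex_asymptotic_ray[OF visual_boundaryD(1)[OF assms(1) c] assms(2)] by blast
  then show thesis using that visual_boundaryD(2)[OF assms(1) c] by blast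
qed

end

section \<open>The cone topology and pointwise convergence\<close>

context proper_CAT0
begin

definition base :: 'a where
  "base = (SOME x. x \<in> M)"

lemma base_in_M [simp]: "base \<in> M"
  unfolding base_def using nonempty by (simp add: some_in_eq)

text \<open>The common model of both compactifications. Vanishing at \<open>base\<close> selects one
  representative modulo constants; on the boundary the chosen ray does not matter, by
  \<open>asymptotic_busemann\<close>.\<close>

fun visual_fun :: "'a + (real \<Rightarrow> 'a) set \<Rightarrow> 'a \<Rightarrow> real" where
  "visual_fun (Inl z) = restrict (\<lambda>x. d x z - d base z) M"
| "visual_fun (Inr \<xi>) = restrict (\<lambda>x. busemann (SOME c. c \<in> \<xi>) x - busemann (SOME c. c \<in> \<xi>) base) M"

declare visual_fun.simps(2) [simp del]

lemma visual_fun_Inr: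
  assumes \<xi>: "\<xi> \<in> visual_boundary" and c: "c \<in> \<xi>" and x: "x \<in> M"
  shows "visual_fun (Inr \<xi>) x = busemann c x - busemann c base"
proof -
  define c' where "c' = (SOME c. c \<in> \<xi>)"
  have "c' \<in> \<xi>" unfolding c'_def using c someI[of "\<lambda>c. c \<in> \<xi>" c] by blast
  then have "(c, c') \<in> asymptotic" using visual_boundaryD(2)[OF \<xi> c] by auto
  from asymptotic_busemann[OF this x] asymptotic_busemann[OF this base_in_M]
  show ?thesis using x by (simp add: visual_fun.simps c'_def)
qed

lemma visual_fun_extensional: "visual_fun w \<in> extensional M"
  by (cases w) (auto simp: visual_fun.simps)

lemma visual_fun_base: "visual_fun w base = 0"
  by (cases w) (auto simp: visual_fun.simps)

lemma visual_fun_tendsto: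
  assumes \<xi>: "\<xi> \<in> visual_boundary" and c: "c \<in> \<xi>" and x: "x \<in> M"
  shows "((\<lambda>t. visual_fun (Inl (c t)) x) \<longlongrightarrow> visual_fun (Inr \<xi>) x) at_top"
  using busemann_diff_tendsto[OF visual_boundaryD(1)[OF \<xi> c] x base_in_M] x
  by (simp add: visual_fun_Inr[OF \<xi> c x])

definition visual_points :: "('a + (real \<Rightarrow> 'a) set) set" where
  "visual_points = Inl ` M \<union> Inr ` visual_boundary"

lemma visual_fun_lipschitz:
  assumes "w \<in> visual_points" "x \<in> M" "y \<in> M"
  shows "\<bar>visual_fun w x - visual_fun w y\<bar> \<le> d x y"
proof (cases w)
  case (Inl z)
  then have "z \<in> M" using assms(1) by (auto simp: visual_points_def)
  then show ?thesis using Inl assms mdist_reverse_triangle[of x z y] commute[of z y] by simp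
next
  case (Inr \<xi>)
  then have \<xi>: "\<xi> \<in> visual_boundary" using assms(1) by (auto simp: visual_points_def)
  obtain c where c: "c \<in> \<xi>" using visual_boundary_nonempty[OF \<xi>] by blast
  show ?thesis
    using busemann_lipschitz[OF visual_boundaryD(1)[OF \<xi> c] assms(2,3)] assms
    by (simp add: Inr visual_fun_Inr[OF \<xi> c])
qed

text \<open>\<open>aims b0 r w p\<close>: the geodesic from \<open>b0\<close> to the point or boundary point \<open>w\<close> passes through \<open>p\<close>
  at time \<open>r\<close>.\<close>

definition aims :: "'a \<Rightarrow> real \<Rightarrow> 'a + (real \<Rightarrow> 'a) set \<Rightarrow> 'a \<Rightarrow> bool" where
  "aims b0 r w p \<longleftrightarrow> (case w of Inl y \<Rightarrow> y \<in> M \<and> between b0 r y p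
     | Inr \<xi> \<Rightarrow> \<xi> \<in> visual_boundary \<and> (\<exists>c\<in>\<xi>. c 0 = b0 \<and> c r = p))"

lemma aims_simps [simp]:
  "aims b0 r (Inl y) p \<longleftrightarrow> y \<in> M \<and> between b0 r y p"
  "aims b0 r (Inr \<xi>) p \<longleftrightarrow> \<xi> \<in> visual_boundary \<and> (\<exists>c\<in>\<xi>. c 0 = b0 \<and> c r = p)"
  by (auto simp: aims_def)

lemma aims_in_M:
  assumes "aims b0 r w p" "0 \<le> r"
  shows "p \<in> M" "d b0 p = r"
  using assms visual_boundaryD(1) geodesic_rayD betweenD
  by (cases w; force)+

lemma aims_visual_fun_le:
  assumes a: "aims b0 r w p" and b0: "b0 \<in> M" and x: "x \<in> M" and r: "d b0 x < r"
  shows "\<bar>(d x p - r) - (visual_fun w x - visual_fun w b0)\<bar> \<le> (d b0 x)\<^sup>2 / (r - d b0 x)"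
proof (cases w)
  case (Inl y)
  then show ?thesis using horofunction_between_le[OF b0 _ x _ r, of y p] a b0 x by simp
next
  case (Inr \<xi>)
  then obtain c where \<xi>: "\<xi> \<in> visual_boundary" and c: "c \<in> \<xi>" "c 0 = b0" "c r = p" using a by auto
  note ray = visual_boundaryD(1)[OF \<xi> c(1)]
  show ?thesis
    using busemann_ray_le[OF ray x, of r] r c(2,3) busemann_ray[OF ray, of 0]
    by (simp add: Inr visual_fun_Inr[OF \<xi> c(1)] x b0)
qed

lemma aims_dist_le:
  assumes a: "aims b0 r w p" and b0: "b0 \<in> M" and q: "q \<in> M" "d b0 q \<le> r"
    and le: "visual_fun w q - visual_fun w b0 < - r + e" and e: "0 \<le> e"
  shows "(d q p)\<^sup>2 \<le> 2 * r * e + e\<^sup>2"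
proof (cases w)
  case (Inl y)
  then show ?thesis using a b0 q le by (intro between_dist_le[OF b0 _ q(1) _ q(2) _ e, of y]) auto
next
  case (Inr \<xi>)
  then obtain c where \<xi>: "\<xi> \<in> visual_boundary" and c: "c \<in> \<xi>" "c 0 = b0" "c r = p" using a by auto
  note ray = visual_boundaryD(1)[OF \<xi> c(1)]
  have "busemann c b0 = 0" using busemann_ray[OF ray, of 0] c by simp
  then have "busemann c q < - r + e" using le by (simp add: Inr visual_fun_Inr[OF \<xi> c(1)] q b0)
  then show ?thesis using busemann_dist_le[OF ray q(1) _ _ e, of r] q(2) c(2,3) by simp
qed

lemma ex_aims:
  assumes "w \<in> visual_points" "b0 \<in> M" "0 \<le> r" "\<And>y. w = Inl y \<Longrightarrow> r \<le> d b0 y"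
  shows "\<exists>p. aims b0 r w p"
proof (cases w)
  case (Inl y)
  then have "y \<in> M" using assms(1) by (auto simp: visual_points_def)
  then show ?thesis using ex_between[OF assms(2) _ assms(3), of y] assms(4)[OF Inl] Inl by auto
next
  case (Inr \<xi>)
  then have "\<xi> \<in> visual_boundary" using assms(1) by (auto simp: visual_points_def)
  then show ?thesis using visual_boundary_ray_from[OF _ assms(2)] Inr by (metis aims_simps(2))
qed

text \<open>Trades segments for between points, by existence and uniqueness of geodesics. The last
  conjunct excludes \<open>r = d (c 0) y\<close>, which \<open>aims\<close> allows at a point
  \<open>y\<close> of the space.\<close>

lemma cone_neighbourhood_iff:
  assumes c: "geodesic_ray c" and r: "0 < r"
  shows "w \<in> cone_neighbourhood c r \<epsilon> \<longleftrightarrow>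
    (\<exists>p. aims (c 0) r w p \<and> d p (c r) < \<epsilon>) \<and> (\<forall>y. w = Inl y \<longrightarrow> r < d (c 0) y)"
proof (cases w)
  case (Inl y)
  have c0: "c 0 \<in> M" using geodesic_rayD[OF c] by simp
  have "(\<exists>\<sigma>. geodesic_segment \<sigma> (c 0) y \<and> d (\<sigma> r) (c r) < \<epsilon>) \<longleftrightarrow> (\<exists>p. between (c 0) r y p \<and> d p (c r) < \<epsilon>)"
    if y: "y \<in> M" "r < d (c 0) y"
  proof
    assume "\<exists>\<sigma>. geodesic_segment \<sigma> (c 0) y \<and> d (\<sigma> r) (c r) < \<epsilon>"
    then show "\<exists>p. between (c 0) r y p \<and> d p (c r) < \<epsilon>"
      using between_geodesic_segment[of _ "c 0" y r] r y by auto
  next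
    assume "\<exists>p. between (c 0) r y p \<and> d p (c r) < \<epsilon>"
    then obtain p where p: "between (c 0) r y p" "d p (c r) < \<epsilon>" by blast
    obtain \<sigma> where \<sigma>: "geodesic_segment \<sigma> (c 0) y" using ex_geodesic_segment[OF c0 y(1)] by blast
    then have "\<sigma> r = p" using between_unique[OF c0 y(1) _ p(1)] between_geodesic_segment[OF \<sigma>, of r] r y by auto
    then show "\<exists>\<sigma>. geodesic_segment \<sigma> (c 0) y \<and> d (\<sigma> r) (c r) < \<epsilon>" using \<sigma> p by blast
  qed
  then show ?thesis by (auto simp: Inl cone_neighbourhood_def)
qed (auto simp: cone_neighbourhood_def)

lemma visual_subbasis_subset:
  "cone_neighbourhood c r \<epsilon> \<subseteq> visual_points" "openin mtopology U \<Longrightarrow> Inl ` U \<subseteq> visual_points"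
  using openin_subset[of mtopology U] by (auto simp: cone_neighbourhood_def visual_points_def)

lemma ray_in_cone_neighbourhood:
  assumes "\<xi> \<in> visual_boundary" "c \<in> \<xi>" "0 < r" "0 < \<epsilon>"
  shows "Inr \<xi> \<in> cone_neighbourhood c r \<epsilon>"
  using assms geodesic_rayD[OF visual_boundaryD(1)[OF assms(1,2)]]
  by (auto simp: cone_neighbourhood_def intro!: bexI[of _ c])

lemma topspace_visual_space: "topspace visual_space = visual_points"
proof
  show "topspace visual_space \<subseteq> visual_points"
    unfolding visual_space_def topology_generated_by_topspace using visual_subbasis_subset by blast
  have "Inl ` M \<subseteq> topspace visual_space"
    unfolding visual_space_def topology_generated_by_topspace using openin_topspace[of mtopology] by auto
  moreover have "Inr \<xi> \<in> topspace visual_space" if \<xi>: "\<xi> \<in> visual_boundary" for \<xi>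
  proof -
    obtain c where c: "c \<in> \<xi>" using visual_boundary_nonempty[OF \<xi>] by blast
    have "Inr \<xi> \<in> cone_neighbourhood c 1 1" using ray_in_cone_neighbourhood[OF \<xi> c] by simp
    then show ?thesis
      unfolding visual_space_def topology_generated_by_topspace using visual_boundaryD(1)[OF \<xi> c] zero_less_one by blast
  qed
  ultimately show "visual_points \<subseteq> topspace visual_space" by (auto simp: visual_points_def)
qed

lemma openin_visual_Inl: "openin mtopology U \<Longrightarrow> openin visual_space (Inl ` U)"
  unfolding visual_space_def by (rule topology_generated_by_Basis) auto

lemma openin_visual_cone:
  "geodesic_ray c \<Longrightarrow> 0 < r \<Longrightarrow> 0 < \<epsilon> \<Longrightarrow> openin visual_space (cone_neighbourhood c r \<epsilon>)"
  unfolding visual_space_def by (rule topology_generated_by_Basis) auto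

text \<open>The bound \<open>3 * \<epsilon>\<close> consists of the estimates at \<open>p\<close>
  and at \<open>c r\<close> and of \<open>d p (c r)\<close>. The functions are compared relative to
  \<open>c 0\<close>, the point from which the neighbourhood is seen.\<close>

lemma visual_fun_near_boundary:
  assumes c: "c \<in> \<xi>" and \<xi>: "\<xi> \<in> visual_boundary" and r: "0 < r" "d (c 0) x < r" "(d (c 0) x)\<^sup>2 / (r - d (c 0) x) < \<epsilon>"
    and w: "w \<in> cone_neighbourhood c r \<epsilon>" and x: "x \<in> M"
  shows "\<bar>(visual_fun w x - visual_fun w (c 0)) - (visual_fun (Inr \<xi>) x - visual_fun (Inr \<xi>) (c 0))\<bar> < 3 * \<epsilon>"
proof -
  note ray = visual_boundaryD(1)[OF \<xi> c]
  have cM: "c 0 \<in> M" "c r \<in> M" using geodesic_rayD[OF ray] r by auto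
  obtain p where p: "aims (c 0) r w p" "d p (c r) < \<epsilon>" using w cone_neighbourhood_iff[OF ray r(1)] by blast
  have pM: "p \<in> M" using aims_in_M[OF p(1)] r by simp
  have "aims (c 0) r (Inr \<xi>) (c r)" using \<xi> c by auto
  from aims_visual_fun_le[OF this cM(1) x r(2)] aims_visual_fun_le[OF p(1) cM(1) x r(2)]
  show ?thesis using p(2) mdist_reverse_triangle[of p x "c r"] commute[of x] pM cM x r(3) by (simp add: abs_less_iff abs_le_iff)
qed

section \<open>The model in the topology of pointwise convergence\<close>

abbreviation pointwise :: "('a \<Rightarrow> real) topology" where
  "pointwise \<equiv> product_topology (\<lambda>_. euclideanreal) M"

lemma topspace_pointwise: "topspace pointwise = extensional M"
  by (auto simp: PiE_def)

lemma openin_pointwise_nbhd: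
  assumes "finite T" "T \<subseteq> M"
  shows "openin pointwise {f \<in> extensional M. \<forall>x\<in>T. \<bar>f x - g x\<bar> < \<epsilon>}"
  using assms
proof (induction T rule: finite_induct)
  case empty
  then show ?case using openin_topspace[of pointwise] unfolding topspace_pointwise by simp
next
  case (insert x T)
  have "openin pointwise {f \<in> topspace pointwise. f x \<in> {s. \<bar>s - g x\<bar> < \<epsilon>}}"
  proof (rule openin_continuous_map_preimage)
    show "continuous_map pointwise euclideanreal (\<lambda>f. f x)"
      using continuous_map_product_projection[of x M "\<lambda>_. euclideanreal"] insert by simp
    have "{s. \<bar>s - g x\<bar> < \<epsilon>} = ball (g x) \<epsilon>" by (auto simp: dist_real_def)
    then show "openin euclideanreal {s. \<bar>s - g x\<bar> < \<epsilon>}" by simp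
  qed
  then have "openin pointwise ({f \<in> topspace pointwise. f x \<in> {s. \<bar>s - g x\<bar> < \<epsilon>}} \<inter>
      {f \<in> extensional M. \<forall>x\<in>T. \<bar>f x - g x\<bar> < \<epsilon>})"
    using insert by (intro openin_Int) auto
  moreover have "{f \<in> topspace pointwise. f x \<in> {s. \<bar>s - g x\<bar> < \<epsilon>}} \<inter> {f \<in> extensional M. \<forall>x\<in>T. \<bar>f x - g x\<bar> < \<epsilon>}
      = {f \<in> extensional M. \<forall>x\<in>insert x T. \<bar>f x - g x\<bar> < \<epsilon>}"
    unfolding topspace_pointwise by auto
  ultimately show ?case by simp
qed

lemma continuous_map_visual_fun: "continuous_map visual_space pointwise visual_fun"
proof -
  have "continuous_map visual_space Met_TC.mtopology (\<lambda>w. visual_fun w x)" if x: "x \<in> M" for x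
    unfolding Met_TC.continuous_map_to_metric
  proof (intro ballI allI impI)
    fix w and \<epsilon> :: real assume w: "w \<in> topspace visual_space" and \<epsilon>: "0 < \<epsilon>"
    have "\<exists>V. openin visual_space V \<and> w \<in> V \<and> (\<forall>w'\<in>V. \<bar>visual_fun w x - visual_fun w' x\<bar> < \<epsilon>)"
    proof (cases w)
      case (Inl z)
      then have z: "z \<in> M" using w by (auto simp: topspace_visual_space visual_points_def)
      have "\<bar>visual_fun (Inl z) x - visual_fun (Inl y) x\<bar> < \<epsilon>" if "y \<in> mball z (\<epsilon> / 2)" for y
        using that mdist_reverse_triangle[of z x y] mdist_reverse_triangle[of z base y] x z commute[of x] commute[of base]
        by (simp add: abs_less_iff abs_le_iff)
      then show ?thesis
        using openin_visual_Inl[of "mball z (\<epsilon> / 2)"] z \<epsilon> Inl by (intro exI[of _ "Inl ` mball z (\<epsilon> / 2)"]) auto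
    next
      case (Inr \<xi>)
      then have \<xi>: "\<xi> \<in> visual_boundary" using w by (auto simp: topspace_visual_space visual_points_def)
      obtain c where c: "c \<in> \<xi>" using visual_boundary_nonempty[OF \<xi>] by blast
      \<comment> \<open>Two comparisons relative to \<open>c 0\<close>, at \<open>x\<close> and at
        \<open>base\<close>, cost \<open>3 * \<epsilon> / 8\<close> each; their difference removes
        \<open>c 0\<close>.\<close>
      have e: "0 < \<epsilon> / 8" using \<epsilon> by simp
      have "\<forall>\<^sub>F r in at_top. (d (c 0) x < r \<and> 0 \<le> r \<and> (d (c 0) x)\<^sup>2 / (r - d (c 0) x) < \<epsilon> / 8) \<and>
          (d (c 0) base < r \<and> 0 \<le> r \<and> (d (c 0) base)\<^sup>2 / (r - d (c 0) base) < \<epsilon> / 8) \<and> 0 < r"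
        by (intro eventually_conj eventually_error_small e eventually_gt_at_top)
      then obtain r where r: "d (c 0) x < r" "(d (c 0) x)\<^sup>2 / (r - d (c 0) x) < \<epsilon> / 8"
          "d (c 0) base < r" "(d (c 0) base)\<^sup>2 / (r - d (c 0) base) < \<epsilon> / 8" "0 < r"
        by (auto dest!: eventually_happens'[OF trivial_limit_at_top_linorder])
      show ?thesis
      proof (intro exI[of _ "cone_neighbourhood c r (\<epsilon> / 8)"] conjI ballI)
        show "openin visual_space (cone_neighbourhood c r (\<epsilon> / 8))"
          by (rule openin_visual_cone[OF visual_boundaryD(1)[OF \<xi> c] r(5) e])
        show "w \<in> cone_neighbourhood c r (\<epsilon> / 8)"
          unfolding Inr by (rule ray_in_cone_neighbourhood[OF \<xi> c r(5) e])
        fix w' assume w': "w' \<in> cone_neighbourhood c r (\<epsilon> / 8)"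
        show "\<bar>visual_fun w x - visual_fun w' x\<bar> < \<epsilon>"
          using visual_fun_near_boundary[OF c \<xi> r(5,1,2) w' x] visual_fun_near_boundary[OF c \<xi> r(5,3,4) w' base_in_M]
          unfolding Inr visual_fun_base by linarith
      qed
    qed
    then show "\<exists>V. openin visual_space V \<and> w \<in> V \<and> (\<forall>w'\<in>V. visual_fun w' x \<in> Met_TC.mball (visual_fun w x) \<epsilon>)"
      by (auto simp: dist_real_def)
  qed
  then show ?thesis
    by (auto simp: continuous_map_componentwise visual_fun_extensional)
qed

text \<open>The function of a point \<open>y\<close> is bounded below by \<open>- d base y\<close>,
  while a Busemann function falls to minus infinity along its ray, so the two kinds never agree.
  Boundary points with the same function are equal by \<open>busemann_asymptotic\<close>.\<close>

lemma visual_fun_inj: "inj_on visual_fun visual_points"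
proof -
  have no: False if y: "y \<in> M" and \<xi>: "\<xi> \<in> visual_boundary" and eq: "visual_fun (Inl y) = visual_fun (Inr \<xi>)" for y \<xi>
  proof -
    obtain c where c: "c \<in> \<xi>" using visual_boundary_nonempty[OF \<xi>] by blast
    note ray = visual_boundaryD(1)[OF \<xi> c]
    define t where "t = max 0 (d base y - busemann c base + 1)"
    have t: "0 \<le> t" "d base y - busemann c base < t" by (auto simp: t_def)
    have ct: "c t \<in> M" using geodesic_rayD[OF ray] t by simp
    have "d (c t) y - d base y = - t - busemann c base"
      using fun_cong[OF eq, of "c t"] ct by (simp add: visual_fun_Inr[OF \<xi> c] busemann_ray[OF ray t(1)])
    then show False using t(2) nonneg[of "c t" y] by linarith
  qed
  show ?thesis
  proof (rule inj_onI)
    fix v w assume v: "v \<in> visual_points" and w: "w \<in> visual_points" and eq: "visual_fun v = visual_fun w"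
    show "v = w"
    proof (cases v)
      case v1: (Inl y)
      then have y: "y \<in> M" using v by (auto simp: visual_points_def)
      show ?thesis
      proof (cases w)
        case w1: (Inl z)
        then have z: "z \<in> M" using w by (auto simp: visual_points_def)
        have "d z y - d base y = d z z - d base z" "d y y - d base y = d y z - d base z"
          using fun_cong[OF eq, of z] fun_cong[OF eq, of y] y z v1 w1 by auto
        then have "d y z = 0" unfolding mdist_zero[OF y] mdist_zero[OF z] commute[of z y] by linarith
        then show ?thesis using y z v1 w1 by simp
      next
        case (Inr \<xi>)
        then show ?thesis using no[OF y, of \<xi>] w eq v1 by (auto simp: visual_points_def)
      qed
    next
      case v2: (Inr \<xi>)
      then have \<xi>: "\<xi> \<in> visual_boundary" using v by (auto simp: visual_points_def)
      show ?thesis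
      proof (cases w)
        case (Inl z)
        then show ?thesis using no[OF _ \<xi>, of z] w eq v2 by (auto simp: visual_points_def)
      next
        case w2: (Inr \<zeta>)
        then have \<zeta>: "\<zeta> \<in> visual_boundary" using w by (auto simp: visual_points_def)
        obtain c where c: "c \<in> \<xi>" using visual_boundary_nonempty[OF \<xi>] by blast
        obtain c' where c': "c' \<in> \<zeta>" using visual_boundary_nonempty[OF \<zeta>] by blast
        have "busemann c x = busemann c' x + (busemann c base - busemann c' base)" if x: "x \<in> M" for x
          using fun_cong[OF eq, of x] v2 w2 by (simp add: visual_fun_Inr[OF \<xi> c x] visual_fun_Inr[OF \<zeta> c' x])
        then have "(c, c') \<in> asymptotic"
          using visual_boundaryD(1)[OF \<xi> c] visual_boundaryD(1)[OF \<zeta> c'] by (intro busemann_asymptotic)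
        then have "\<xi> = \<zeta>"
          using visual_boundaryD(2)[OF \<xi> c] visual_boundaryD(2)[OF \<zeta> c'] equiv_class_eq[OF equiv_asymptotic] by metis
        then show ?thesis using v2 w2 by simp
      qed
    qed
  qed
qed

text \<open>Finitely many values detect closeness to \<open>z\<close>. From \<open>base\<close> the
  function of \<open>y\<close> falls at unit rate towards \<open>y\<close>, but that of
  \<open>z\<close> is nowhere below \<open>- R\<close>; agreement on a net of the ball of radius
  \<open>R + 1\<close> therefore keeps \<open>y\<close> at distance less than
  \<open>R + 2 * \<epsilon>\<close>. The value at \<open>z\<close> then bounds
  \<open>d z y\<close>.\<close>

lemma visual_nbhd_Inl:
  assumes U: "openin mtopology U" and z: "z \<in> U"
  shows "\<exists>T \<epsilon>. finite T \<and> T \<subseteq> M \<and> 0 < \<epsilon> \<and>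
    (\<forall>w\<in>visual_points. (\<forall>x\<in>T. \<bar>visual_fun w x - visual_fun (Inl z) x\<bar> < \<epsilon>) \<longrightarrow> w \<in> Inl ` U)"
proof -
  have zM: "z \<in> M" using openin_subset[OF U] z by auto
  obtain \<delta> where \<delta>: "0 < \<delta>" "mball z \<delta> \<subseteq> U" using U z by (auto simp: openin_mtopology)
  \<comment> \<open>\<open>1/4\<close> keeps \<open>R + 2 * \<epsilon>\<close> below
    \<open>R + 1\<close>, which forces \<open>s = d base y\<close>; \<open>\<delta> / 3\<close>
    matches the final bound \<open>3 * \<epsilon>\<close> on \<open>d z y\<close>.\<close>
  define \<epsilon> where "\<epsilon> = min (1/4) (\<delta> / 3)"
  have \<epsilon>: "0 < \<epsilon>" "\<epsilon> \<le> 1/4" "3 * \<epsilon> \<le> \<delta>" using \<delta>(1) by (auto simp: \<epsilon>_def)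
  define R where "R = d base z"
  have R: "0 \<le> R" by (simp add: R_def)
  obtain T where T: "finite T" "T \<subseteq> M" "\<And>x. x \<in> mcball base (R + 1) \<Longrightarrow> \<exists>t\<in>T. d x t < \<epsilon>"
    using ex_finite_net[OF compactin_mcball[OF base_in_M] \<epsilon>(1)] by metis
  have near: "d z y < \<delta>" if y: "y \<in> M" and close: "\<forall>x\<in>insert z T. \<bar>visual_fun (Inl y) x - visual_fun (Inl z) x\<bar> < \<epsilon>" for y
  proof -
    define s where "s = min (d base y) (R + 1)"
    have s: "0 \<le> s" "s \<le> d base y" "s \<le> R + 1" using R by (auto simp: s_def)
    obtain p where p: "between base s y p" using ex_between[OF base_in_M y s(1,2)] by blast
    have pM: "p \<in> M" "d base p = s" "d p y = d base y - s" using betweenD[OF p] by auto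
    then obtain t where t: "t \<in> T" "d p t < \<epsilon>" using T(3)[of p] s by auto
    have tM: "t \<in> M" using t T by auto
    have "\<bar>(d t y - d base y) - (d t z - d base z)\<bar> < \<epsilon>" using close t tM by auto
    moreover have "d t y \<le> d p t + d p y" using triangle[of t p y] commute[of t p] tM pM y by simp
    moreover have "0 \<le> d t z" by simp
    ultimately have "s < R + 2 * \<epsilon>" using t(2) pM(3) unfolding R_def by linarith
    then have "d base y < R + 2 * \<epsilon>" using \<epsilon>(2) by (auto simp: s_def min_def split: if_splits)
    moreover have "\<bar>(d z y - d base y) - (d z z - d base z)\<bar> < \<epsilon>" using close zM by auto
    ultimately show ?thesis using \<epsilon>(3) zM by (simp add: R_def abs_less_iff)
  qed
  have "w \<in> Inl ` U" if w: "w \<in> visual_points" and close: "\<forall>x\<in>insert z T. \<bar>visual_fun w x - visual_fun (Inl z) x\<bar> < \<epsilon>" for w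
  proof (cases w)
    case (Inl y)
    then have y: "y \<in> M" using w by (auto simp: visual_points_def)
    have "d z y < \<delta>" by (rule near[OF y]) (use close Inl in blast)
    then show ?thesis using \<delta>(2) y zM Inl by auto
  next
    case (Inr \<xi>)
    then have \<xi>: "\<xi> \<in> visual_boundary" using w by (auto simp: visual_points_def)
    obtain c where c: "c \<in> \<xi>" using visual_boundary_nonempty[OF \<xi>] by blast
    note ray = visual_boundaryD(1)[OF \<xi> c]
    have "\<forall>\<^sub>F t in at_top. \<bar>visual_fun (Inl (c t)) x - visual_fun (Inl z) x\<bar> < \<epsilon>" if x: "x \<in> insert z T" for x
    proof -
      have "x \<in> M" using x T zM by auto
      then have "((\<lambda>t. \<bar>visual_fun (Inl (c t)) x - visual_fun (Inl z) x\<bar>) \<longlongrightarrow> \<bar>visual_fun w x - visual_fun (Inl z) x\<bar>) at_top"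
        unfolding Inr by (intro tendsto_intros visual_fun_tendsto[OF \<xi> c])
      then show ?thesis using close x by (intro order_tendstoD) auto
    qed
    then have "\<forall>\<^sub>F t in at_top. \<forall>x\<in>insert z T. \<bar>visual_fun (Inl (c t)) x - visual_fun (Inl z) x\<bar> < \<epsilon>"
      using T(1) by (simp only: eventually_ball_finite_distrib finite.insertI) blast
    \<comment> \<open>Far points of a ray to \<open>\<xi>\<close> inherit the closeness and would
      lie within \<open>\<delta>\<close> of \<open>z\<close>, which
      \<open>d (c 0) z + \<delta> \<le> t\<close> contradicts.\<close>
    then have "\<forall>\<^sub>F t in at_top. (\<forall>x\<in>insert z T. \<bar>visual_fun (Inl (c t)) x - visual_fun (Inl z) x\<bar> < \<epsilon>) \<and> 0 \<le> t \<and> d (c 0) z + \<delta> \<le> t"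
      by (intro eventually_conj eventually_ge_at_top)
    from eventually_happens'[OF trivial_limit_at_top_linorder this]
    obtain t where t: "\<forall>x\<in>insert z T. \<bar>visual_fun (Inl (c t)) x - visual_fun (Inl z) x\<bar> < \<epsilon>" "0 \<le> t" "d (c 0) z + \<delta> \<le> t"
      by blast
    have ct: "c t \<in> M" "c 0 \<in> M" "d (c 0) (c t) = t" using geodesic_rayD[OF ray] t(2) by auto
    have "d z (c t) < \<delta>" by (rule near[OF ct(1) t(1)])
    then show ?thesis using triangle[of "c 0" z "c t"] ct zM t(3) by linarith
  qed
  then show ?thesis using T zM \<epsilon>(1) by (intro exI[of _ "insert z T"] exI[of _ \<epsilon>]) auto
qed

text \<open>Moving \<open>y\<close> by less than \<open>\<delta>\<close> spoils the minimality of
  \<open>p\<close> by at most \<open>2 * \<delta>\<close>: once for the new target, once for the new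
  length. So \<open>between_dist_le\<close> bounds \<open>d p p'\<close>.\<close>

lemma openin_cone_trace:
  assumes c: "geodesic_ray c" and r: "0 < r"
  shows "openin mtopology {y \<in> M. Inl y \<in> cone_neighbourhood c r \<epsilon>}"
  unfolding openin_mtopology
proof (intro conjI allI impI)
  fix y assume "y \<in> {y \<in> M. Inl y \<in> cone_neighbourhood c r \<epsilon>}"
  then obtain p where y: "y \<in> M" "r < d (c 0) y" and p: "between (c 0) r y p" "d p (c r) < \<epsilon>"
    using cone_neighbourhood_iff[OF c r] by auto
  have cM: "c 0 \<in> M" "c r \<in> M" using geodesic_rayD[OF c] r by auto
  define \<eta> where "\<eta> = \<epsilon> - d p (c r)"
  have \<eta>: "0 < \<eta>" using p(2) by (simp add: \<eta>_def)
  obtain e where e: "0 < e" "2 * r * e + e\<^sup>2 < \<eta>\<^sup>2" using ex_small_error[OF less_imp_le[OF r] \<eta>] by auto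
  define \<delta> where "\<delta> = min (d (c 0) y - r) (e / 2)"
  have \<delta>: "0 < \<delta>" "\<delta> \<le> d (c 0) y - r" "2 * \<delta> \<le> e" using y e by (auto simp: \<delta>_def min_def)
  have "Inl y' \<in> cone_neighbourhood c r \<epsilon>" if y': "y' \<in> mball y \<delta>" for y'
  proof -
    have y'M: "y' \<in> M" "d y y' < \<delta>" using y' by auto
    have D: "d (c 0) y \<le> d (c 0) y' + d y y'" using triangle'[of "c 0" y' y] cM y y'M by simp
    then have r': "r < d (c 0) y'" using \<delta> y'M by linarith
    obtain p' where p': "between (c 0) r y' p'" using ex_between[OF cM(1) y'M(1), of r] r r' by auto
    have pM: "p \<in> M" "p' \<in> M" "d (c 0) p = r" "d p y = d (c 0) y - r" using betweenD p p' by auto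
    have "d p y' \<le> d (c 0) y' - r + e"
      using triangle[of p y y'] pM y y'M D \<delta>(3) by simp
    then have "(d p p')\<^sup>2 \<le> 2 * r * e + e\<^sup>2"
      using pM e by (intro between_dist_le[OF cM(1) y'M(1) pM(1) p']) auto
    then have "(d p p')\<^sup>2 < \<eta>\<^sup>2" using e by linarith
    then have "d p p' < \<eta>" using \<eta> by (auto intro: power2_less_imp_less)
    then have "d p' (c r) < \<epsilon>" using triangle''[of p' p "c r"] pM cM by (simp add: \<eta>_def)
    then show ?thesis unfolding cone_neighbourhood_iff[OF c r] using p' r' y'M by auto
  qed
  then show "\<exists>\<delta>>0. mball y \<delta> \<subseteq> {y \<in> M. Inl y \<in> cone_neighbourhood c r \<epsilon>}"
    using \<delta>(1) by (intro exI[of _ \<delta>]) auto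
qed auto

text \<open>At a boundary point three test points suffice, taken on the ray \<open>c'\<close> from
  \<open>b0\<close> to \<open>v\<close>. The drop from \<open>b0\<close> to \<open>c' r\<close>
  forces the geodesic towards \<open>w\<close> to pass near \<open>c' r\<close>; the drop to
  \<open>c' (r + 1)\<close> keeps an interior \<open>w\<close> beyond distance \<open>r\<close>,
  since \<open>e \<le> 1\<close>.\<close>

lemma visual_nbhd_cone:
  assumes c: "geodesic_ray c" and r: "0 < r" and v: "v \<in> cone_neighbourhood c r \<epsilon>"
  shows "\<exists>T \<delta>. finite T \<and> T \<subseteq> M \<and> 0 < \<delta> \<and>
    (\<forall>w\<in>visual_points. (\<forall>x\<in>T. \<bar>visual_fun w x - visual_fun v x\<bar> < \<delta>) \<longrightarrow> w \<in> cone_neighbourhood c r \<epsilon>)"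
proof (cases v)
  case (Inl y)
  let ?U = "{y \<in> M. Inl y \<in> cone_neighbourhood c r \<epsilon>}"
  have "y \<in> ?U" using v visual_subbasis_subset(1)[of c r \<epsilon>] by (auto simp: Inl visual_points_def)
  from visual_nbhd_Inl[OF openin_cone_trace[OF c r] this] show ?thesis
    unfolding Inl by (elim exE) (intro exI, auto)
next
  case (Inr \<xi>)
  then obtain c' where \<xi>: "\<xi> \<in> visual_boundary" and c': "c' \<in> \<xi>" "c' 0 = c 0" "d (c' r) (c r) < \<epsilon>"
    using v by (auto simp: cone_neighbourhood_def)
  note ray = visual_boundaryD(1)[OF \<xi> c'(1)]
  define b0 where "b0 = c 0"
  have M: "b0 \<in> M" "c r \<in> M" "c' r \<in> M" "c' (r + 1) \<in> M" using geodesic_rayD[OF c] geodesic_rayD[OF ray] r by (auto simp: b0_def)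
  define \<eta> where "\<eta> = \<epsilon> - d (c' r) (c r)"
  have \<eta>: "0 < \<eta>" using c'(3) by (simp add: \<eta>_def)
  obtain e where e: "0 < e" "e \<le> 1" "2 * r * e + e\<^sup>2 < \<eta>\<^sup>2" using ex_small_error[OF less_imp_le[OF r] \<eta>] by auto
  have v_ray: "visual_fun v (c' s) - visual_fun v b0 = - s" if "0 \<le> s" for s
    using visual_fun_Inr[OF \<xi> c'(1), of "c' s"] visual_fun_Inr[OF \<xi> c'(1) M(1)] busemann_ray[OF ray that]
      busemann_ray[OF ray, of 0] geodesic_rayD(1)[OF ray that] c'(2) by (simp add: Inr b0_def)
  have "w \<in> cone_neighbourhood c r \<epsilon>" if w: "w \<in> visual_points"
    and close: "\<forall>x\<in>{b0, c' r, c' (r + 1)}. \<bar>visual_fun w x - visual_fun v x\<bar> < e / 2" for w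
  proof -
    have 1: "visual_fun w (c' r) - visual_fun w b0 < - r + e"
      and 2: "visual_fun w (c' (r + 1)) - visual_fun w b0 < - (r + 1) + e"
  proof -
    have "\<bar>visual_fun w x - visual_fun v x\<bar> < e / 2" if "x \<in> {b0, c' r, c' (r + 1)}" for x
      using close that by blast
    then have "\<bar>visual_fun w b0 - visual_fun v b0\<bar> < e / 2" "\<bar>visual_fun w (c' r) - visual_fun v (c' r)\<bar> < e / 2"
      "\<bar>visual_fun w (c' (r + 1)) - visual_fun v (c' (r + 1))\<bar> < e / 2"
      by blast+
    moreover have "visual_fun v (c' r) - visual_fun v b0 = - r" "visual_fun v (c' (r + 1)) - visual_fun v b0 = - (r + 1)"
      using v_ray r by simp_all
    ultimately show "visual_fun w (c' r) - visual_fun w b0 < - r + e"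
      "visual_fun w (c' (r + 1)) - visual_fun w b0 < - (r + 1) + e"
      by argo+
  qed
  have far: "r < d b0 y" if "w = Inl y" for y
  proof -
    have "d (c' (r + 1)) y - d b0 y < - (r + 1) + e" using 2 that M by simp
    then show ?thesis using e(2) nonneg[of "c' (r + 1)" y] by linarith
  qed
    obtain p where p: "aims b0 r w p" using ex_aims[OF w M(1), of r] r far by force
    have pM: "p \<in> M" using aims_in_M[OF p] r by simp
    have "(d (c' r) p)\<^sup>2 \<le> 2 * r * e + e\<^sup>2"
      using geodesic_rayD(2)[OF ray, of 0 r] r c'(2) e
      by (intro aims_dist_le[OF p M(1,3) _ 1]) (auto simp: b0_def)
    then have "(d (c' r) p)\<^sup>2 < \<eta>\<^sup>2" using e by linarith
    then have "d (c' r) p < \<eta>" using \<eta> by (auto intro: power2_less_imp_less)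
    then have "d p (c r) < \<epsilon>" using triangle''[of p "c' r" "c r"] pM M by (simp add: \<eta>_def)
    then show ?thesis unfolding cone_neighbourhood_iff[OF c r] using p far by (auto simp: b0_def)
  qed
  then show ?thesis using M e by (intro exI[of _ "{b0, c' r, c' (r + 1)}"] exI[of _ "e / 2"]) auto
qed

text \<open>Continuity of the inverse is tested on the generating sets: around each of its points
  such a set contains a neighbourhood given by finitely many values of \<open>visual_fun\<close>.
  Rays from all base points are thus treated at once.\<close>

lemma homeomorphic_map_visual_fun:
  "homeomorphic_map visual_space (subtopology pointwise (visual_fun ` visual_points)) visual_fun"
proof -
  let ?E = "visual_fun ` visual_points" and ?g = "inv_into visual_points visual_fun"
  have topE: "topspace (subtopology pointwise ?E) = ?E"
    using visual_fun_extensional by (auto simp: topspace_pointwise simp del: topspace_product_topology)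
  have gf: "?g (visual_fun w) = w" if "w \<in> visual_points" for w
    using visual_fun_inj that by (rule inv_into_f_f)
  have "homeomorphic_maps visual_space (subtopology pointwise ?E) visual_fun ?g"
    unfolding homeomorphic_maps_def
  proof (intro conjI)
    show "continuous_map visual_space (subtopology pointwise ?E) visual_fun"
      using continuous_map_visual_fun by (auto simp: continuous_map_in_subtopology topspace_visual_space)
    show "continuous_map (subtopology pointwise ?E) visual_space ?g"
      unfolding visual_space_def
    proof (rule continuous_on_generated_topo)
      let ?S = "{Inl ` U |U. openin mtopology U} \<union> {cone_neighbourhood c r \<epsilon> |c r \<epsilon>. geodesic_ray c \<and> 0 < r \<and> 0 < \<epsilon>}"
      have "?g ` topspace (subtopology pointwise ?E) \<subseteq> visual_points"
        unfolding topE using gf by auto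
      then show "?g ` topspace (subtopology pointwise ?E) \<subseteq> \<Union>?S"
        using topspace_visual_space unfolding visual_space_def topology_generated_by_topspace by simp
      fix V assume V: "V \<in> ?S"
      have sub: "V \<subseteq> visual_points" using V visual_subbasis_subset by blast
      show "openin (subtopology pointwise ?E) (?g -` V \<inter> topspace (subtopology pointwise ?E))"
      proof (subst openin_subopen, intro ballI)
        fix f assume "f \<in> ?g -` V \<inter> topspace (subtopology pointwise ?E)"
        then obtain v where v: "v \<in> V" "f = visual_fun v" unfolding topE using gf by auto
        have "\<exists>T \<epsilon>. finite T \<and> T \<subseteq> M \<and> 0 < \<epsilon> \<and>
            (\<forall>w\<in>visual_points. (\<forall>x\<in>T. \<bar>visual_fun w x - visual_fun v x\<bar> < \<epsilon>) \<longrightarrow> w \<in> V)"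
          using V v(1) visual_nbhd_Inl visual_nbhd_cone by auto
        then obtain T \<epsilon> where T: "finite T" "T \<subseteq> M" "0 < \<epsilon>"
          "\<And>w. w \<in> visual_points \<Longrightarrow> (\<forall>x\<in>T. \<bar>visual_fun w x - visual_fun v x\<bar> < \<epsilon>) \<Longrightarrow> w \<in> V" by blast
        let ?N = "{h \<in> extensional M. \<forall>x\<in>T. \<bar>h x - visual_fun v x\<bar> < \<epsilon>} \<inter> ?E"
        have "openin (subtopology pointwise ?E) ?N"
          by (intro openin_subtopology_Int openin_pointwise_nbhd T)
        moreover have "f \<in> ?N" using v sub T(3) visual_fun_extensional by auto
        moreover have "?N \<subseteq> ?g -` V \<inter> topspace (subtopology pointwise ?E)"
          unfolding topE using T(4) gf by auto
        ultimately show "\<exists>N. openin (subtopology pointwise ?E) N \<and> f \<in> N \<and> N \<subseteq> ?g -` V \<inter> topspace (subtopology pointwise ?E)"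
          by blast
      qed
    qed
    show "\<forall>x\<in>topspace visual_space. ?g (visual_fun x) = x" by (simp add: topspace_visual_space gf)
    show "\<forall>y\<in>topspace (subtopology pointwise ?E). visual_fun (?g y) = y"
      unfolding topE using gf by auto
  qed
  then show ?thesis by (rule homeomorphic_maps_imp_map)
qed

lemma continuous_map_Inl: "continuous_map mtopology visual_space Inl"
  unfolding visual_space_def
proof (rule continuous_on_generated_topo)
  fix V assume "V \<in> {Inl ` U |U. openin mtopology U} \<union> {cone_neighbourhood c r \<epsilon> |c r \<epsilon>. geodesic_ray c \<and> 0 < r \<and> 0 < \<epsilon>}"
  then consider U where "V = Inl ` U" "openin mtopology U" | c r \<epsilon> where "V = cone_neighbourhood c r \<epsilon>" "geodesic_ray c" "0 < r"
    by blast
  then show "openin mtopology (Inl -` V \<inter> topspace mtopology)"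
  proof cases
    case 1
    then have "Inl -` V \<inter> topspace mtopology = U" using openin_subset[of mtopology U] by auto
    then show ?thesis using 1 by simp
  next
    case 2
    then have "Inl -` V \<inter> topspace mtopology = {y \<in> M. Inl y \<in> cone_neighbourhood c r \<epsilon>}" by auto
    then show ?thesis using openin_cone_trace[OF 2(2,3)] by simp
  qed
next
  show "Inl ` topspace mtopology \<subseteq> \<Union>({Inl ` U |U. openin mtopology U} \<union> {cone_neighbourhood c r \<epsilon> |c r \<epsilon>. geodesic_ray c \<and> 0 < r \<and> 0 < \<epsilon>})"
    using openin_topspace[of mtopology] by auto
qed

text \<open>Dichotomy for a limit \<open>f\<close>: either for some ball \<open>f\<close> is no
  limit of functions from outside it, and then it comes from that ball, whose image is compact; or
  such functions approximate \<open>f\<close> for every radius, and \<open>f\<close> is the Busemann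
  function of a ray from \<open>base\<close>.\<close>

lemma visual_fun_closure:
  "pointwise closure_of (visual_fun ` Inl ` M) = visual_fun ` visual_points"
proof
  show "visual_fun ` visual_points \<subseteq> pointwise closure_of (visual_fun ` Inl ` M)"
  proof
    fix f assume "f \<in> visual_fun ` visual_points"
    then obtain w where w: "w \<in> visual_points" "f = visual_fun w" by blast
    have sub: "visual_fun ` Inl ` M \<subseteq> topspace pointwise"
      using visual_fun_extensional by (auto simp: topspace_pointwise simp del: topspace_product_topology)
    show "f \<in> pointwise closure_of (visual_fun ` Inl ` M)"
    proof (cases w)
      case (Inl z)
      then have "z \<in> M" using w by (auto simp: visual_points_def)
      then show ?thesis using closure_of_subset[OF sub] unfolding w(2) Inl by blast
    next
      case (Inr \<xi>)
      then have \<xi>: "\<xi> \<in> visual_boundary" using w by (auto simp: visual_points_def)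
      obtain c where c: "c \<in> \<xi>" using visual_boundary_nonempty[OF \<xi>] by blast
      have "limitin pointwise (\<lambda>t. visual_fun (Inl (c t))) (visual_fun w) at_top"
        unfolding limitin_componentwise
        using visual_fun_extensional visual_fun_tendsto[OF \<xi> c] by (auto simp: Inr)
      moreover have "\<forall>\<^sub>F t in at_top. visual_fun (Inl (c t)) \<in> visual_fun ` Inl ` M"
        using eventually_ge_at_top[of 0]
        by eventually_elim (intro imageI geodesic_rayD(1)[OF visual_boundaryD(1)[OF \<xi> c]])
      ultimately show ?thesis
        unfolding w(2) using closure_of_subset[OF sub]
        by (elim limitin_closedin[OF _ closedin_closure_of] eventually_mono) auto
    qed
  qed
  show "pointwise closure_of (visual_fun ` Inl ` M) \<subseteq> visual_fun ` visual_points"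
  proof
    fix f assume f: "f \<in> pointwise closure_of (visual_fun ` Inl ` M)"
    have ext: "f \<in> extensional M"
      using f closure_of_subset_topspace[of pointwise] by (auto simp: topspace_pointwise simp del: topspace_product_topology)
    show "f \<in> visual_fun ` visual_points"
    proof (cases "\<exists>R. f \<notin> pointwise closure_of (visual_fun ` Inl ` (M - mcball base R))")
      case True
      then obtain R where R: "f \<notin> pointwise closure_of (visual_fun ` Inl ` (M - mcball base R))" by blast
      have "compactin pointwise ((visual_fun \<circ> Inl) ` mcball base R)"
        by (rule image_compactin[OF compactin_mcball[OF base_in_M] continuous_map_compose[OF continuous_map_Inl continuous_map_visual_fun]])
      then have closed: "closedin pointwise (visual_fun ` Inl ` mcball base R)"
        by (intro compactin_imp_closedin) (auto simp: Hausdorff_space_product_topology image_comp)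
      have "visual_fun ` Inl ` M = visual_fun ` Inl ` mcball base R \<union> visual_fun ` Inl ` (M - mcball base R)"
        by auto
      then have "f \<in> visual_fun ` Inl ` mcball base R \<union> pointwise closure_of (visual_fun ` Inl ` (M - mcball base R))"
        using f by (simp only: closure_of_Un closure_of_closedin[OF closed])
      then have "f \<in> visual_fun ` Inl ` mcball base R" using R by blast
      then show ?thesis by (auto simp: visual_points_def)
    next
      case False
      have "\<exists>c. geodesic_ray c \<and> c 0 = base \<and> (\<forall>x\<in>M. busemann c x = f x)"
      proof (rule horofunction_at_infinity_busemann[OF base_in_M])
        fix T and \<epsilon> R :: real assume T: "finite T" "T \<subseteq> M" "0 < \<epsilon>"
        let ?N = "{h \<in> extensional M. \<forall>x\<in>T. \<bar>h x - f x\<bar> < \<epsilon>}"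
        have N: "f \<in> ?N \<and> openin pointwise ?N" using ext T openin_pointwise_nbhd by auto
        have "f \<in> pointwise closure_of (visual_fun ` Inl ` (M - mcball base R))" using False by blast
        then have "\<forall>S. f \<in> S \<and> openin pointwise S \<longrightarrow> (\<exists>h. h \<in> visual_fun ` Inl ` (M - mcball base R) \<and> h \<in> S)"
          unfolding in_closure_of by (rule conjunct2)
        then have "\<exists>h. h \<in> visual_fun ` Inl ` (M - mcball base R) \<and> h \<in> ?N" using N by (elim allE[of _ ?N] impE)
        then obtain y where y: "y \<in> M" "\<not> d base y \<le> R" "\<forall>x\<in>T. \<bar>visual_fun (Inl y) x - f x\<bar> < \<epsilon>"
          by (auto simp del: visual_fun.simps)
        then have "R < d base y" by simp
        then show "\<exists>y\<in>M. R < d base y \<and> (\<forall>x\<in>T. \<bar>d x y - d base y - f x\<bar> < \<epsilon>)"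
          using T(2) y by (intro bexI[of _ y] conjI ballI) (auto simp: subset_iff)
      qed
      then obtain c where c: "geodesic_ray c" "c 0 = base" "\<forall>x\<in>M. busemann c x = f x" by blast
      let ?\<xi> = "asymptotic `` {c}"
      have \<xi>: "?\<xi> \<in> visual_boundary" "c \<in> ?\<xi>" using asymptotic_class_in_boundary[OF c(1)] by auto
      have "busemann c base = 0" using busemann_ray[OF c(1), of 0] c(2) by simp
      then have "visual_fun (Inr ?\<xi>) x = f x" if "x \<in> M" for x
        using visual_fun_Inr[OF \<xi> that] c(3) that by simp
      then have "f = visual_fun (Inr ?\<xi>)"
        using ext visual_fun_extensional by (intro extensionalityI[of f M]) auto
      then show ?thesis using \<xi> by (auto simp: visual_points_def)
    qed
  qed
qed

text \<open>Being 1-Lipschitz and 0 at \<open>base\<close>, the functions lie in a product of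
  compact intervals, which is compact by Tychonoff's theorem.\<close>

lemma compactin_visual_fun: "compactin pointwise (visual_fun ` visual_points)"
proof -
  have "compactin pointwise (PiE M (\<lambda>x. {- d base x .. d base x}))"
    unfolding compactin_PiE by auto
  moreover have "visual_fun ` visual_points \<subseteq> PiE M (\<lambda>x. {- d base x .. d base x})"
  proof (intro image_subsetI PiE_I)
    fix w x assume "w \<in> visual_points" "x \<in> M"
    then show "visual_fun w x \<in> {- d base x .. d base x}"
      using visual_fun_lipschitz[of w x base] by (auto simp: visual_fun_base commute[of x] abs_le_iff)
  qed (use visual_fun_extensional in \<open>auto simp: extensional_def\<close>)
  moreover have "closedin pointwise (visual_fun ` visual_points)"
    using closedin_closure_of[of pointwise] by (simp flip: visual_fun_closure)
  ultimately show ?thesis by (rule closed_compactin)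
qed

end

section \<open>The two compactifications\<close>

context proper_CAT0
begin

abbreviation mod_const :: "('a \<Rightarrow> real) \<Rightarrow> ('a \<Rightarrow> real) set" where
  "mod_const f \<equiv> differ_by_const `` {f}"

text \<open>A section of the quotient by constants: subtracting the value at \<open>base\<close>
  cancels the choice of representative.\<close>

definition normalized :: "('a \<Rightarrow> real) set \<Rightarrow> 'a \<Rightarrow> real" where
  "normalized u = restrict (\<lambda>x. (SOME f. f \<in> u) x - (SOME f. f \<in> u) base) M"

lemma differ_by_constD:
  "(f, g) \<in> differ_by_const \<Longrightarrow> x \<in> M \<Longrightarrow> y \<in> M \<Longrightarrow> g x - g y = f x - f y"
  unfolding differ_by_const_def by force

lemma equiv_differ_by_const: "equiv continuous_funs differ_by_const"
proof (rule equivI)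
  show "differ_by_const \<subseteq> continuous_funs \<times> continuous_funs" by (auto simp: differ_by_const_def)
  show "refl_on continuous_funs differ_by_const"
    by (auto simp: refl_on_def differ_by_const_def intro!: exI[of _ 0])
  show "sym differ_by_const"
  proof (rule symI)
    fix f g assume "(f, g) \<in> differ_by_const"
    then obtain c where "f \<in> continuous_funs" "g \<in> continuous_funs" "\<forall>x\<in>M. g x = f x + c"
      by (auto simp: differ_by_const_def)
    then show "(g, f) \<in> differ_by_const" by (auto simp: differ_by_const_def intro!: exI[of _ "- c"])
  qed
  show "trans differ_by_const"
  proof (rule transI)
    fix f g h assume "(f, g) \<in> differ_by_const" "(g, h) \<in> differ_by_const"
    then obtain c c' where "f \<in> continuous_funs" "h \<in> continuous_funs" "\<forall>x\<in>M. g x = f x + c" "\<forall>x\<in>M. h x = g x + c'"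
      unfolding differ_by_const_def by blast
    then show "(f, h) \<in> differ_by_const" by (auto simp: differ_by_const_def intro!: exI[of _ "c + c'"])
  qed
qed

lemma normalized_mod_const:
  assumes f: "f \<in> continuous_funs" and x: "x \<in> M"
  shows "normalized (mod_const f) x = f x - f base"
proof -
  define g where "g = (SOME g. g \<in> mod_const f)"
  have "f \<in> mod_const f" using equiv_class_self[OF equiv_differ_by_const f] .
  then have "g \<in> mod_const f" unfolding g_def using someI[of "\<lambda>g. g \<in> mod_const f" f] by blast
  then have "(f, g) \<in> differ_by_const" by simp
  from differ_by_constD[OF this x base_in_M] show ?thesis using x by (simp add: normalized_def g_def)
qed

lemma mod_const_normalized:
  assumes u: "u \<in> continuous_funs // differ_by_const"
  shows "normalized u \<in> continuous_funs" "mod_const (normalized u) = u"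
proof -
  obtain f where f: "f \<in> continuous_funs" "u = mod_const f" using u by (auto elim: quotientE)
  have n: "normalized u x = f x - f base" if "x \<in> M" for x
    using normalized_mod_const[OF f(1) that] f(2) by simp
  have "continuous_map mtopology euclideanreal (\<lambda>x. f x - f base)"
    using f(1) by (intro continuous_intros) (auto simp: continuous_funs_def)
  then have "continuous_map mtopology euclideanreal (normalized u)"
    by (rule continuous_map_eq) (simp add: n)
  then show cf: "normalized u \<in> continuous_funs" by (auto simp: continuous_funs_def normalized_def)
  have "(f, normalized u) \<in> differ_by_const"
    using f(1) cf n by (auto simp: differ_by_const_def intro!: exI[of _ "- f base"])
  then show "mod_const (normalized u) = u" using equiv_class_eq[OF equiv_differ_by_const] f(2) by metis
qed

lemma topspace_funs_mod_const: "topspace funs_mod_const = continuous_funs // differ_by_const"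
proof
  show "topspace funs_mod_const \<subseteq> continuous_funs // differ_by_const"
    using openin_topspace[of funs_mod_const] unfolding openin_funs_mod_const by blast
  have "{f \<in> continuous_funs. mod_const f \<in> continuous_funs // differ_by_const} = continuous_funs"
    by (auto intro: quotientI)
  moreover have "openin compact_convergence continuous_funs"
    unfolding openin_compact_convergence by (auto intro!: exI[of _ "{}"] exI[of _ 1])
  ultimately have "openin funs_mod_const (continuous_funs // differ_by_const)"
    unfolding openin_funs_mod_const by simp
  then show "continuous_funs // differ_by_const \<subseteq> topspace funs_mod_const" by (rule openin_subset)
qed

text \<open>Only the values at \<open>x\<close> and \<open>base\<close> enter, and
  \<open>{x, base}\<close> is compact, so preimages are open for uniform convergence on compact
  sets.\<close>

lemma continuous_map_normalized: "continuous_map funs_mod_const pointwise normalized"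
proof -
  have "continuous_map funs_mod_const euclideanreal (\<lambda>u. normalized u x)" if x: "x \<in> M" for x
    unfolding continuous_map_def
  proof (intro conjI allI impI)
    fix U assume "openin euclideanreal U"
    then have U: "open U" by simp
    have "openin compact_convergence {f \<in> continuous_funs. f x - f base \<in> U}"
      unfolding openin_compact_convergence
    proof (intro conjI ballI)
      fix f assume "f \<in> {f \<in> continuous_funs. f x - f base \<in> U}"
      then obtain \<delta> where \<delta>: "0 < \<delta>" "ball (f x - f base) \<delta> \<subseteq> U" using U open_contains_ball by blast
      have "{g \<in> continuous_funs. \<forall>y\<in>{x, base}. \<bar>g y - f y\<bar> < \<delta> / 2} \<subseteq> {g \<in> continuous_funs. g x - g base \<in> U}"
      proof safe
        fix g assume g: "g \<in> continuous_funs" "\<forall>y\<in>{x, base}. \<bar>g y - f y\<bar> < \<delta> / 2"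
        then have "\<bar>g x - f x\<bar> < \<delta> / 2" "\<bar>g base - f base\<bar> < \<delta> / 2" by blast+
        then have "dist (f x - f base) (g x - g base) < \<delta>" unfolding dist_real_def by linarith
        then show "g x - g base \<in> U" using \<delta>(2) by auto
      qed
      then show "\<exists>K \<epsilon>. compactin mtopology K \<and> 0 < \<epsilon> \<and>
          {g \<in> continuous_funs. \<forall>y\<in>K. \<bar>g y - f y\<bar> < \<epsilon>} \<subseteq> {f \<in> continuous_funs. f x - f base \<in> U}"
        using \<delta>(1) x by (intro exI[of _ "{x, base}"] exI[of _ "\<delta> / 2"]) (auto intro: finite_imp_compactin)
    qed auto
    moreover have "{f \<in> continuous_funs. mod_const f \<in> {u \<in> topspace funs_mod_const. normalized u x \<in> U}}
        = {f \<in> continuous_funs. f x - f base \<in> U}"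
      using normalized_mod_const[OF _ x] by (auto simp: topspace_funs_mod_const quotientI)
    ultimately show "openin funs_mod_const {u \<in> topspace funs_mod_const. normalized u x \<in> U}"
      unfolding openin_funs_mod_const by (auto simp: topspace_funs_mod_const)
  qed auto
  then show ?thesis by (auto simp: continuous_map_componentwise normalized_def)
qed

lemma Hausdorff_funs_mod_const: "Hausdorff_space funs_mod_const"
proof (rule Hausdorff_space_injective_preimage[OF _ continuous_map_normalized])
  show "inj_on normalized (topspace funs_mod_const)"
    unfolding topspace_funs_mod_const by (rule inj_on_inverseI[of _ mod_const]) (rule mod_const_normalized)
qed (simp add: Hausdorff_space_product_topology)

lemma visual_fun_continuous: "w \<in> visual_points \<Longrightarrow> visual_fun w \<in> continuous_funs"
  unfolding continuous_funs_def
  using lipschitz_continuous_map[of "visual_fun w"] visual_fun_lipschitz[of w] visual_fun_extensional by auto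

text \<open>On functions that are 1-Lipschitz, pointwise convergence implies uniform convergence on
  compact sets.\<close>

lemma continuous_map_mod_const:
  "continuous_map (subtopology pointwise (visual_fun ` visual_points)) funs_mod_const mod_const"
  unfolding continuous_map_def
proof (intro conjI allI impI)
  let ?E = "visual_fun ` visual_points"
  have topE: "topspace (subtopology pointwise ?E) = ?E"
    using visual_fun_extensional by (auto simp: topspace_pointwise simp del: topspace_product_topology)
  show "mod_const \<in> topspace (subtopology pointwise ?E) \<rightarrow> topspace funs_mod_const"
    unfolding topE topspace_funs_mod_const using visual_fun_continuous by (auto intro: quotientI)
  fix V assume "openin funs_mod_const V"
  then have V: "openin compact_convergence {f \<in> continuous_funs. mod_const f \<in> V}"
    by (simp add: openin_funs_mod_const)
  show "openin (subtopology pointwise ?E) {f \<in> topspace (subtopology pointwise ?E). mod_const f \<in> V}"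
    unfolding topE
  proof (subst openin_subopen, intro ballI)
    fix f assume "f \<in> {f \<in> ?E. mod_const f \<in> V}"
    then have f: "f \<in> ?E" "f \<in> {f \<in> continuous_funs. mod_const f \<in> V}" using visual_fun_continuous by auto
    obtain K \<epsilon> where K: "compactin mtopology K" "0 < \<epsilon>"
        "{g \<in> continuous_funs. \<forall>x\<in>K. \<bar>g x - f x\<bar> < \<epsilon>} \<subseteq> {f \<in> continuous_funs. mod_const f \<in> V}"
      using V f(2) unfolding openin_compact_convergence by blast
    obtain T where T: "finite T" "T \<subseteq> K" "T \<subseteq> M" "\<And>x. x \<in> K \<Longrightarrow> \<exists>t\<in>T. d x t < \<epsilon> / 3"
      using ex_finite_net[OF K(1), of "\<epsilon> / 3"] K(2) by auto
    let ?N = "{g \<in> extensional M. \<forall>x\<in>T. \<bar>g x - f x\<bar> < \<epsilon> / 3} \<inter> ?E"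
    have lip: "\<bar>g x - g y\<bar> \<le> d x y" if "g \<in> ?E" "x \<in> M" "y \<in> M" for g x y
      using that visual_fun_lipschitz by auto
    have "g \<in> {f \<in> ?E. mod_const f \<in> V}" if g: "g \<in> ?N" for g
    proof -
      have "\<bar>g x - f x\<bar> < \<epsilon>" if x: "x \<in> K" for x
      proof -
        obtain t where t: "t \<in> T" "d x t < \<epsilon> / 3" using T(4)[OF x] by blast
        have M: "x \<in> M" "t \<in> M" using x t T(3) compactin_subset_topspace[OF K(1)] by auto
        have "\<bar>g t - f t\<bar> < \<epsilon> / 3" using g t(1) by blast
        moreover have "\<bar>f x - f t\<bar> \<le> d x t" by (rule lip[OF f(1) M])
        moreover have "\<bar>g x - g t\<bar> \<le> d x t" using g by (intro lip[OF _ M]) blast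
        ultimately show ?thesis using t(2) by linarith
      qed
      then have "g \<in> {f \<in> continuous_funs. mod_const f \<in> V}" using K(3) g visual_fun_continuous by blast
      then show ?thesis using g by blast
    qed
    moreover have "openin (subtopology pointwise ?E) ?N"
      by (intro openin_subtopology_Int openin_pointwise_nbhd T)
    moreover have "f \<in> ?N" using f K(2) visual_fun_extensional by auto
    ultimately show "\<exists>N. openin (subtopology pointwise ?E) N \<and> f \<in> N \<and> N \<subseteq> {f \<in> ?E. mod_const f \<in> V}" by blast
  qed
qed

lemma normalized_visual_fun:
  assumes "w \<in> visual_points"
  shows "normalized (mod_const (visual_fun w)) = visual_fun w"
proof (rule extensionalityI[of _ M])
  show "normalized (mod_const (visual_fun w)) \<in> extensional M" by (simp add: normalized_def)
  show "normalized (mod_const (visual_fun w)) x = visual_fun w x" if "x \<in> M" for x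
    using normalized_mod_const[OF visual_fun_continuous[OF assms] that] by (simp add: visual_fun_base)
qed (rule visual_fun_extensional)

lemma horo_embedding_eq:
  assumes z: "z \<in> M"
  shows "horo_embedding z = mod_const (visual_fun (Inl z))"
proof -
  have "continuous_map mtopology euclideanreal (restrict (\<lambda>x. d x z) M)"
    using mdist_reverse_triangle[of _ z] z commute[of z] by (intro lipschitz_continuous_map) auto
  then have "restrict (\<lambda>x. d x z) M \<in> continuous_funs" by (auto simp: continuous_funs_def)
  then have "(restrict (\<lambda>x. d x z) M, visual_fun (Inl z)) \<in> differ_by_const"
    using visual_fun_continuous[of "Inl z"] z
    by (auto simp: differ_by_const_def visual_points_def intro!: exI[of _ "- d base z"])
  then show ?thesis unfolding horo_embedding_def by (rule equiv_class_eq[OF equiv_differ_by_const])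
qed

text \<open>The image of the compact model is closed in a Hausdorff space, which bounds the closure
  from above; continuity carries over the density of the interior functions, which gives the
  rest.\<close>

lemma horo_embedding_closure:
  "funs_mod_const closure_of (horo_embedding ` M) = mod_const ` visual_fun ` visual_points"
proof
  let ?E = "visual_fun ` visual_points"
  have img: "horo_embedding ` M = mod_const ` visual_fun ` Inl ` M" using horo_embedding_eq by force
  have "compactin (subtopology pointwise ?E) ?E" using compactin_visual_fun by (simp add: compactin_subtopology)
  then have "compactin funs_mod_const (mod_const ` ?E)" using image_compactin continuous_map_mod_const by blast
  then have "closedin funs_mod_const (mod_const ` ?E)"
    by (rule compactin_imp_closedin[OF Hausdorff_funs_mod_const])
  then show "funs_mod_const closure_of (horo_embedding ` M) \<subseteq> mod_const ` ?E"
    by (intro closure_of_minimal) (auto simp: img visual_points_def)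
  have "mod_const ` (subtopology pointwise ?E closure_of (visual_fun ` Inl ` M)) \<subseteq> funs_mod_const closure_of (horo_embedding ` M)"
    unfolding img by (rule continuous_map_image_closure_subset[OF continuous_map_mod_const])
  moreover have "visual_fun ` Inl ` M \<subseteq> ?E" by (auto simp: visual_points_def)
  then have "subtopology pointwise ?E closure_of (visual_fun ` Inl ` M) = ?E"
    unfolding closure_of_subtopology by (simp add: Int_absorb1 visual_fun_closure)
  ultimately show "mod_const ` ?E \<subseteq> funs_mod_const closure_of (horo_embedding ` M)" by simp
qed

lemma homeomorphic_map_mod_const:
  "homeomorphic_map (subtopology pointwise (visual_fun ` visual_points)) horofunction_space mod_const"
proof -
  let ?E = "visual_fun ` visual_points"
  have topE: "topspace (subtopology pointwise ?E) = ?E"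
    using visual_fun_extensional by (auto simp: topspace_pointwise simp del: topspace_product_topology)
  have sub: "mod_const ` ?E \<subseteq> topspace funs_mod_const"
    unfolding horo_embedding_closure[symmetric] by (rule closure_of_subset_topspace)
  have "homeomorphic_maps (subtopology pointwise ?E) horofunction_space mod_const normalized"
    unfolding homeomorphic_maps_def horofunction_space_def horo_embedding_closure
  proof (intro conjI)
    show "continuous_map (subtopology pointwise ?E) (subtopology funs_mod_const (mod_const ` ?E)) mod_const"
      using continuous_map_mod_const topE by (auto simp: continuous_map_in_subtopology)
    show "continuous_map (subtopology funs_mod_const (mod_const ` ?E)) (subtopology pointwise ?E) normalized"
      using continuous_map_from_subtopology[OF continuous_map_normalized] normalized_visual_fun
      by (auto simp: continuous_map_in_subtopology)
    show "\<forall>f\<in>topspace (subtopology pointwise ?E). normalized (mod_const f) = f"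
      unfolding topE using normalized_visual_fun by auto
    show "\<forall>u\<in>topspace (subtopology funs_mod_const (mod_const ` ?E)). mod_const (normalized u) = u"
      using mod_const_normalized(2) by (auto simp: topspace_funs_mod_const)
  qed
  then show ?thesis by (rule homeomorphic_maps_imp_map)
qed

text \<open>Each property is proved on one side and carried over: the embedding for
  \<open>Inl\<close>, which is an open map; the Hausdorff property and density for the horofunction
  space; compactness comes from the model.\<close>

theorem horofunction_compactification_visual:
  "isomorphic_compactifications mtopology horofunction_space horo_embedding visual_space Inl"
proof -
  let ?h = "mod_const \<circ> visual_fun"
  have h: "homeomorphic_map visual_space horofunction_space ?h"
    by (rule homeomorphic_map_compose[OF homeomorphic_map_visual_fun homeomorphic_map_mod_const])
  then obtain g where g: "homeomorphic_maps visual_space horofunction_space ?h g"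
    unfolding homeomorphic_map_maps by blast
  then have g': "homeomorphic_map horofunction_space visual_space g"
    using homeomorphic_maps_sym homeomorphic_maps_imp_map by blast
  have gh: "g (horo_embedding z) = Inl z" if z: "z \<in> M" for z
  proof -
    have "Inl z \<in> topspace visual_space" using z by (simp add: topspace_visual_space visual_points_def)
    then show ?thesis using g z by (simp add: homeomorphic_maps_def horo_embedding_eq del: visual_fun.simps)
  qed
  have top_horo: "topspace horofunction_space = funs_mod_const closure_of (horo_embedding ` M)"
    unfolding horofunction_space_def using closure_of_subset_topspace[of funs_mod_const] by auto
  have "horo_embedding ` M \<subseteq> topspace funs_mod_const"
    using horo_embedding_eq visual_fun_continuous[of "Inl _"]
    by (auto simp: topspace_funs_mod_const visual_points_def intro!: quotientI)
  then have dense: "horofunction_space closure_of (horo_embedding ` M) = topspace horofunction_space"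
    unfolding top_horo unfolding horofunction_space_def closure_of_subtopology
    by (simp add: closure_of_subset Int_absorb1)
  have sub: "horo_embedding ` M \<subseteq> topspace horofunction_space"
    unfolding top_horo using \<open>horo_embedding ` M \<subseteq> topspace funs_mod_const\<close> by (rule closure_of_subset)
  have compact: "compact_space horofunction_space"
  proof -
    have "compact_space (subtopology pointwise (visual_fun ` visual_points))"
      by (rule compact_space_subtopology[OF compactin_visual_fun])
    then show ?thesis
      using homeomorphic_compact_space[OF homeomorphic_map_imp_homeomorphic_space[OF homeomorphic_map_mod_const]] by simp
  qed
  have haus: "Hausdorff_space horofunction_space"
    unfolding horofunction_space_def by (rule Hausdorff_space_subtopology[OF Hausdorff_funs_mod_const])
  have emb: "embedding_map mtopology visual_space Inl"
  proof (rule injective_open_imp_embedding_map[OF continuous_map_Inl])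
    show "open_map mtopology visual_space Inl" by (simp add: open_map_def openin_visual_Inl)
  qed simp
  have "embedding_map mtopology horofunction_space (?h \<circ> Inl)"
  proof (rule embedding_map_compose[OF emb])
    show "embedding_map visual_space horofunction_space ?h"
      unfolding embedding_map_def using h homeomorphic_imp_surjective_map[OF h] by simp
  qed
  then have "embedding_map mtopology horofunction_space horo_embedding"
    by (rule embedding_map_eq) (simp add: horo_embedding_eq del: visual_fun.simps)
  then have 1: "compactification mtopology horofunction_space horo_embedding"
    using compact haus dense by (simp add: compactification_def)
  have "visual_space closure_of (g ` horo_embedding ` M) = g ` topspace horofunction_space"
    unfolding homeomorphic_map_closure_of[OF g' sub] dense ..
  also have "\<dots> = topspace visual_space" using g' by (rule homeomorphic_imp_surjective_map)
  also have "g ` horo_embedding ` M = Inl ` M" using gh by force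
  finally have "visual_space closure_of (Inl ` M) = topspace visual_space" .
  then have 2: "compactification mtopology visual_space Inl"
    using compact haus emb homeomorphic_map_imp_homeomorphic_space[OF g']
    by (simp add: compactification_def homeomorphic_compact_space homeomorphic_Hausdorff_space)
  show ?thesis
    unfolding isomorphic_compactifications_def using 1 2 g' gh by auto
qed

end

theorem corollary1p4:
  fixes P :: "(real^'n^'n) set"
  defines "P \<equiv> flat_torus_teich"
  assumes "CARD('n) \<ge> 2"
  shows "isomorphic_compactifications (Metric_space.mtopology P wp_dist)
           (Metric_space.horofunction_space P wp_dist) (Metric_space.horo_embedding P wp_dist)
           (Metric_space.visual_space P wp_dist) Inl"
proof -
  have "proper_CAT0 P wp_dist"
    unfolding P_def proper_CAT0_def proper_CAT0_axioms_def
    using wp_dist_metric compactin_wp_mcball wp_dist_stewart mat_1_flat_torus_teich by blast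
  then show ?thesis by (rule proper_CAT0.horofunction_compactification_visual)
qed

end
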